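(* For every constant $\alpha>0$ there exist constants $C_p,C_d>0$ and $c>0$ (depending on nothing other than possibly $\alpha$) such that for all integers $n\ge 1$, $d\ge 2$ and all real $p$ with $$d\ge C_d\,(n^2p^2+\log^4(n))\log^4(n),\qquad \frac{\alpha}{n}<p<\frac12,\qquad np\ge C_p\log^2(n),$$ a random geometric graph $G$ sampled from $G(n,p,d)$ is globally synchronizing with probability at least $1-n^{-c}$.
   Context: Random geometric graph on the sphere $G(n,p,d)$: let $X_1,\dots,X_n$ be independent points, each uniformly distributed on the unit sphere $\mathbb{S}^{d-1}\subset\mathbb{R}^d$. Let $t_{p,d}\in[-1,1]$ be the number with $\mathbb{P}(\langle X_i,X_j\rangle\ge t_{p,d})=p$ for $i\ne j$. The graph $G(n,p,d)$ has vertex set $[n]=\{1,\dots,n\}$, and for $i\neq j$ the pair $\{i,j\}$ is an edge if and only if $\langle X_i,X_j\rangle\ge t_{p,d}$. Globally synchronizing: for a graph $G$ on $[n]$ with adjacency matrix $(a_{ij})$, the (homogeneous) Kuramoto energy is $E_G(\theta)=\sum_{i,j=1}^n a_{ij}\,(1-\cos(\theta_i-\theta_j))$, for angles $\theta=(\theta_1,\dots,\theta_n)\in(\mathbb{R}/2\pi\mathbb{Z})^n$. The graph $G$ is globally synchronizing (one also says $G$ synchronizes) if every local minimum of $E_G$ is constant, i.e. satisfies $\theta_1=\dots=\theta_n$ (as angles modulo $2\pi$). *)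

theory Defs
  imports "HOL-Probability.Probability" "HOL-Library.Real_Mod"
begin

text \<open>
  Since the dimension varies inside the statement, a vector of $R^d$ is a function on
  the index set \<^term>\<open>{..<d::nat}\<close>, as in the product measure spaces of the library.
\<close>

definition dot :: "nat \<Rightarrow> (nat \<Rightarrow> real) \<Rightarrow> (nat \<Rightarrow> real) \<Rightarrow> real" where
  "dot d x y = (\<Sum>k<d. x k * y k)"

definition unit_ball :: "nat \<Rightarrow> (nat \<Rightarrow> real) set" where
  "unit_ball d = {x \<in> space (\<Pi>\<^sub>M k\<in>{..<d}. lborel). L2_set x {..<d} \<le> 1}"

definition radial_proj :: "nat \<Rightarrow> (nat \<Rightarrow> real) \<Rightarrow> nat \<Rightarrow> real" where
  "radial_proj d x = (\<lambda>k\<in>{..<d}. x k / L2_set x {..<d})"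

text \<open>
  The uniform distribution on the unit sphere, as the normalised cone measure: the law of
  \<open>x / |x|\<close> for \<open>x\<close> uniform in the unit ball. It lives on all of $R^d$ but is
  concentrated on the sphere. The origin, which \<^const>\<open>radial_proj\<close> fixes, has measure
  zero for \<open>d \<ge> 1\<close>.
\<close>

definition uniform_sphere :: "nat \<Rightarrow> (nat \<Rightarrow> real) measure" where
  "uniform_sphere d =
     distr (uniform_measure (\<Pi>\<^sub>M k\<in>{..<d}. lborel) (unit_ball d))
       (\<Pi>\<^sub>M k\<in>{..<d}. borel) (radial_proj d)"

definition uniform_points :: "nat \<Rightarrow> nat \<Rightarrow> (nat \<Rightarrow> nat \<Rightarrow> real) measure" where
  "uniform_points n d = (\<Pi>\<^sub>M i\<in>{1..n}. uniform_sphere d)"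

text \<open>For \<open>d \<ge> 2\<close> and \<open>0 < p < 1\<close> there is exactly one such threshold.\<close>

definition threshold :: "real \<Rightarrow> nat \<Rightarrow> real" where
  "threshold p d = (THE t. t \<in> {-1..1} \<and>
     \<P>(z in uniform_sphere d \<Otimes>\<^sub>M uniform_sphere d. dot d (fst z) (snd z) \<ge> t) = p)"

text \<open>A graph on \<^term>\<open>{1..n::nat}\<close> is given by its adjacency relation.\<close>

definition geometric_graph ::
    "nat \<Rightarrow> real \<Rightarrow> nat \<Rightarrow> (nat \<Rightarrow> nat \<Rightarrow> real) \<Rightarrow> nat \<Rightarrow> nat \<Rightarrow> bool" where
  "geometric_graph n p d X i j \<longleftrightarrow>
     i \<in> {1..n} \<and> j \<in> {1..n} \<and> i \<noteq> j \<and> dot d (X i) (X j) \<ge> threshold p d"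

definition kuramoto_energy :: "nat \<Rightarrow> (nat \<Rightarrow> nat \<Rightarrow> bool) \<Rightarrow> (nat \<Rightarrow> real) \<Rightarrow> real" where
  "kuramoto_energy n G \<theta> =
     (\<Sum>i\<in>{1..n}. \<Sum>j\<in>{1..n}. of_bool (G i j) * (1 - cos (\<theta> i - \<theta> j)))"

text \<open>
  Angles are represented by real lifts. The quotient map from $R^n$ to the torus is a
  local homeomorphism, so local minimality may be tested on any lift.
\<close>

definition energy_local_min :: "nat \<Rightarrow> (nat \<Rightarrow> nat \<Rightarrow> bool) \<Rightarrow> (nat \<Rightarrow> real) \<Rightarrow> bool" where
  "energy_local_min n G \<theta> \<longleftrightarrow>
     (\<exists>\<epsilon>>0. \<forall>\<phi>. (\<forall>i\<in>{1..n}. \<bar>\<phi> i - \<theta> i\<bar> < \<epsilon>) \<longrightarrow>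
        kuramoto_energy n G \<theta> \<le> kuramoto_energy n G \<phi>)"

definition globally_synchronizing :: "nat \<Rightarrow> (nat \<Rightarrow> nat \<Rightarrow> bool) \<Rightarrow> bool" where
  "globally_synchronizing n G \<longleftrightarrow>
     (\<forall>\<theta>. energy_local_min n G \<theta> \<longrightarrow>
        (\<forall>i\<in>{1..n}. \<forall>j\<in>{1..n}. [\<theta> i = \<theta> j] (rmod (2 * pi))))"

subsection \<open>Well-definedness\<close>

lemma L2_set_measurable_PiM [measurable]:
  "(\<lambda>x. L2_set x {..<d}) \<in> borel_measurable (\<Pi>\<^sub>M k\<in>{..<d}. lborel)"
  unfolding L2_set_def by measurable

lemma unit_ball_sets [measurable]: "unit_ball d \<in> sets (\<Pi>\<^sub>M k\<in>{..<d}. lborel)"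
  unfolding unit_ball_def by measurable

lemma measurable_radial_proj [measurable]:
  "radial_proj d \<in> (\<Pi>\<^sub>M k\<in>{..<d}. lborel) \<rightarrow>\<^sub>M (\<Pi>\<^sub>M k\<in>{..<d}. borel)"
  unfolding radial_proj_def by measurable

lemma sets_uniform_sphere [measurable_cong, simp]:
  "sets (uniform_sphere d) = sets (\<Pi>\<^sub>M k\<in>{..<d}. borel)"
  by (simp add: uniform_sphere_def)

lemma emeasure_unit_ball:
  "emeasure (\<Pi>\<^sub>M k\<in>{..<d}. lborel) (unit_ball d) \<noteq> 0"
  "emeasure (\<Pi>\<^sub>M k\<in>{..<d}. lborel) (unit_ball d) \<noteq> \<infinity>"
proof -
  interpret product_sigma_finite "\<lambda>_::nat. lborel :: real measure"
    by unfold_locales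
  let ?M = "\<Pi>\<^sub>M k\<in>{..<d}. lborel :: real measure"
  let ?s = "1 / real (d + 1)"
  have "(\<Pi>\<^sub>E k\<in>{..<d}. {0..?s}) \<subseteq> unit_ball d"
  proof
    fix x assume x: "x \<in> (\<Pi>\<^sub>E k\<in>{..<d}. {0..?s})"
    have "L2_set x {..<d} \<le> (\<Sum>k<d. \<bar>x k\<bar>)" by (rule L2_set_le_sum_abs)
    also have "\<dots> \<le> (\<Sum>k<d. ?s)" using x by (intro sum_mono) (auto simp: PiE_iff)
    also have "\<dots> \<le> 1" by simp
    finally show "x \<in> unit_ball d"
      using x by (auto simp: unit_ball_def space_PiM PiE_iff)
  qed
  then have "emeasure ?M (\<Pi>\<^sub>E k\<in>{..<d}. {0..?s}) \<le> emeasure ?M (unit_ball d)"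
    by (intro emeasure_mono) auto
  moreover have "emeasure ?M (\<Pi>\<^sub>E k\<in>{..<d}. {0..?s}) = (\<Prod>k<d. ennreal ?s)"
    by (subst emeasure_PiM) auto
  ultimately have "ennreal ?s ^ d \<le> emeasure ?M (unit_ball d)" by simp
  moreover have "ennreal ?s ^ d > 0" by (simp add: ennreal_power)
  ultimately show "emeasure ?M (unit_ball d) \<noteq> 0" by (metis not_le)
  have "unit_ball d \<subseteq> (\<Pi>\<^sub>E k\<in>{..<d}. {-1..1})"
  proof
    fix x assume x: "x \<in> unit_ball d"
    have "x k \<in> {-1..1}" if "k < d" for k
    proof -
      have "\<bar>x k\<bar> \<le> L2_set (\<lambda>k. \<bar>x k\<bar>) {..<d}"
        using that by (intro member_le_L2_set) auto
      also have "\<dots> = L2_set x {..<d}" by (simp add: L2_set_def)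
      finally show ?thesis using x by (auto simp: unit_ball_def)
    qed
    then show "x \<in> (\<Pi>\<^sub>E k\<in>{..<d}. {-1..1})"
      using x by (auto simp: unit_ball_def space_PiM PiE_iff)
  qed
  then have "emeasure ?M (unit_ball d) \<le> emeasure ?M (\<Pi>\<^sub>E k\<in>{..<d}. {-1..1})"
    by (intro emeasure_mono) auto
  also have "\<dots> = (\<Prod>k<d. ennreal 2)"
    by (subst emeasure_PiM) auto
  also have "\<dots> < \<infinity>" by (simp add: ennreal_power power_less_top_ennreal)
  finally show "emeasure ?M (unit_ball d) \<noteq> \<infinity>" by simp
qed

lemma prob_space_uniform_sphere: "prob_space (uniform_sphere d)"
  unfolding uniform_sphere_def
  by (intro prob_space.prob_space_distr prob_space_uniform_measure emeasure_unit_ball)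
    simp

lemma prob_space_uniform_points: "prob_space (uniform_points n d)"
  unfolding uniform_points_def by (intro prob_space_PiM prob_space_uniform_sphere)

lemma globally_synchronizing_event:
  "{X \<in> space (uniform_points n d). globally_synchronizing n (geometric_graph n p d X)}
     \<in> sets (uniform_points n d)"
proof -
  let ?M = "uniform_points n d"
  let ?P = "{1..n} \<times> {1..n}"
  let ?r = "\<lambda>X. {z \<in> ?P. geometric_graph n p d X (fst z) (snd z)}"
  have coord: "(\<lambda>X. X i k) \<in> borel_measurable ?M" if "i \<in> {1..n}" "k < d" for i k
  proof -
    have "(\<lambda>X. X i) \<in> ?M \<rightarrow>\<^sub>M (\<Pi>\<^sub>M k\<in>{..<d}. borel :: real measure)"
      using measurable_component_singleton[OF that(1), of "\<lambda>_. uniform_sphere d"]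
      by (simp add: uniform_points_def cong: measurable_cong_sets)
    from measurable_compose[OF this measurable_component_singleton[of k]] that(2)
    show ?thesis by simp
  qed
  have edge: "{X \<in> space ?M. geometric_graph n p d X i j} \<in> sets ?M" for i j
  proof (cases "i \<in> {1..n} \<and> j \<in> {1..n} \<and> i \<noteq> j")
    case True
    then have "(\<lambda>X. dot d (X i) (X j)) \<in> borel_measurable ?M"
      unfolding dot_def
      by (intro borel_measurable_sum borel_measurable_times coord) auto
    then have "{X \<in> space ?M. threshold p d \<le> dot d (X i) (X j)} \<in> sets ?M"
      by measurable
    moreover have "{X \<in> space ?M. geometric_graph n p d X i j} =
        {X \<in> space ?M. threshold p d \<le> dot d (X i) (X j)}"
      using True by (auto simp: geometric_graph_def)
    ultimately show ?thesis by simp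
  next
    case False
    then have "{X \<in> space ?M. geometric_graph n p d X i j} = {}"
      by (auto simp: geometric_graph_def)
    then show ?thesis by (simp only: sets.empty_sets)
  qed
  have level: "{X \<in> space ?M. ?r X = S} \<in> sets ?M" if "S \<subseteq> ?P" for S
  proof -
    have "{X \<in> space ?M. \<forall>z\<in>?P. geometric_graph n p d X (fst z) (snd z) \<longleftrightarrow> z \<in> S}
        \<in> sets ?M"
    proof (rule sets.sets_Collect_finite_All)
      fix z assume "z \<in> ?P"
      show "{X \<in> space ?M. geometric_graph n p d X (fst z) (snd z) \<longleftrightarrow> z \<in> S} \<in> sets ?M"
        using edge[of "fst z" "snd z"] sets.sets_Collect_neg[OF edge[of "fst z" "snd z"]]
        by (cases "z \<in> S") auto
    qed auto
    moreover have "?r X = S \<longleftrightarrow>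
        (\<forall>z\<in>?P. geometric_graph n p d X (fst z) (snd z) \<longleftrightarrow> z \<in> S)" for X
      using that by blast
    ultimately show ?thesis by simp
  qed
  let ?G = "\<lambda>S i j. (i, j) \<in> S"
  have eq: "geometric_graph n p d X = ?G (?r X)" for X
    by (intro ext) (auto simp: geometric_graph_def)
  have "{X \<in> space ?M. globally_synchronizing n (geometric_graph n p d X)} =
      (\<Union>S\<in>{S \<in> Pow ?P. globally_synchronizing n (?G S)}. {X \<in> space ?M. ?r X = S})"
    (is "?A = ?B")
  proof (intro set_eqI iffI)
    fix X assume "X \<in> ?A"
    then have "globally_synchronizing n (?G (?r X))" "X \<in> space ?M"
      using eq[of X] by simp_all
    moreover have "?r X \<in> Pow ?P" by blast
    ultimately show "X \<in> ?B"
      by (intro UN_I[of "?r X"] CollectI conjI refl)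
  next
    fix X assume "X \<in> ?B"
    then obtain S where "globally_synchronizing n (?G S)" "X \<in> space ?M" "?r X = S"
      by (elim UN_E CollectE conjE)
    then have "globally_synchronizing n (?G (?r X))" "X \<in> space ?M" by simp_all
    then show "X \<in> ?A" using eq[of X] by simp
  qed
  also have "\<dots> \<in> sets ?M"
    by (intro sets.finite_UN level) auto
  finally show ?thesis .
qed

end

theory Submission
  imports Defs
begin

text \<open>
  A local minimum \<open>\<theta>\<close> satisfies \<open>A z = diag(r) z\<close> with \<open>r \<ge> 0\<close> for \<open>z = exp (i \<theta>)\<close>. Testing the Hessian
  with \<open>cos \<theta>\<close> and \<open>sin \<theta>\<close> bounds the mean \<open>\<rho>\<close> of \<open>z\<close> away from \<open>0\<close>; after a rotation \<open>\<rho> > 0\<close>. Since \<open>z\<^sub>i\<close>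
  is the direction of \<open>(A z)\<^sub>i = deg\<^sub>i \<rho> + (A (z - \<rho>))\<^sub>i\<close>, we get
  \<open>|z\<^sub>i - 1| \<le> 2 |(A (z - \<rho>))\<^sub>i| / (\<rho> deg\<^sub>i)\<close>, and as \<open>z - \<rho>\<close> has mean zero, a spectral gap of \<open>A\<close> forces
  \<open>z = 1\<close>. So it suffices that the minimal degree is of order \<open>n p\<close> and that \<open>A - p J\<close> has norm at most a
  small multiple of \<open>n p\<close>.

  For the norm, reveal the points one at a time. Given nearly orthogonal earlier points, the new column
  of centred edge indicators has a covariance matrix of norm at most \<open>p + \<epsilon> n p\<^sup>2\<close>, because two caps
  around nearly orthogonal centres are almost independent in high dimension. The sum of the
  rank-one matrices of the columns is then controlled through the trace of a power of order \<open>log n\<close>.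
  The cap estimate is proved by replacing the sphere by a Gaussian vector.
\<close>

section \<open>Expanders synchronize\<close>

text \<open>The obstacle is dependence: given the earlier points, all edges from a new point are
  functions of that single point. What survives is pairwise decorrelation with a relative error
  \<delta>. The conditional covariance matrix of a column then has diagonal entries of order p and
  off-diagonal entries at most 16 \<delta> p^2. Summed over the columns, its norm is at most n p +
  16 \<delta> (n p)^2, to be compared with the square (n p / 50)^2 of the desired norm: a fixed
  small \<delta> and a large n p suffice. The exponent of the trace is of order ln n in order to
  beat the factor n that a trace costs. The squared length of a column, of order n p, must be
  smaller than (n p)^2 by a factor of that order, which is the origin of n p \<ge> const * ln n.
  Since p may be tiny, probabilities must be compared multiplicatively. For Gaussian tails this
  comes from a change of measure, up to additive errors n^-8 that are negligible against p^2. The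
  trace argument uses bounds valid at every sample point, so the columns are set to zero on
  exceptional events and recovered at the end by a union bound.\<close>

lemma bilinear_sum_split:
  fixes a :: "nat \<Rightarrow> nat \<Rightarrow> real"
  shows "(\<Sum>i\<in>I. \<Sum>j\<in>I. (a i j - p) * x i * y j) =
     (\<Sum>i\<in>I. \<Sum>j\<in>I. a i j * x i * y j) - p * (\<Sum>i\<in>I. x i) * (\<Sum>j\<in>I. y j)"
proof -
  have "p * (\<Sum>i\<in>I. x i) * (\<Sum>j\<in>I. y j) = (\<Sum>i\<in>I. \<Sum>j\<in>I. p * x i * y j)"
    by (simp add: sum_distrib_left sum_distrib_right mult_ac)
  then show ?thesis
    by (simp only: left_diff_distrib sum_subtractf)
qed

section \<open>First and second order conditions at a local minimum of the energy\<close>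

lemma energy_local_min_line:
  assumes "energy_local_min n G \<theta>"
  obtains e where "e > 0" "\<And>t. \<bar>t\<bar> < e \<Longrightarrow> kuramoto_energy n G \<theta> \<le> kuramoto_energy n G (\<lambda>i. \<theta> i + t * x i)"
proof -
  obtain e where e: "e > 0" and min: "\<And>\<phi>. (\<forall>i\<in>{1..n}. \<bar>\<phi> i - \<theta> i\<bar> < e) \<Longrightarrow>
      kuramoto_energy n G \<theta> \<le> kuramoto_energy n G \<phi>"
    using assms unfolding energy_local_min_def by blast
  define K where "K = 1 + (\<Sum>i\<in>{1..n}. \<bar>x i\<bar>)"
  have K: "K > 0" by (simp add: K_def add_pos_nonneg sum_nonneg)
  show ?thesis
  proof
    show "e / K > 0" using e K by simp
    fix t assume t: "\<bar>t\<bar> < e / K"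
    have "\<bar>(\<theta> i + t * x i) - \<theta> i\<bar> < e" if i: "i \<in> {1..n}" for i
    proof -
      have "\<bar>x i\<bar> \<le> K"
        using member_le_sum[OF i, of "\<lambda>i. \<bar>x i\<bar>"] unfolding K_def by simp
      then have "\<bar>t * x i\<bar> \<le> \<bar>t\<bar> * K" by (simp add: abs_mult mult_left_mono)
      also have "\<dots> < e" using t K by (simp add: field_simps)
      finally show ?thesis by simp
    qed
    then show "kuramoto_energy n G \<theta> \<le> kuramoto_energy n G (\<lambda>i. \<theta> i + t * x i)" by (intro min) blast
  qed
qed

lemma energy_local_min_first_order:
  assumes "energy_local_min n G \<theta>"
  shows "(\<Sum>i\<in>{1..n}. \<Sum>j\<in>{1..n}. of_bool (G i j) * ((x i - x j) * sin (\<theta> i - \<theta> j))) = 0"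
proof -
  define h where "h t = kuramoto_energy n G (\<lambda>i. \<theta> i + t * x i)" for t
  obtain e where e: "e > 0" and hmin: "\<And>t. \<bar>t\<bar> < e \<Longrightarrow> h 0 \<le> h t"
    using energy_local_min_line[OF assms, of x] by (auto simp: h_def)
  have der: "(h has_real_derivative
      (\<Sum>i\<in>{1..n}. \<Sum>j\<in>{1..n}. of_bool (G i j) * ((x i - x j) * sin (\<theta> i - \<theta> j)))) (at 0)"
  proof -
    have "((\<lambda>t. of_bool (G i j) * (1 - cos (\<theta> i + t * x i - (\<theta> j + t * x j)))) has_real_derivative
        of_bool (G i j) * ((x i - x j) * sin (\<theta> i - \<theta> j))) (at 0)" for i j
      by (rule derivative_eq_intros refl | simp)+
    then show ?thesis unfolding h_def kuramoto_energy_def by (intro DERIV_sum)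
  qed
  from DERIV_local_min[OF der, of e] hmin e
  show ?thesis by (auto simp: abs_minus_commute)
qed

text \<open>No second derivative is taken. The symmetric difference h(t) + h(-t) - 2 h(0) is
  nonnegative near a minimum, the sine terms cancel in it, and after division by t^2 each summand
  converges because 1 - cos(y t) is asymptotic to (y t)^2 / 2.\<close>

lemma energy_local_min_second_order:
  assumes "energy_local_min n G \<theta>"
  shows "(\<Sum>i\<in>{1..n}. \<Sum>j\<in>{1..n}. of_bool (G i j) * ((x i - x j)\<^sup>2 * cos (\<theta> i - \<theta> j))) \<ge> 0"
proof -
  define h where "h t = kuramoto_energy n G (\<lambda>i. \<theta> i + t * x i)" for t
  obtain e where e: "e > 0" and hmin: "\<And>t. \<bar>t\<bar> < e \<Longrightarrow> h 0 \<le> h t"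
    using energy_local_min_line[OF assms, of x] by (auto simp: h_def)
  have cos_sum: "2 * cos b * (1 - cos a) = (1 - cos (b + a)) + (1 - cos (b - a)) - 2 * (1 - cos b)" for a b :: real
    by (simp add: cos_add cos_diff algebra_simps)
  have sym: "h t + h (- t) - 2 * h 0 =
     (\<Sum>i\<in>{1..n}. \<Sum>j\<in>{1..n}. of_bool (G i j) * (2 * cos (\<theta> i - \<theta> j) * (1 - cos ((x i - x j) * t))))" for t
  proof -
    define a :: "nat \<Rightarrow> nat \<Rightarrow> real" where "a i j = of_bool (G i j)" for i j
    show ?thesis
      unfolding h_def kuramoto_energy_def cos_sum a_def[symmetric]
      by (simp add: sum_distrib_left sum.distrib sum_subtractf algebra_simps)
  qed
  have lim: "((\<lambda>t. (1 - cos (y * t)) / t\<^sup>2) \<longlongrightarrow> y\<^sup>2 / 2) (at_right 0)" for y :: real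
  proof (cases "y = 0")
    case False
    have "((\<lambda>t. ((sin (y * t / 2)) / (y * t / 2))) \<longlongrightarrow> 1) (at_right 0)"
    proof (rule filterlim_compose[OF sinc_at_0])
      show "filterlim (\<lambda>t. y * t / 2) (at 0) (at_right 0)"
        using False by (auto simp: filterlim_at eventually_at_filter intro!: tendsto_eq_intros)
    qed
    then have "((\<lambda>t. ((sin (y * t / 2)) / (y * t / 2))\<^sup>2 * (y\<^sup>2 / 2)) \<longlongrightarrow> 1\<^sup>2 * (y\<^sup>2 / 2)) (at_right 0)"
      by (intro tendsto_intros)
    moreover have "((sin (y * t / 2)) / (y * t / 2))\<^sup>2 * (y\<^sup>2 / 2) = (1 - cos (y * t)) / t\<^sup>2" for t
    proof (cases "t = 0")
      case nz: False
      have "1 - cos (y * t) = 2 * (sin (y * t / 2))\<^sup>2"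
        using cos_double_sin[of "y * t / 2"] by simp
      then show ?thesis using False nz by (simp add: power_divide power_mult_distrib)
    qed simp
    ultimately show ?thesis by (simp only: power_one mult_1)
  qed simp
  have "((\<lambda>t. (h t + h (- t) - 2 * h 0) / t\<^sup>2) \<longlongrightarrow>
     (\<Sum>i\<in>{1..n}. \<Sum>j\<in>{1..n}. of_bool (G i j) * (2 * cos (\<theta> i - \<theta> j) * ((x i - x j)\<^sup>2 / 2)))) (at_right 0)"
    unfolding sym sum_divide_distrib times_divide_eq_right[symmetric]
    by (intro tendsto_intros lim)
  moreover have "\<forall>\<^sub>F t in at_right 0. 0 \<le> (h t + h (- t) - 2 * h 0) / t\<^sup>2"
  proof -
    have "\<forall>\<^sub>F t in at_right 0. t < e" "\<forall>\<^sub>F t in at_right 0. (0::real) < t"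
      using e by (auto simp: eventually_at_right_less intro: eventually_at_right_real
        order_tendstoD(2)[OF tendsto_ident_at])
    then show ?thesis
    proof eventually_elim
      case (elim t)
      then show ?case using hmin[of t] hmin[of "- t"] by auto
    qed
  qed
  ultimately have "0 \<le> (\<Sum>i\<in>{1..n}. \<Sum>j\<in>{1..n}. of_bool (G i j) * (2 * cos (\<theta> i - \<theta> j) * ((x i - x j)\<^sup>2 / 2)))"
    by (rule tendsto_lowerbound) simp
  then show ?thesis by (simp add: mult_ac)
qed

section \<open>Synchronization from criticality and a spectral gap\<close>

text \<open>As r is nonnegative, it is the modulus of w. Moving from w along the ray of z to
  \<open>D * z\<close> therefore costs |D - |w||, which is at most |w - D|; the factor 2 is the
  triangle inequality through w.\<close>

lemma dist_one_le_of_aligned: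
  fixes z w :: complex
  assumes z: "cmod z = 1" and w: "w = of_real r * z" "r \<ge> 0" and D: "D > 0"
  shows "D * cmod (z - 1) \<le> 2 * cmod (w - of_real D)"
proof -
  have "D * cmod (z - 1) = cmod (of_real D * z - of_real D)"
  proof -
    have "of_real D * z - of_real D = of_real D * (z - 1)" by (simp add: right_diff_distrib)
    then show ?thesis using D by (simp add: norm_mult)
  qed
  also have "\<dots> \<le> cmod (of_real D * z - w) + cmod (w - of_real D)"
    using norm_triangle_ineq[of "of_real D * z - w" "w - of_real D"] by simp
  also have "cmod (of_real D * z - w) = \<bar>D - r\<bar>"
  proof -
    have "of_real D * z - w = of_real (D - r) * z" using w by (simp add: left_diff_distrib)
    then show ?thesis using z by (simp only: norm_mult norm_of_real mult_1_right)
  qed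
  also have "\<dots> = \<bar>cmod (of_real D) - cmod w\<bar>"
    using z w D by (simp add: norm_mult)
  also have "\<dots> \<le> cmod (w - of_real D)"
    by (metis norm_minus_commute norm_triangle_ineq3)
  finally show ?thesis by simp
qed

lemma cos_diff_one_imp_rcong:
  assumes "cos (a - b) = 1"
  shows "[a = b] (rmod (2 * pi))"
proof -
  obtain k :: int where "a - b = of_int k * (2 * pi)"
    using assms cos_one_2pi_int by (auto simp: mult_ac)
  then show ?thesis by (auto simp: rcong_altdef algebra_simps intro!: exI[of _ "- k"])
qed


text \<open>The constants fit as follows: the gap n p / 20 yields \<rho>^2 \<ge> 2/5, and the
  contraction closes because twice the gap, n p / 10, is smaller than \<rho> n p / 4, which is at
  least 0.158 n p.\<close>

lemma expander_globally_synchronizing: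
  fixes p :: real
  defines "I \<equiv> \<lambda>n::nat. {1..n}"
  assumes n: "n \<ge> 1" and p: "p > 0"
    and sym: "\<And>i j. G i j \<longleftrightarrow> G j i" and irr: "\<And>i. \<not> G i i"
    and norm: "\<And>x y :: nat \<Rightarrow> real. (\<Sum>i\<in>I n. \<Sum>j\<in>I n. (of_bool (G i j) - p) * x i * y j)
        \<le> n * p / 20 * sqrt (\<Sum>i\<in>I n. (x i)\<^sup>2) * sqrt (\<Sum>i\<in>I n. (y i)\<^sup>2)"
    and deg: "\<And>i. i \<in> I n \<Longrightarrow> n * p / 4 \<le> (\<Sum>j\<in>I n. of_bool (G i j))"
  shows "globally_synchronizing n G"
  unfolding globally_synchronizing_def
proof (intro allI impI)
  fix \<theta> assume lm: "energy_local_min n G \<theta>"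
  define a :: "nat \<Rightarrow> nat \<Rightarrow> real" where "a i j = of_bool (G i j)" for i j
  define S where "S = (\<Sum>i\<in>I n. cos (\<theta> i))"
  define T where "T = (\<Sum>i\<in>I n. sin (\<theta> i))"
  have asym: "a i j = a j i" for i j using sym by (simp add: a_def)
  have norm': "(\<Sum>i\<in>I n. \<Sum>j\<in>I n. a i j * x i * y j) - p * (\<Sum>i\<in>I n. x i) * (\<Sum>j\<in>I n. y j)
        \<le> n * p / 20 * sqrt (\<Sum>i\<in>I n. (x i)\<^sup>2) * sqrt (\<Sum>i\<in>I n. (y i)\<^sup>2)" for x y
    using norm[of x y] unfolding a_def[symmetric] bilinear_sum_split .
  have upper: "(\<Sum>i\<in>I n. \<Sum>j\<in>I n. a i j * x i * x j) - p * (\<Sum>i\<in>I n. x i)\<^sup>2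
        \<le> n * p / 20 * (\<Sum>i\<in>I n. (x i)\<^sup>2)" for x
    using norm'[of x x] by (simp add: power2_eq_square mult.assoc sum_nonneg)
  have lower: "p * (\<Sum>i\<in>I n. x i)\<^sup>2 - (\<Sum>i\<in>I n. \<Sum>j\<in>I n. a i j * x i * x j)
        \<le> n * p / 20 * (\<Sum>i\<in>I n. (x i)\<^sup>2)" for x
    using norm'[of x "\<lambda>i. - x i"] by (simp add: power2_eq_square mult.assoc sum_nonneg sum_negf)
  have card: "card (I n) = n" by (simp add: I_def)
  have cos_split: "(\<Sum>i\<in>I n. \<Sum>j\<in>I n. a i j * cos (\<alpha> i - \<alpha> j)) =
     (\<Sum>i\<in>I n. \<Sum>j\<in>I n. a i j * cos (\<alpha> i) * cos (\<alpha> j)) + (\<Sum>i\<in>I n. \<Sum>j\<in>I n. a i j * sin (\<alpha> i) * sin (\<alpha> j))"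
    for \<alpha> :: "nat \<Rightarrow> real"
    by (simp add: cos_diff distrib_left sum.distrib mult.assoc)
  have sq1: "(\<Sum>i\<in>I n. (cos (\<alpha> i))\<^sup>2) + (\<Sum>i\<in>I n. (sin (\<alpha> i))\<^sup>2) = n" for \<alpha> :: "nat \<Rightarrow> real"
    by (simp add: sum.distrib[symmetric] card)
  have sq1': "n * p / 20 * (\<Sum>i\<in>I n. (cos (\<alpha> i))\<^sup>2) + n * p / 20 * (\<Sum>i\<in>I n. (sin (\<alpha> i))\<^sup>2) = n * p / 20 * n"
    for \<alpha> :: "nat \<Rightarrow> real"
    unfolding distrib_left[symmetric] sq1 ..
  \<comment> \<open>Adding the Hessian tests for cos \<theta> and sin \<theta> produces the squared
    chord, equal to 2 - 2 cos (\<theta> i - \<theta> j).\<close>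
  have hess: "(\<Sum>i\<in>I n. \<Sum>j\<in>I n. a i j * (cos (\<theta> i - \<theta> j) * cos (\<theta> i - \<theta> j)))
      \<le> (\<Sum>i\<in>I n. \<Sum>j\<in>I n. a i j * cos (\<theta> i - \<theta> j))"
  proof -
    have "0 \<le> (\<Sum>i\<in>I n. \<Sum>j\<in>I n. a i j * ((cos (\<theta> i) - cos (\<theta> j))\<^sup>2 * cos (\<theta> i - \<theta> j)))
        + (\<Sum>i\<in>I n. \<Sum>j\<in>I n. a i j * ((sin (\<theta> i) - sin (\<theta> j))\<^sup>2 * cos (\<theta> i - \<theta> j)))"
      unfolding a_def I_def by (intro add_nonneg_nonneg energy_local_min_second_order[OF lm])
    also have "\<dots> = (\<Sum>i\<in>I n. \<Sum>j\<in>I n. a i j * (((cos (\<theta> i) - cos (\<theta> j))\<^sup>2 + (sin (\<theta> i) - sin (\<theta> j))\<^sup>2)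
        * cos (\<theta> i - \<theta> j)))"
      by (simp only: sum.distrib[symmetric] distrib_left distrib_right)
    also have "\<dots> = (\<Sum>i\<in>I n. \<Sum>j\<in>I n. 2 * (a i j * cos (\<theta> i - \<theta> j)) - 2 * (a i j * (cos (\<theta> i - \<theta> j) * cos (\<theta> i - \<theta> j))))"
    proof (intro sum.cong refl)
      fix i j
      have "(cos (\<theta> i) - cos (\<theta> j))\<^sup>2 + (sin (\<theta> i) - sin (\<theta> j))\<^sup>2 = 2 - 2 * cos (\<theta> i - \<theta> j)"
        using sin_cos_squared_add[of "\<theta> i"] sin_cos_squared_add[of "\<theta> j"]
        by (simp add: cos_diff power2_eq_square algebra_simps)
      then show "a i j * (((cos (\<theta> i) - cos (\<theta> j))\<^sup>2 + (sin (\<theta> i) - sin (\<theta> j))\<^sup>2) * cos (\<theta> i - \<theta> j)) =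
        2 * (a i j * cos (\<theta> i - \<theta> j)) - 2 * (a i j * (cos (\<theta> i - \<theta> j) * cos (\<theta> i - \<theta> j)))"
        by (simp only:) (simp add: left_diff_distrib right_diff_distrib)
    qed
    finally show ?thesis by (simp add: sum_subtractf sum_distrib_left[symmetric])
  qed
  \<comment> \<open>By the double angle formula, twice the squared cosine is 1 plus the cosine of
    the doubled difference. The doubled sum is bounded below by the gap alone, since its rank-one
    part is nonnegative and may be dropped. In units of p n^2 this reads 1 - 2/20 \<le> 2 ((S^2 +
    T^2) / n^2 + 1/20).\<close>
  have order: "S\<^sup>2 + T\<^sup>2 \<ge> 2 / 5 * (real n)\<^sup>2"
  proof -
    have 1: "(\<Sum>i\<in>I n. \<Sum>j\<in>I n. a i j * cos (\<theta> i - \<theta> j)) \<le> p * S\<^sup>2 + p * T\<^sup>2 + n * p / 20 * n"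
      using upper[of "\<lambda>i. cos (\<theta> i)"] upper[of "\<lambda>i. sin (\<theta> i)"] sq1'[of \<theta>]
      unfolding cos_split S_def T_def by linarith
    have 2: "(\<Sum>i\<in>I n. \<Sum>j\<in>I n. a i j) \<ge> p * (real n)\<^sup>2 - n * p / 20 * n"
      using lower[of "\<lambda>i. 1"] by (simp add: card)
    have 3: "(\<Sum>i\<in>I n. \<Sum>j\<in>I n. a i j * cos (2 * \<theta> i - 2 * \<theta> j)) \<ge> - (n * p / 20 * n)"
    proof -
      have "0 \<le> p * (\<Sum>i\<in>I n. cos (2 * \<theta> i))\<^sup>2" "0 \<le> p * (\<Sum>i\<in>I n. sin (2 * \<theta> i))\<^sup>2" using p by simp_all
      then show ?thesis
        using lower[of "\<lambda>i. cos (2 * \<theta> i)"] lower[of "\<lambda>i. sin (2 * \<theta> i)"] sq1'[of "\<lambda>i. 2 * \<theta> i"]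
        unfolding cos_split[of "\<lambda>i. 2 * \<theta> i"] by linarith
    qed
    have 4: "2 * (\<Sum>i\<in>I n. \<Sum>j\<in>I n. a i j * (cos (\<theta> i - \<theta> j) * cos (\<theta> i - \<theta> j))) =
        (\<Sum>i\<in>I n. \<Sum>j\<in>I n. a i j) + (\<Sum>i\<in>I n. \<Sum>j\<in>I n. a i j * cos (2 * \<theta> i - 2 * \<theta> j))"
      unfolding sum_distrib_left sum.distrib[symmetric]
    proof (intro sum.cong refl)
      fix i j
      have "cos (2 * \<theta> i - 2 * \<theta> j) = 2 * (cos (\<theta> i - \<theta> j))\<^sup>2 - 1"
        using cos_double_cos[of "\<theta> i - \<theta> j"] by (simp add: right_diff_distrib)
      then show "2 * (a i j * (cos (\<theta> i - \<theta> j) * cos (\<theta> i - \<theta> j))) = a i j + a i j * cos (2 * \<theta> i - 2 * \<theta> j)"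
        by (simp only: power2_eq_square) (simp add: right_diff_distrib)
    qed
    have "p * (real n)\<^sup>2 - n * p / 20 * n + - (n * p / 20 * n)
        \<le> 2 * (\<Sum>i\<in>I n. \<Sum>j\<in>I n. a i j * (cos (\<theta> i - \<theta> j) * cos (\<theta> i - \<theta> j)))"
      unfolding 4 by (rule add_mono[OF 2 3])
    also have "\<dots> \<le> 2 * (p * S\<^sup>2 + p * T\<^sup>2 + n * p / 20 * n)"
      by (rule mult_left_mono[OF order_trans[OF hess 1]]) simp
    finally have "p * (4 / 5 * (real n)\<^sup>2) \<le> p * (2 * (S\<^sup>2 + T\<^sup>2))"
      by (simp add: power2_eq_square distrib_left)
    then show ?thesis using p by simp
  qed
  define R where "R = sqrt (S\<^sup>2 + T\<^sup>2)"
  \<comment> \<open>\<open>\<rho>\<close> is the modulus of the order parameter, the mean of the \<open>exp (i \<theta>)\<close>.\<close>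
  define \<rho> where "\<rho> = R / n"
  have R2: "R\<^sup>2 = S\<^sup>2 + T\<^sup>2" by (simp add: R_def)
  have Rpos: "R > 0"
  proof -
    have "0 < 2 / 5 * (real n)\<^sup>2" using n by simp
    also note order
    finally show ?thesis by (simp add: R_def)
  qed
  have rho2: "\<rho>\<^sup>2 \<ge> 2 / 5" "\<rho> > 0"
    using order R2 n Rpos by (simp_all add: \<rho>_def power_divide field_simps)
  have "(S / R)\<^sup>2 + (T / R)\<^sup>2 = 1"
    using Rpos by (simp add: power_divide add_divide_distrib[symmetric] R2[symmetric])
  then obtain \<phi> where \<phi>: "S / R = cos \<phi>" "T / R = sin \<phi>"
    by (auto elim: sincos_total_2pi)
  define c where "c i = cos (\<theta> i - \<phi>)" for i
  define s where "s i = sin (\<theta> i - \<phi>)" for i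
  have SR: "S = R * cos \<phi>" "T = R * sin \<phi>" using \<phi> Rpos by (simp_all add: field_simps)
  have sum_c: "(\<Sum>i\<in>I n. c i) = n * \<rho>"
  proof -
    have "(\<Sum>i\<in>I n. c i) = S * cos \<phi> + T * sin \<phi>"
      by (simp add: c_def cos_diff S_def T_def sum.distrib sum_distrib_right)
    also have "\<dots> = R * ((cos \<phi>)\<^sup>2 + (sin \<phi>)\<^sup>2)"
      unfolding SR by algebra
    finally show ?thesis using n by (simp add: \<rho>_def)
  qed
  have sum_s: "(\<Sum>i\<in>I n. s i) = 0"
  proof -
    have "(\<Sum>i\<in>I n. s i) = T * cos \<phi> - S * sin \<phi>"
      by (simp add: s_def sin_diff S_def T_def sum_subtractf sum_distrib_right)
    then show ?thesis unfolding SR by simp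
  qed
  have mean_zero: "(\<Sum>i\<in>I n. (\<Sum>j\<in>I n. a i j * x j)\<^sup>2) \<le> (n * p / 20)\<^sup>2 * (\<Sum>i\<in>I n. (x i)\<^sup>2)"
    if x: "(\<Sum>i\<in>I n. x i) = 0" for x
  proof -
    \<comment> \<open>Testing the bilinear bound with the image \<open>y\<close> of \<open>x\<close>
      itself gives |y|^2 \<le> (n p / 20) |y| |x|; the rank-one term vanishes because
      \<open>x\<close> sums to zero.\<close>
    define y where "y i = (\<Sum>j\<in>I n. a i j * x j)" for i
    have "(\<Sum>i\<in>I n. (y i)\<^sup>2) = (\<Sum>i\<in>I n. \<Sum>j\<in>I n. a i j * y i * x j)"
      by (simp add: power2_eq_square y_def sum_distrib_left mult_ac)
    also have "\<dots> \<le> n * p / 20 * sqrt (\<Sum>i\<in>I n. (y i)\<^sup>2) * sqrt (\<Sum>i\<in>I n. (x i)\<^sup>2)"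
      using norm'[of y x] x by simp
    finally have "sqrt (\<Sum>i\<in>I n. (y i)\<^sup>2) * sqrt (\<Sum>i\<in>I n. (y i)\<^sup>2)
        \<le> (n * p / 20 * sqrt (\<Sum>i\<in>I n. (x i)\<^sup>2)) * sqrt (\<Sum>i\<in>I n. (y i)\<^sup>2)"
      by (simp add: sum_nonneg mult_ac)
    then have "sqrt (\<Sum>i\<in>I n. (y i)\<^sup>2) \<le> n * p / 20 * sqrt (\<Sum>i\<in>I n. (x i)\<^sup>2)"
    proof (cases "sqrt (\<Sum>i\<in>I n. (y i)\<^sup>2) > 0")
      case False
      have "0 \<le> n * p / 20 * sqrt (\<Sum>i\<in>I n. (x i)\<^sup>2)"
        using p by (intro mult_nonneg_nonneg) (auto simp: sum_nonneg)
      with False show ?thesis by linarith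
    qed (rule mult_right_le_imp_le)
    then have "(sqrt (\<Sum>i\<in>I n. (y i)\<^sup>2))\<^sup>2 \<le> (n * p / 20 * sqrt (\<Sum>i\<in>I n. (x i)\<^sup>2))\<^sup>2"
      by (intro power_mono) (auto simp: sum_nonneg)
    also have "\<dots> = (n * p / 20)\<^sup>2 * (\<Sum>i\<in>I n. (x i)\<^sup>2)"
      unfolding power_mult_distrib by (simp add: sum_nonneg)
    finally show ?thesis by (simp add: y_def sum_nonneg)
  qed
  \<comment> \<open>After rotating by \<open>\<phi>\<close> the vector \<open>u + i s\<close> is orthogonal to the constants, so the adjacency matrix
    contracts it strongly; comparing with the mean \<open>\<rho>\<close> times the degree needs no degree regularity.\<close>
  define u where "u i = c i - \<rho>" for i
  have sum_u: "(\<Sum>i\<in>I n. u i) = 0" by (simp add: u_def sum_subtractf sum_c card)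
  have local: "((c i - 1)\<^sup>2 + (s i)\<^sup>2) * (n * p * \<rho> / 4)\<^sup>2 \<le>
      4 * ((\<Sum>j\<in>I n. a i j * u j)\<^sup>2 + (\<Sum>j\<in>I n. a i j * s j)\<^sup>2)" if i: "i \<in> I n" for i
  proof -
    define z where "z = cis (\<theta> i - \<phi>)"
    define w where "w = (\<Sum>j\<in>I n. of_real (a i j) * cis (\<theta> j - \<phi>))"
    define r where "r = (\<Sum>j\<in>I n. a i j * cos (\<theta> i - \<theta> j))"
    define d where "d = (\<Sum>j\<in>I n. a i j)"
    \<comment> \<open>A symmetric function supported on pairs that contain i collapses to twice its
      row i; the pair (i, i), counted once too often, has weight zero because the graph has no
      loops.\<close>
    have off: "(\<Sum>k\<in>I n. \<Sum>j\<in>I n. a k j * f k j) = 2 * (\<Sum>j\<in>I n. a i j * f i j)"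
      if "\<And>k j. k \<noteq> i \<Longrightarrow> j \<noteq> i \<Longrightarrow> f k j = 0" "\<And>k j. f k j = f j k" for f :: "nat \<Rightarrow> nat \<Rightarrow> real"
    proof -
      have fin: "finite (I n)" by (simp add: I_def)
      have "(\<Sum>k\<in>I n. \<Sum>j\<in>I n. a k j * f k j) =
          (\<Sum>j\<in>I n. a i j * f i j) + (\<Sum>k\<in>I n - {i}. \<Sum>j\<in>I n. a k j * f k j)"
        using sum.remove[OF fin i, of "\<lambda>k. \<Sum>j\<in>I n. a k j * f k j"] by simp
      also have "(\<Sum>k\<in>I n - {i}. \<Sum>j\<in>I n. a k j * f k j) = (\<Sum>k\<in>I n - {i}. a k i * f k i)"
      proof (intro sum.cong refl)
        fix k assume "k \<in> I n - {i}"
        then have "(\<Sum>j\<in>I n - {i}. a k j * f k j) = 0" using that by (intro sum.neutral) auto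
        then show "(\<Sum>j\<in>I n. a k j * f k j) = a k i * f k i"
          using sum.remove[OF fin i, of "\<lambda>j. a k j * f k j"] by simp
      qed
      also have "\<dots> = (\<Sum>k\<in>I n. a i k * f i k)"
      proof -
        have "(\<Sum>k\<in>I n - {i}. a k i * f k i) = (\<Sum>k\<in>I n - {i}. a i k * f i k)"
          by (intro sum.cong refl) (metis asym that(2))
        then show ?thesis using sum.remove[OF fin i, of "\<lambda>k. a i k * f i k"] irr by (simp add: a_def)
      qed
      finally show ?thesis by simp
    qed
    \<comment> \<open>Moving only the angle at i: the first order condition makes conj(z_i) (A z)_i
      real, the second order condition makes it nonnegative.\<close>
    define e :: "nat \<Rightarrow> real" where "e k = of_bool (k = i)" for k
    have ee: "e i = 1" "\<And>k. k \<noteq> i \<Longrightarrow> e k = 0" by (auto simp: e_def)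
    have first: "(\<Sum>j\<in>I n. a i j * sin (\<theta> i - \<theta> j)) = 0"
    proof -
      have "(\<Sum>k\<in>I n. \<Sum>j\<in>I n. a k j * ((e k - e j) * sin (\<theta> k - \<theta> j))) = 0"
        using energy_local_min_first_order[OF lm, of e] by (simp only: a_def I_def)
      moreover have "(\<Sum>k\<in>I n. \<Sum>j\<in>I n. a k j * ((e k - e j) * sin (\<theta> k - \<theta> j))) =
          2 * (\<Sum>j\<in>I n. a i j * ((e i - e j) * sin (\<theta> i - \<theta> j)))"
      proof (rule off)
        show "(e k - e j) * sin (\<theta> k - \<theta> j) = (e j - e k) * sin (\<theta> j - \<theta> k)" for k j
          using sin_minus[of "\<theta> j - \<theta> k"] by (simp add: algebra_simps)
      qed (simp add: ee)
      moreover have "(\<Sum>j\<in>I n. a i j * ((e i - e j) * sin (\<theta> i - \<theta> j))) = (\<Sum>j\<in>I n. a i j * sin (\<theta> i - \<theta> j))"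
        by (intro sum.cong refl) (auto simp: e_def)
      ultimately show ?thesis by simp
    qed
    have "0 \<le> (\<Sum>k\<in>I n. \<Sum>j\<in>I n. a k j * ((e k - e j)\<^sup>2 * cos (\<theta> k - \<theta> j)))"
      using energy_local_min_second_order[OF lm, of e] by (simp only: a_def I_def)
    also have "\<dots> = 2 * (\<Sum>j\<in>I n. a i j * ((e i - e j)\<^sup>2 * cos (\<theta> i - \<theta> j)))"
    proof (rule off)
      show "(e k - e j)\<^sup>2 * cos (\<theta> k - \<theta> j) = (e j - e k)\<^sup>2 * cos (\<theta> j - \<theta> k)" for k j
        using cos_minus[of "\<theta> j - \<theta> k"] by (simp add: power2_commute)
    qed (simp add: ee)
    also have "(\<Sum>j\<in>I n. a i j * ((e i - e j)\<^sup>2 * cos (\<theta> i - \<theta> j))) = r"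
      unfolding r_def using irr by (intro sum.cong refl) (auto simp: e_def a_def)
    finally have r0: "r \<ge> 0" by simp
    have wz: "w = of_real r * z"
    proof -
      have "w = (\<Sum>j\<in>I n. of_real (a i j) * (cis (- (\<theta> i - \<theta> j)) * z))"
        unfolding w_def z_def by (simp add: cis_mult)
      also have "\<dots> = (\<Sum>j\<in>I n. of_real (a i j) * cis (- (\<theta> i - \<theta> j))) * z"
        by (simp only: sum_distrib_right mult.assoc)
      also have "(\<Sum>j\<in>I n. of_real (a i j) * cis (- (\<theta> i - \<theta> j))) = of_real r"
      proof (rule complex_eqI)
        show "Re (\<Sum>j\<in>I n. of_real (a i j) * cis (- (\<theta> i - \<theta> j))) = Re (of_real r)"
          by (simp add: r_def cos_diff mult.commute)
        have "Im (\<Sum>j\<in>I n. of_real (a i j) * cis (- (\<theta> i - \<theta> j))) = - (\<Sum>j\<in>I n. a i j * sin (\<theta> i - \<theta> j))"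
          by (simp add: sum_negf[symmetric] sin_diff algebra_simps)
        then show "Im (\<Sum>j\<in>I n. of_real (a i j) * cis (- (\<theta> i - \<theta> j))) = Im (of_real r)"
          using first by simp
      qed
      finally show ?thesis .
    qed
    have d4: "n * p / 4 \<le> d" using deg[OF i] by (simp add: d_def a_def)
    have D: "d * \<rho> > 0" 
    proof (rule mult_pos_pos)
      have "0 < n * p / 4" using n p by simp
      with d4 show "d > 0" by linarith
    qed (rule rho2)
    have wD: "w - of_real (d * \<rho>) = Complex (\<Sum>j\<in>I n. a i j * u j) (\<Sum>j\<in>I n. a i j * s j)"
      by (rule complex_eqI)
        (simp_all add: w_def d_def u_def c_def s_def right_diff_distrib sum_subtractf sum_distrib_right)
    have "(n * p * \<rho> / 4) * cmod (z - 1) \<le> d * \<rho> * cmod (z - 1)"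
      using d4 rho2 by (intro mult_right_mono) (auto simp: field_simps)
    also have "\<dots> \<le> 2 * cmod (w - of_real (d * \<rho>))"
      by (rule dist_one_le_of_aligned[OF _ wz r0 D]) (simp add: z_def)
    finally have "((n * p * \<rho> / 4) * cmod (z - 1))\<^sup>2 \<le> (2 * cmod (w - of_real (d * \<rho>)))\<^sup>2"
      using p rho2 by (intro power_mono) auto
    then have "(n * p * \<rho> / 4)\<^sup>2 * (cmod (z - 1))\<^sup>2 \<le> 4 * (cmod (w - of_real (d * \<rho>)))\<^sup>2"
      by (simp only: power_mult_distrib) simp
    then show ?thesis
      unfolding wD by (simp add: cmod_power2 z_def c_def s_def mult.commute)
  qed
  define Q where "Q = (\<Sum>i\<in>I n. (c i - 1)\<^sup>2 + (s i)\<^sup>2)"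
  have Q_le: "Q * (n * p * \<rho> / 4)\<^sup>2 \<le> 4 * (n * p / 20)\<^sup>2 * Q"
  proof -
    have "Q * (n * p * \<rho> / 4)\<^sup>2 \<le> (\<Sum>i\<in>I n. 4 * ((\<Sum>j\<in>I n. a i j * u j)\<^sup>2 + (\<Sum>j\<in>I n. a i j * s j)\<^sup>2))"
      unfolding Q_def sum_distrib_right by (intro sum_mono local)
    also have "\<dots> = 4 * ((\<Sum>i\<in>I n. (\<Sum>j\<in>I n. a i j * u j)\<^sup>2) + (\<Sum>i\<in>I n. (\<Sum>j\<in>I n. a i j * s j)\<^sup>2))"
      by (simp add: sum_distrib_left sum.distrib distrib_left)
    also have "\<dots> \<le> 4 * ((n * p / 20)\<^sup>2 * (\<Sum>i\<in>I n. (u i)\<^sup>2) + (n * p / 20)\<^sup>2 * (\<Sum>i\<in>I n. (s i)\<^sup>2))"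
      by (intro mult_left_mono add_mono mean_zero sum_u sum_s) auto
    also have "\<dots> = 4 * (n * p / 20)\<^sup>2 * ((\<Sum>i\<in>I n. (u i)\<^sup>2) + (\<Sum>i\<in>I n. (s i)\<^sup>2))"
      by (simp add: algebra_simps)
    \<comment> \<open>The mean minimises the sum of squared deviations, so replacing \<rho> by 1
      only increases it. Thus \<open>Q\<close> appears on both sides.\<close>
    also have "(\<Sum>i\<in>I n. (u i)\<^sup>2) \<le> (\<Sum>i\<in>I n. (c i - 1)\<^sup>2)"
    proof -
      have "(\<Sum>i\<in>I n. (c i - 1)\<^sup>2) = (\<Sum>i\<in>I n. (u i)\<^sup>2 + 2 * (\<rho> - 1) * u i + (\<rho> - 1)\<^sup>2)"
        by (intro sum.cong refl) (simp add: u_def power2_eq_square algebra_simps)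
      also have "\<dots> = (\<Sum>i\<in>I n. (u i)\<^sup>2) + n * (\<rho> - 1)\<^sup>2"
        by (simp add: sum.distrib sum_distrib_left[symmetric] sum_u card)
      finally show ?thesis by simp
    qed
    finally show ?thesis by (simp add: Q_def sum.distrib mult_left_mono)
  qed
  have "Q = 0"
  proof (rule ccontr)
    assume "Q \<noteq> 0"
    moreover have "Q \<ge> 0" unfolding Q_def by (intro sum_nonneg) auto
    ultimately have Q: "Q > 0" by simp
    have "(n * p)\<^sup>2 * (\<rho>\<^sup>2 / 16) * Q \<le> (n * p)\<^sup>2 * (1 / 100) * Q"
      using Q_le by (simp add: power_mult_distrib power_divide mult_ac)
    then have "\<rho>\<^sup>2 / 16 \<le> 1 / 100" using Q n p by simp
    then show False using rho2 by simp
  qed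
  then have c1: "c i = 1" "s i = 0" if "i \<in> I n" for i
  proof -
    have "(c i - 1)\<^sup>2 + (s i)\<^sup>2 = 0"
      using \<open>Q = 0\<close> that unfolding Q_def by (subst (asm) sum_nonneg_eq_0_iff) (auto simp: I_def)
    then show "c i = 1" "s i = 0" by (auto simp: sum_power2_eq_zero_iff)
  qed
  show "\<forall>i\<in>{1..n}. \<forall>j\<in>{1..n}. [\<theta> i = \<theta> j] (rmod (2 * pi))"
  proof (intro ballI cos_diff_one_imp_rcong)
    fix i j assume ij: "i \<in> {1..n}" "j \<in> {1..n}"
    have "cos (\<theta> i - \<theta> j) = cos ((\<theta> i - \<phi>) - (\<theta> j - \<phi>))" by simp
    also have "\<dots> = c i * c j + s i * s j" unfolding cos_diff[of "\<theta> i - \<phi>"] by (simp add: c_def s_def)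
    also have "\<dots> = 1" using c1 ij by (simp add: I_def)
    finally show "cos (\<theta> i - \<theta> j) = 1" .
  qed
qed

section \<open>Random sums of rank-one matrices\<close>

text \<open>Vectors are functions on nat that are read only on the index set, and operators are
  plain maps of such functions, so that powers of a matrix are iterates \<open>^^\<close>.\<close>

definition ip :: "nat set \<Rightarrow> (nat \<Rightarrow> real) \<Rightarrow> (nat \<Rightarrow> real) \<Rightarrow> real" where
  "ip I x y = (\<Sum>i\<in>I. x i * y i)"

definition unit_vec :: "nat \<Rightarrow> nat \<Rightarrow> real" where
  "unit_vec k = (\<lambda>i. of_bool (i = k))"

definition op_trace :: "nat set \<Rightarrow> ((nat \<Rightarrow> real) \<Rightarrow> nat \<Rightarrow> real) \<Rightarrow> real" where
  "op_trace I A = (\<Sum>k\<in>I. ip I (unit_vec k) (A (unit_vec k)))"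

lemma ip_commute: "ip I x y = ip I y x"
  by (simp add: ip_def mult.commute)

lemma ip_add_right: "ip I x (\<lambda>i. y i + z i) = ip I x y + ip I x z"
  by (simp add: ip_def distrib_left sum.distrib)

lemma ip_scale_right: "ip I x (\<lambda>i. a * y i) = a * ip I x y"
  by (simp add: ip_def sum_distrib_left mult_ac)

lemma ip_sum_right: "ip I x (\<lambda>i. \<Sum>l\<in>J. f l i) = (\<Sum>l\<in>J. ip I x (f l))"
  unfolding ip_def sum_distrib_left by (rule sum.swap)

lemma ip_self_nonneg: "ip I x x \<ge> 0"
  by (simp add: ip_def sum_nonneg)

lemma ip_unit_vec: "finite I \<Longrightarrow> k \<in> I \<Longrightarrow> ip I (unit_vec k) y = y k"
  by (simp add: ip_def unit_vec_def)

lemma ip_parseval: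
  assumes "finite I"
  shows "(\<Sum>k\<in>I. ip I x (unit_vec k) * ip I y (unit_vec k)) = ip I x y"
proof -
  have "ip I z (unit_vec k) = z k" if "k \<in> I" for k z
    using ip_unit_vec[OF assms that] by (simp add: ip_commute)
  then show ?thesis by (simp add: ip_def)
qed

section \<open>Moments of positive operators without diagonalisation\<close>

lemma quadratic_form_CS:
  fixes a b c :: real
  assumes "\<And>t. a + 2 * t * b + t\<^sup>2 * c \<ge> 0"
  shows "b\<^sup>2 \<le> a * c"
proof (cases "c = 0")
  case True
  show ?thesis
  proof (rule ccontr)
    assume "\<not> ?thesis"
    then have "b \<noteq> 0" using True by auto
    then have "a + 2 * (- (a + 1) / (2 * b)) * b = -1" by (simp add: field_simps)
    then show False using assms[of "- (a + 1) / (2 * b)"] True by simp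
  qed
next
  case False
  have "c > 0"
  proof (rule ccontr)
    assume "\<not> c > 0"
    then have c: "c < 0" using False by simp
    define t where "t = (\<bar>a\<bar> + 1 + 2 * \<bar>b\<bar>) / - c + 1"
    have t1: "t \<ge> 1" using c by (simp add: t_def divide_nonneg_neg)
    have tc: "t * c = - (\<bar>a\<bar> + 1 + 2 * \<bar>b\<bar>) + c" using c by (simp add: t_def field_simps)
    have "a + t * (2 * b + t * c) \<le> a + t * (2 * \<bar>b\<bar> - (\<bar>a\<bar> + 1 + 2 * \<bar>b\<bar>))"
      using tc c t1 by (intro add_left_mono mult_left_mono) auto
    also have "\<dots> = a - t * (\<bar>a\<bar> + 1)" by (simp add: algebra_simps)
    also have "\<dots> \<le> a - 1 * (\<bar>a\<bar> + 1)" using t1 by (intro diff_left_mono mult_right_mono) auto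
    also have "\<dots> < 0" by simp
    finally show False using assms[of t] by (simp add: power2_eq_square algebra_simps)
  qed
  have "0 \<le> c * (a + 2 * (- b / c) * b + (- b / c)\<^sup>2 * c)" using assms[of "- b / c"] \<open>c > 0\<close> by simp
  also have "\<dots> = a * c - b\<^sup>2" using \<open>c > 0\<close> by (simp add: power2_eq_square field_simps)
  finally show ?thesis by simp
qed

text \<open>Log-convexity makes the ratios m (k + 1) / m k nondecreasing, so all inherit the lower
  bound on the first one. The intended sequence is m k = <v, B^k v>, the moments of the spectral
  measure of v.\<close>

lemma log_convex_growth:
  fixes m :: "nat \<Rightarrow> real"
  assumes pos: "m 0 > 0" and c: "c > 0" and base: "c * m 0 \<le> m 1"
    and lc: "\<And>k. (m (Suc k))\<^sup>2 \<le> m k * m (Suc (Suc k))"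
  shows "m k > 0" and "c * m k \<le> m (Suc k)"
proof -
  have "m k > 0 \<and> c * m k \<le> m (Suc k)"
  proof (induction k)
    case 0
    then show ?case using pos base by simp
  next
    case (Suc k)
    then have k: "m k > 0" "c * m k \<le> m (Suc k)" by auto
    then have p: "m (Suc k) > 0" using c by (meson less_le_trans mult_pos_pos)
    have "c * m (Suc k) * m k \<le> m (Suc k) * m (Suc k)"
      using k p by (simp add: mult_ac)
    also have "\<dots> \<le> m (Suc (Suc k)) * m k" using lc[of k] by (simp add: power2_eq_square mult_ac)
    finally show ?case using k(1) p by simp
  qed
  then show "m k > 0" "c * m k \<le> m (Suc k)" by auto
qed

text \<open>The ratio of consecutive terms at i is at most the ratio at i + k. For moments this is
  Chebyshev's correlation inequality.\<close>

lemma log_convex_supermult: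
  fixes m :: "nat \<Rightarrow> real"
  assumes pos: "\<And>k. m k > 0" and lc: "\<And>k. (m (Suc k))\<^sup>2 \<le> m k * m (Suc (Suc k))"
  shows "m i * m j \<le> m 0 * m (i + j)"
proof (induction i)
  case (Suc i)
  have ratio: "m (Suc i) * m (i + k) \<le> m i * m (Suc (i + k))" for k
  proof (induction k)
    case (Suc k)
    have "m (Suc i) * m (i + Suc k) * m (i + k) = (m (Suc i) * m (i + k)) * m (Suc (i + k))"
      by (simp add: mult_ac)
    also have "\<dots> \<le> (m i * m (Suc (i + k))) * m (Suc (i + k))"
      by (intro mult_right_mono Suc.IH less_imp_le pos)
    also have "\<dots> \<le> m i * (m (i + k) * m (Suc (Suc (i + k))))"
      using lc[of "i + k"] pos[of i] by (simp add: power2_eq_square mult.assoc)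
    finally have "(m (Suc i) * m (i + Suc k)) * m (i + k) \<le> (m i * m (Suc (i + Suc k))) * m (i + k)"
      by (simp add: mult_ac)
    then show ?case using pos mult_right_le_imp_le by blast
  qed (simp add: mult.commute)
  have "m (Suc i) * m j * m (i + j) \<le> m j * (m i * m (Suc (i + j)))"
    using ratio[of j] pos[of j] by (simp add: mult_ac)
  also have "\<dots> \<le> (m 0 * m (i + j)) * m (Suc (i + j))"
    using Suc.IH pos[of "Suc (i + j)"] by (simp add: mult_ac)
  finally have "(m (Suc i) * m j) * m (i + j) \<le> (m 0 * m (Suc i + j)) * m (i + j)"
    by (simp add: mult_ac)
  then show ?case using pos mult_right_le_imp_le by blast
qed simp

text \<open>c is a lower bound for the spectrum of B. Linearity enters only inside inner products,
  where it follows from symmetry by moving B to the other argument.\<close>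

locale coercive_op =
  fixes I :: "nat set" and c :: real and B :: "(nat \<Rightarrow> real) \<Rightarrow> nat \<Rightarrow> real"
  assumes fin: "finite I" and c_pos: "c > 0"
    and sym: "\<And>x y. ip I x (B y) = ip I (B x) y"
    and coercive: "\<And>x. c * ip I x x \<le> ip I x (B x)"
begin

lemma sym_pow: "ip I x ((B ^^ k) y) = ip I ((B ^^ k) x) y"
proof (induction k arbitrary: x y)
  case (Suc k)
  then show ?case by (simp add: sym funpow_swap1)
qed simp

lemma ip_pow_pow: "ip I ((B ^^ a) x) ((B ^^ b) y) = ip I x ((B ^^ (a + b)) y)"
  by (simp add: sym_pow[symmetric] funpow_add)

lemma form_nonneg: "ip I x (B x) \<ge> 0"
  using coercive[of x] ip_self_nonneg[of I x] c_pos by (meson mult_nonneg_nonneg less_imp_le order_trans)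

lemma pow_form_nonneg: "ip I x ((B ^^ k) x) \<ge> 0"
proof (cases "even k")
  case True
  then obtain i where "k = i + i" by (metis mult_2 evenE)
  then show ?thesis using ip_self_nonneg[of I "(B ^^ i) x"] by (simp add: ip_pow_pow)
next
  case False
  then obtain i where "k = i + Suc i" by (metis mult_2 oddE add_Suc_right Suc_eq_plus1)
  then show ?thesis using form_nonneg[of "(B ^^ i) x"] ip_pow_pow[of i x "Suc i" x] by simp
qed

lemma pow_form_CS: "(ip I x ((B ^^ k) y))\<^sup>2 \<le> ip I x ((B ^^ k) x) * ip I y ((B ^^ k) y)"
proof (rule quadratic_form_CS)
  fix t
  have lin: "ip I z ((B ^^ k) (\<lambda>i. x i + t * y i)) = ip I z ((B ^^ k) x) + t * ip I z ((B ^^ k) y)" for z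
    by (simp only: sym_pow ip_add_right ip_scale_right)
  have "0 \<le> ip I (\<lambda>i. x i + t * y i) ((B ^^ k) (\<lambda>i. x i + t * y i))"
    by (rule pow_form_nonneg)
  also have "\<dots> = ip I x ((B ^^ k) x) + t * ip I x ((B ^^ k) y) + t * (ip I y ((B ^^ k) x) + t * ip I y ((B ^^ k) y))"
  proof -
    have "ip I (\<lambda>i. x i + t * y i) w = ip I x w + t * ip I y w" for w
      by (simp only: ip_commute[of I _ w] ip_add_right ip_scale_right)
    then show ?thesis by (simp only: lin)
  qed
  also have "ip I y ((B ^^ k) x) = ip I x ((B ^^ k) y)"
    by (metis sym_pow ip_commute)
  finally show "0 \<le> ip I x ((B ^^ k) x) + 2 * t * ip I x ((B ^^ k) y) + t\<^sup>2 * ip I y ((B ^^ k) y)"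
    by (simp add: power2_eq_square algebra_simps)
qed

text \<open>A vector that vanishes on I has only zero inner products; for every other vector the
  moments are positive and log-convex. The split keeps divisions by moments out of the later
  inequalities.\<close>

lemma moment_cases:
  obtains (zero) "\<And>k y. ip I v y = 0"
  | (pos) "\<And>k. ip I v ((B ^^ k) v) > 0" "\<And>k. c * ip I v ((B ^^ k) v) \<le> ip I v ((B ^^ Suc k) v)"
      "\<And>i j. ip I v ((B ^^ i) v) * ip I v ((B ^^ j) v) \<le> ip I v v * ip I v ((B ^^ (i + j)) v)"
proof (cases "ip I v v = 0")
  case True
  then have "\<forall>i\<in>I. v i = 0" using fin by (simp add: ip_def sum_nonneg_eq_0_iff)
  then show ?thesis by (intro zero) (simp add: ip_def)
next
  case False
  define m where "m k = ip I v ((B ^^ k) v)" for k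
  have m0: "m 0 > 0" using False ip_self_nonneg[of I v] by (simp add: m_def)
  have lc: "(m (Suc k))\<^sup>2 \<le> m k * m (Suc (Suc k))" for k
    using pow_form_CS[of v k "B v"] sym[of v "(B ^^ Suc k) v"] by (simp add: m_def funpow_swap1)
  have base: "c * m 0 \<le> m 1" using coercive[of v] by (simp add: m_def)
  note g = log_convex_growth[OF m0 c_pos base lc]
  show ?thesis
    using g log_convex_supermult[of m, OF g(1) lc] by (intro pos) (simp_all add: m_def)
qed

lemma moment_growth: "c * ip I v ((B ^^ k) v) \<le> ip I v ((B ^^ Suc k) v)"
  by (cases v rule: moment_cases) auto

lemma moment_supermult: "ip I v ((B ^^ i) v) * ip I v ((B ^^ j) v) \<le> ip I v v * ip I v ((B ^^ (i + j)) v)"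
  by (cases v rule: moment_cases) auto

text \<open>Jensen's inequality for the spectral measure of v.\<close>

lemma moment_one_power: "ip I v (B v) ^ Suc k \<le> ip I v v ^ k * ip I v ((B ^^ Suc k) v)"
proof (induction k)
  case (Suc k)
  have "ip I v (B v) ^ Suc (Suc k) \<le> ip I v (B v) * (ip I v v ^ k * ip I v ((B ^^ Suc k) v))"
    using Suc.IH form_nonneg[of v] by (simp add: mult_left_mono)
  also have "\<dots> = ip I v v ^ k * (ip I v ((B ^^ 1) v) * ip I v ((B ^^ Suc k) v))" by simp
  also have "\<dots> \<le> ip I v v ^ k * (ip I v v * ip I v ((B ^^ (1 + Suc k)) v))"
    by (intro mult_left_mono moment_supermult zero_le_power ip_self_nonneg)
  finally show ?case by (simp add: mult_ac)
qed simp

lemma trace_pow_nonneg: "op_trace I (B ^^ k) \<ge> 0"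
  unfolding op_trace_def by (intro sum_nonneg pow_form_nonneg)

lemma pow_form_le_trace: "ip I x ((B ^^ k) x) \<le> ip I x x * op_trace I (B ^^ k)"
proof (cases "ip I x ((B ^^ k) x) = 0")
  case True
  then show ?thesis using trace_pow_nonneg ip_self_nonneg by simp
next
  case False
  define M where "M = ip I x ((B ^^ k) x)"
  have M: "M > 0" using False pow_form_nonneg[of x k] by (simp add: M_def)
  have "M\<^sup>2 = (\<Sum>i\<in>I. x i * ((B ^^ k) x) i)\<^sup>2" by (simp add: M_def ip_def)
  also have "\<dots> \<le> (\<Sum>i\<in>I. (x i)\<^sup>2) * (\<Sum>i\<in>I. (((B ^^ k) x) i)\<^sup>2)"
    by (rule Cauchy_Schwarz_ineq_sum)
  also have "\<dots> \<le> ip I x x * (\<Sum>i\<in>I. ip I (unit_vec i) ((B ^^ k) (unit_vec i)) * M)"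
  proof (intro mult_mono sum_mono sum_nonneg)
    fix i assume "i \<in> I"
    then show "(((B ^^ k) x) i)\<^sup>2 \<le> ip I (unit_vec i) ((B ^^ k) (unit_vec i)) * M"
      using pow_form_CS[of "unit_vec i" k x] by (simp add: ip_unit_vec fin M_def)
  qed (auto simp: ip_def power2_eq_square sum_nonneg)
  also have "\<dots> = (ip I x x * op_trace I (B ^^ k)) * M"
    by (simp add: op_trace_def sum_distrib_right mult.assoc)
  finally show ?thesis using M by (simp add: power2_eq_square M_def)
qed

lemma trace_pow_growth: "c * op_trace I (B ^^ k) \<le> op_trace I (B ^^ Suc k)"
  unfolding op_trace_def sum_distrib_left by (intro sum_mono moment_growth)

text \<open>This is how a norm is read off a trace: a Rayleigh quotient of at least \<mu> for B
  gives, by Jensen, one of at least \<mu>^q for B^q, and the trace dominates it.\<close>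

lemma trace_pow_ge:
  assumes "\<mu> * ip I x x \<le> ip I x (B x)" "\<mu> > 0" "ip I x x > 0" "q > 0"
  shows "\<mu> ^ q \<le> op_trace I (B ^^ q)"
proof -
  obtain k where q: "q = Suc k" using assms(4) gr0_implies_Suc by blast
  have "\<mu> ^ q * ip I x x ^ q = (\<mu> * ip I x x) ^ q" by (simp add: power_mult_distrib)
  also have "\<dots> \<le> ip I x (B x) ^ q"
    using assms by (intro power_mono) auto
  also have "\<dots> \<le> ip I x x ^ k * ip I x ((B ^^ q) x)" unfolding q by (rule moment_one_power)
  also have "\<dots> \<le> ip I x x ^ k * (ip I x x * op_trace I (B ^^ q))"
    by (intro mult_left_mono pow_form_le_trace zero_le_power ip_self_nonneg)
  also have "\<dots> = op_trace I (B ^^ q) * ip I x x ^ q" by (simp add: q)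
  finally show ?thesis using assms(3) by (simp add: mult_le_cancel_right)
qed

section \<open>The effect of a rank-one update on the trace of a power\<close>

lemma coercive_op_rank_one:
  "coercive_op I c (\<lambda>x i. B x i + ip I v x * v i)"
proof
  show "ip I x (\<lambda>i. B y i + ip I v y * v i) = ip I (\<lambda>i. B x i + ip I v x * v i) y" for x y
    unfolding ip_commute[of I "\<lambda>i. B x i + ip I v x * v i"] ip_add_right ip_scale_right
    by (simp only: sym[of x y] ip_commute[of I "B x" y] ip_commute[of I x v] ip_commute[of I y v] mult.commute)
  show "c * ip I x x \<le> ip I x (\<lambda>i. B x i + ip I v x * v i)" for x
    unfolding ip_add_right ip_scale_right
    using coercive[of x] by (simp add: ip_commute[of I x v] add_increasing2)
qed (rule fin c_pos)+

text \<open>Unfolding one factor C leaves either B or the rank-one term. The latter contributes a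
  product of moments of orders a and j, at most |v|^2 times the moment of order a + j, hence at most
  R / c times the next moment. Each replaced factor thus costs 1 + R / c.\<close>

lemma rank_one_mixed_moment:
  assumes C: "C = (\<lambda>x i. B x i + ip I v x * v i)" and R: "ip I v v \<le> R"
  shows "ip I ((B ^^ a) v) ((C ^^ j) v) \<le> (1 + R / c) ^ j * ip I v ((B ^^ (a + j)) v)"
proof (induction j arbitrary: a)
  case 0
  then show ?case by (simp add: sym_pow)
next
  case (Suc j)
  define K where "K = 1 + R / c"
  have R0: "R \<ge> 0" using R ip_self_nonneg[of I v] by simp
  then have K0: "K \<ge> 0" using c_pos by (simp add: K_def)
  have m0: "ip I v ((B ^^ k) v) \<ge> 0" for k by (rule pow_form_nonneg)
  have "ip I ((B ^^ a) v) ((C ^^ Suc j) v) =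
      ip I ((B ^^ Suc a) v) ((C ^^ j) v) + ip I v ((C ^^ j) v) * ip I v ((B ^^ a) v)"
    by (subst (1) funpow.simps(2), subst o_apply, subst (1) C)
      (simp only: ip_add_right ip_scale_right sym funpow.simps o_apply ip_commute[of I "(B ^^ a) v" v])
  also have "\<dots> \<le> K ^ j * ip I v ((B ^^ (Suc a + j)) v) + (K ^ j * ip I v ((B ^^ j) v)) * ip I v ((B ^^ a) v)"
    using Suc.IH[of "Suc a"] Suc.IH[of 0] m0 by (intro add_mono mult_right_mono) (auto simp: K_def)
  also have "\<dots> \<le> K ^ j * ip I v ((B ^^ (Suc a + j)) v) + K ^ j * (ip I v v * ip I v ((B ^^ (a + j)) v))"
    using moment_supermult[of v j a] K0 by (simp add: mult.assoc mult_left_mono add.commute)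
  also have "\<dots> \<le> K ^ j * ip I v ((B ^^ (Suc a + j)) v) + K ^ j * (R / c * (c * ip I v ((B ^^ (a + j)) v)))"
    using R m0 K0 c_pos by (intro add_left_mono mult_left_mono) (auto intro: mult_right_mono)
  also have "\<dots> \<le> K ^ j * ip I v ((B ^^ (Suc a + j)) v) + K ^ j * (R / c * ip I v ((B ^^ Suc (a + j)) v))"
    using R0 K0 c_pos by (intro add_left_mono mult_left_mono moment_growth) auto
  also have "\<dots> = K ^ Suc j * ip I v ((B ^^ (a + Suc j)) v)"
    by (simp add: K_def algebra_simps)
  finally show ?case by (simp add: K_def)
qed

text \<open>Telescoping along tr (C^j B^(q - j)): each exchange of a B for a C adds <B^k v, C^j v>
  with j + k = q - 1, and the mixed moment bound returns this to the moment of order q - 1 of the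
  old operator, which does not involve v.\<close>

lemma trace_rank_one_update:
  assumes R: "ip I v v \<le> R"
  shows "op_trace I ((\<lambda>x i. B x i + ip I v x * v i) ^^ q) \<le>
     op_trace I (B ^^ q) + q * ((1 + R / c) ^ (q - 1) * ip I v ((B ^^ (q - 1)) v))"
proof -
  define C where "C = (\<lambda>x i. B x i + ip I v x * v i)"
  interpret C: coercive_op I c C unfolding C_def by (rule coercive_op_rank_one)
  define K where "K = 1 + R / c"
  have K1: "K \<ge> 1" using R ip_self_nonneg[of I v] c_pos by (simp add: K_def)
  define T where "T j k = (\<Sum>i\<in>I. ip I ((C ^^ j) (unit_vec i)) ((B ^^ k) (unit_vec i)))" for j k
  have step: "T (Suc j) k = T j (Suc k) + ip I ((B ^^ k) v) ((C ^^ j) v)" for j k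
  proof -
    have "T (Suc j) k = (\<Sum>i\<in>I. ip I ((C ^^ j) (unit_vec i)) (C ((B ^^ k) (unit_vec i))))"
      by (simp add: T_def C.sym)
    also have "\<dots> = T j (Suc k) + (\<Sum>i\<in>I. ip I v ((B ^^ k) (unit_vec i)) * ip I ((C ^^ j) (unit_vec i)) v)"
      by (subst C_def) (simp add: T_def ip_add_right ip_scale_right sum.distrib)
    also have "(\<Sum>i\<in>I. ip I v ((B ^^ k) (unit_vec i)) * ip I ((C ^^ j) (unit_vec i)) v) =
        (\<Sum>i\<in>I. ip I ((B ^^ k) v) (unit_vec i) * ip I ((C ^^ j) v) (unit_vec i))"
      by (intro sum.cong refl arg_cong2[of _ _ _ _ "(*)"]) (metis sym_pow C.sym_pow ip_commute)+
    also have "\<dots> = ip I ((B ^^ k) v) ((C ^^ j) v)" by (rule ip_parseval[OF fin])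
    finally show ?thesis .
  qed
  have "T j (q - j) \<le> T 0 q + j * (K ^ (q - 1) * ip I v ((B ^^ (q - 1)) v))" if "j \<le> q" for j
    using that
  proof (induction j)
    case (Suc j)
    have "T (Suc j) (q - Suc j) = T j (q - j) + ip I ((B ^^ (q - Suc j)) v) ((C ^^ j) v)"
      using Suc.prems by (simp add: step Suc_diff_Suc)
    also have "ip I ((B ^^ (q - Suc j)) v) ((C ^^ j) v) \<le> K ^ j * ip I v ((B ^^ (q - Suc j + j)) v)"
      unfolding K_def by (rule rank_one_mixed_moment[OF C_def R])
    also have "\<dots> \<le> K ^ (q - 1) * ip I v ((B ^^ (q - 1)) v)"
      using Suc.prems K1 pow_form_nonneg by (intro mult_mono power_increasing) auto
    finally show ?case using Suc by (simp add: algebra_simps)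
  qed simp
  from this[of q] show ?thesis
    by (simp add: T_def op_trace_def K_def C_def[symmetric] ip_commute[of I _ "unit_vec _"])
qed

end

section \<open>Shifted Gram matrices, resampling of a coordinate, and the norm bound\<close>

definition shifted_gram :: "nat set \<Rightarrow> real \<Rightarrow> (nat \<Rightarrow> nat \<Rightarrow> real) \<Rightarrow> nat set \<Rightarrow> (nat \<Rightarrow> real) \<Rightarrow> nat \<Rightarrow> real" where
  "shifted_gram I c v J x = (\<lambda>i. c * x i + (\<Sum>l\<in>J. ip I (v l) x * v l i))"

lemma ip_shifted_gram:
  "ip I y (shifted_gram I c v J x) = c * ip I y x + (\<Sum>l\<in>J. ip I (v l) x * ip I (v l) y)"
  unfolding shifted_gram_def ip_add_right ip_scale_right ip_sum_right
  by (simp add: ip_commute[of I y])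

lemma coercive_op_shifted_gram:
  assumes "finite I" "c > 0"
  shows "coercive_op I c (shifted_gram I c v J)"
proof
  show "ip I x (shifted_gram I c v J y) = ip I (shifted_gram I c v J x) y" for x y
    unfolding ip_commute[of I "shifted_gram I c v J x"] ip_shifted_gram
    by (simp add: ip_commute[of I x y] mult.commute)
  show "c * ip I x x \<le> ip I x (shifted_gram I c v J x)" for x
    unfolding ip_shifted_gram by (simp add: sum_nonneg)
qed (rule assms)+

lemma shifted_gram_insert:
  assumes "finite J" "j \<notin> J"
  shows "shifted_gram I c v (insert j J) = (\<lambda>x i. shifted_gram I c v J x i + ip I (v j) x * v j i)"
  using assms by (intro ext) (simp add: shifted_gram_def)

lemma shifted_gram_empty_trace:
  fixes c :: real
  assumes "finite I"
  shows "op_trace I (shifted_gram I c v {} ^^ q) = card I * c ^ q"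
proof -
  have "(shifted_gram I c v {} ^^ q) x = (\<lambda>i. c ^ q * x i)" for x :: "nat \<Rightarrow> real"
    by (induction q) (auto simp: shifted_gram_def)
  then show ?thesis using assms
    by (simp add: op_trace_def ip_scale_right ip_unit_vec) (simp add: unit_vec_def)
qed

text \<open>Averaging over a fresh value of coordinate j leaves the integral unchanged. This takes
  the place of a filtration and conditional expectations: with the other coordinates fixed, the
  inner integral is the conditional mean.\<close>

lemma nn_integral_PiM_resample:
  assumes M: "\<And>i. prob_space (M i)" and I: "finite I" "j \<in> I"
    and F: "F \<in> borel_measurable (PiM I M)"
  shows "(\<integral>\<^sup>+ w. F w \<partial>PiM I M) = (\<integral>\<^sup>+ w. (\<integral>\<^sup>+ x. F (w(j := x)) \<partial>M j) \<partial>PiM I M)"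
proof -
  interpret product_prob_space M I
    using M by (simp add: product_prob_space_def product_prob_space_axioms_def product_sigma_finite_def
        prob_space.axioms(1) finite_measure.axioms(1) prob_space_imp_sigma_finite)
  define J where "J = I - {j}"
  have J: "I = insert j J" "finite J" "j \<notin> J" using I by (auto simp: J_def)
  have Fu: "(\<lambda>z. F ((fst z)(j := snd z))) \<in> borel_measurable (PiM I M \<Otimes>\<^sub>M M j)"
  proof (rule measurable_compose[OF _ F])
    show "(\<lambda>z. (fst z)(j := snd z)) \<in> PiM I M \<Otimes>\<^sub>M M j \<rightarrow>\<^sub>M PiM I M"
      using measurable_fun_upd[of I I j "\<lambda>z. fst z" "PiM I M \<Otimes>\<^sub>M M j" M snd] I
      by (auto simp: insert_absorb)
  qed
  have G: "(\<lambda>w. \<integral>\<^sup>+ x. F (w(j := x)) \<partial>M j) \<in> borel_measurable (PiM I M)"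
    using M.borel_measurable_nn_integral[of "\<lambda>w x. F (w(j := x))" "PiM I M" j] Fu
    by (simp add: case_prod_beta')
  have "(\<integral>\<^sup>+ w. (\<integral>\<^sup>+ x. F (w(j := x)) \<partial>M j) \<partial>PiM I M) =
      (\<integral>\<^sup>+ w. \<integral>\<^sup>+ y. \<integral>\<^sup>+ x. F (w(j := y, j := x)) \<partial>M j \<partial>M j \<partial>PiM J M)"
    unfolding J(1) by (rule product_nn_integral_insert[OF J(2,3)]) (use G J(1) in simp)
  also have "\<dots> = (\<integral>\<^sup>+ w. \<integral>\<^sup>+ x. F (w(j := x)) \<partial>M j \<partial>PiM J M)"
    by (simp add: M.emeasure_space_1)
  also have "\<dots> = (\<integral>\<^sup>+ w. F w \<partial>PiM I M)"
    unfolding J(1) by (rule product_nn_integral_insert[OF J(2,3), symmetric]) (use F J(1) in simp)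
  finally show ?thesis ..
qed

lemma (in prob_space) exponential_Markov:
  fixes f :: "'a \<Rightarrow> real"
  assumes [measurable]: "f \<in> borel_measurable M" and mgf: "(\<integral>\<^sup>+ x. ennreal (exp (f x)) \<partial>M) \<le> ennreal (exp b)"
  shows "prob {x \<in> space M. a \<le> f x} \<le> exp (b - a)"
proof -
  let ?A = "{x \<in> space M. a \<le> f x}"
  have A: "?A \<in> sets M" by measurable
  have "ennreal (prob ?A) = (\<integral>\<^sup>+ x. indicator ?A x \<partial>M)"
    using A by (simp add: emeasure_eq_measure)
  also have "\<dots> \<le> (\<integral>\<^sup>+ x. ennreal (exp (- a)) * ennreal (exp (f x)) \<partial>M)"
  proof (rule nn_integral_mono)
    fix x
    have "1 \<le> exp (- a) * exp (f x)" if "a \<le> f x"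
      using that by (simp add: exp_add[symmetric])
    then show "indicator ?A x \<le> ennreal (exp (- a)) * ennreal (exp (f x))"
      by (auto simp: indicator_def ennreal_mult[symmetric] simp flip: ennreal_1 intro!: ennreal_leI)
  qed
  also have "\<dots> = ennreal (exp (- a)) * (\<integral>\<^sup>+ x. ennreal (exp (f x)) \<partial>M)"
    by (rule nn_integral_cmult) measurable
  also have "\<dots> \<le> ennreal (exp (- a)) * ennreal (exp b)" by (intro mult_left_mono mgf) simp
  also have "\<dots> = ennreal (exp (b - a))"
    by (simp add: ennreal_mult[symmetric] exp_add[symmetric])
  finally show ?thesis by simp
qed

lemma one_plus_inverse_power_le:
  assumes "q > 0"
  shows "(1 + 1 / real q) ^ (q - 1) \<le> 3"
proof -
  have "(1 + 1 / real q) ^ (q - 1) \<le> (exp (1 / real q)) ^ (q - 1)"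
    by (intro power_mono exp_ge_add_one_self) auto
  also have "\<dots> = exp (real (q - 1) / real q)" by (simp add: exp_of_nat_mult[symmetric])
  also have "\<dots> \<le> exp 1" using assms by simp
  also have "\<dots> \<le> 3" by (rule exp_le)
  finally show ?thesis .
qed

lemma borel_measurable_shifted_gram_pow:
  assumes "finite I" "\<And>l i. l \<in> J \<Longrightarrow> i \<in> I \<Longrightarrow> (\<lambda>w. v l w i) \<in> borel_measurable P" "k \<in> I"
  shows "(\<lambda>w. (shifted_gram I c (\<lambda>l. v l w) J ^^ q) y k) \<in> borel_measurable P"
  using assms(3)
proof (induction q arbitrary: k)
  case (Suc q)
  show ?case
    unfolding funpow.simps o_apply
    by (subst shifted_gram_def) (unfold ip_def, intro borel_measurable_add borel_measurable_times
      borel_measurable_sum borel_measurable_const assms(2) Suc.IH Suc.prems)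
qed simp

text \<open>
  The idea: with the shift \<open>q R\<close>, every added rank-one term multiplies the expectation of the trace of
  the \<open>q\<close>-th power of the shifted Gram matrix by at most \<open>1 + 3 \<sigma> / R\<close>.
\<close>

lemma gram_norm_concentration:
  fixes M :: "'a measure" and v :: "nat \<Rightarrow> (nat \<Rightarrow> 'a) \<Rightarrow> nat \<Rightarrow> real"
  defines "P \<equiv> \<lambda>n. PiM {1..n} (\<lambda>_. M)"
  assumes M: "prob_space M"
    and meas: "\<And>j i. j \<in> {1..n} \<Longrightarrow> i \<in> {1..n} \<Longrightarrow> (\<lambda>w. v j w i) \<in> borel_measurable (P n)"
    and adapted: "\<And>l j w x. l < j \<Longrightarrow> v l (w(j := x)) = v l w"
    and bound: "\<And>j w. j \<in> {1..n} \<Longrightarrow> w \<in> space (P n) \<Longrightarrow> ip {1..n} (v j w) (v j w) \<le> R"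
    and var: "\<And>j w y. j \<in> {1..n} \<Longrightarrow> w \<in> space (P n) \<Longrightarrow>
        (\<integral>\<^sup>+ x. ennreal ((ip {1..n} (v j (w(j := x))) y)\<^sup>2) \<partial>M) \<le> ennreal (\<sigma> * ip {1..n} y y)"
    and R: "R > 0" and \<sigma>: "\<sigma> \<ge> 0" and q: "odd q" and lam: "L > 0"
  obtains N where "N \<in> sets (P n)"
    "measure (P n) N \<le> n * (q * R / L) ^ q * exp (3 * real n * \<sigma> / R)"
    "\<And>w x. w \<in> space (P n) - N \<Longrightarrow> (\<Sum>j\<in>{1..n}. (ip {1..n} (v j w) x)\<^sup>2) \<le> L * ip {1..n} x x"
proof -
  define I where "I = {1..n}"
  have fin: "finite I" by (simp add: I_def)
  have q0: "q > 0" using q by (rule odd_pos)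
  \<comment> \<open>This shift gives R / c = 1 / q, so that (1 + R / c)^(q - 1) stays below 3. It
    also makes traces of powers grow by the factor c even while the Gram part is singular.\<close>
  define c where "c = q * R"
  have c: "c > 0" using q0 R by (simp add: c_def)
  define B where "B j w = shifted_gram I c (\<lambda>l. v l w) {1..j}" for j w
  define \<Phi> where "\<Phi> j w = op_trace I (B j w ^^ q)" for j w
  have B: "coercive_op I c (B j w)" for j w
    unfolding B_def by (rule coercive_op_shifted_gram[OF fin c])
  have Bmeas: "(\<lambda>w. (B j w ^^ k) y i) \<in> borel_measurable (P n)" if "j \<le> n" "i \<in> I" for j k y i
    unfolding B_def using that by (intro borel_measurable_shifted_gram_pow fin meas) (auto simp: I_def)
  have \<Phi>meas: "\<Phi> j \<in> borel_measurable (P n)" if "j \<le> n" for j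
    unfolding \<Phi>_def op_trace_def ip_def using that by (intro borel_measurable_sum borel_measurable_times Bmeas) auto
  have \<Phi>nonneg: "\<Phi> j w \<ge> 0" for j w
    unfolding \<Phi>_def by (rule coercive_op.trace_pow_nonneg[OF B])
  interpret M: prob_space M by (rule M)
  interpret P: prob_space "P n" unfolding P_def by (rule prob_space_PiM) (rule M)
  have upd: "w(j := x) \<in> space (P n)" if "w \<in> space (P n)" "j \<in> I" "x \<in> space M" for w j x
    using that by (auto simp: P_def I_def space_PiM PiE_iff extensional_def)
  have upd_meas: "(\<lambda>x. w(j := x)) \<in> M \<rightarrow>\<^sub>M P n" if "w \<in> space (P n)" "j \<in> I" for w j
    unfolding P_def
    by (rule measurable_fun_upd[of _ "{1..n}"]) (use that in \<open>auto simp: P_def I_def insert_absorb\<close>)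
  have step: "(\<integral>\<^sup>+ w. \<Phi> (Suc j) w \<partial>P n) \<le> ennreal (1 + 3 * \<sigma> / R) * (\<integral>\<^sup>+ w. \<Phi> j w \<partial>P n)"
    if j: "Suc j \<le> n" for j
  proof -
    have jI: "Suc j \<in> I" using j by (simp add: I_def)
    have "(\<integral>\<^sup>+ w. \<Phi> (Suc j) w \<partial>P n) = (\<integral>\<^sup>+ w. (\<integral>\<^sup>+ x. \<Phi> (Suc j) (w(Suc j := x)) \<partial>M) \<partial>P n)"
      unfolding P_def
      by (rule nn_integral_PiM_resample) (use M jI \<Phi>meas[OF j] in \<open>auto simp: I_def P_def\<close>)
    also have "\<dots> \<le> (\<integral>\<^sup>+ w. ennreal (1 + 3 * \<sigma> / R) * \<Phi> j w \<partial>P n)"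
    proof (rule nn_integral_mono)
      fix w assume w: "w \<in> space (P n)"
      interpret Bj: coercive_op I c "B j w" by (rule B)
      \<comment> \<open>As q is odd, B^(q - 1) is the square of B^i, so the moment of order q - 1 is
        a sum of squares of inner products of the new vector with the fixed vectors B^i e_k. The
        variance hypothesis applies to each of them.\<close>
      obtain i where qi: "q - 1 = i + i" using q by (metis oddE diff_add_inverse2 mult_2)
      let ?v = "\<lambda>x. v (Suc j) (w(Suc j := x))"
      let ?u = "\<lambda>k. (B j w ^^ i) (unit_vec k)"
      have vmeas: "(\<lambda>x. ?v x k) \<in> borel_measurable M" if "k \<in> I" for k
        using measurable_compose[OF upd_meas[OF w jI] meas[of "Suc j" k]] jI that by (simp add: I_def)
      have one: "\<Phi> (Suc j) (w(Suc j := x)) \<le> \<Phi> j w + 3 * q * (\<Sum>k\<in>I. (ip I (?v x) (?u k))\<^sup>2)"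
        if x: "x \<in> space M" for x
      proof -
        have "B (Suc j) (w(Suc j := x)) = (\<lambda>y l. B j w y l + ip I (?v x) y * ?v x l)"
        proof -
          have "{1..Suc j} = insert (Suc j) {1..j}" by auto
          moreover have "shifted_gram I c (\<lambda>l. v l (w(Suc j := x))) {1..j} = B j w"
            unfolding B_def shifted_gram_def
            by (intro ext arg_cong2[of _ _ _ _ "(+)"] refl sum.cong) (simp_all add: adapted)
          ultimately show ?thesis by (simp add: B_def shifted_gram_insert)
        qed
        then have "\<Phi> (Suc j) (w(Suc j := x)) \<le>
            \<Phi> j w + q * ((1 + R / c) ^ (q - 1) * ip I (?v x) ((B j w ^^ (q - 1)) (?v x)))"
          unfolding \<Phi>_def
          using Bj.trace_rank_one_update[of "?v x" R q] bound[of "Suc j", OF _ upd[OF w jI x]] jI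
          by (simp add: I_def)
        also have "R / c = 1 / q" using R by (simp add: c_def)
        also have "ip I (?v x) ((B j w ^^ (q - 1)) (?v x)) = (\<Sum>k\<in>I. (ip I (?v x) (?u k))\<^sup>2)"
        proof -
          have "ip I (?v x) ((B j w ^^ (q - 1)) (?v x)) = ip I ((B j w ^^ i) (?v x)) ((B j w ^^ i) (?v x))"
            unfolding qi by (simp only: Bj.ip_pow_pow)
          also have "\<dots> = (\<Sum>k\<in>I. (ip I ((B j w ^^ i) (?v x)) (unit_vec k))\<^sup>2)"
            using ip_parseval[OF fin, of "(B j w ^^ i) (?v x)" "(B j w ^^ i) (?v x)"] by (simp add: power2_eq_square)
          finally show ?thesis by (simp only: Bj.sym_pow)
        qed
        also have "q * ((1 + 1 / q) ^ (q - 1) * (\<Sum>k\<in>I. (ip I (?v x) (?u k))\<^sup>2)) \<le>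
            q * (3 * (\<Sum>k\<in>I. (ip I (?v x) (?u k))\<^sup>2))"
          by (intro mult_left_mono mult_right_mono one_plus_inverse_power_le q0 sum_nonneg) auto
        finally show ?thesis by (simp add: mult.assoc mult.left_commute fun_upd_def)
      qed
      have ipmeas: "(\<lambda>x. (ip I (?v x) y)\<^sup>2) \<in> borel_measurable M" for y
        unfolding ip_def by (intro borel_measurable_power borel_measurable_sum borel_measurable_times vmeas) auto
      have "(\<integral>\<^sup>+ x. \<Phi> (Suc j) (w(Suc j := x)) \<partial>M) \<le>
          (\<integral>\<^sup>+ x. ennreal (\<Phi> j w) + ennreal (3 * q) * (\<Sum>k\<in>I. ennreal ((ip I (?v x) (?u k))\<^sup>2)) \<partial>M)"
      proof (rule nn_integral_mono)
        fix x assume "x \<in> space M"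
        from one[OF this] show "ennreal (\<Phi> (Suc j) (w(Suc j := x))) \<le>
            ennreal (\<Phi> j w) + ennreal (3 * q) * (\<Sum>k\<in>I. ennreal ((ip I (?v x) (?u k))\<^sup>2))"
          by (simp add: \<Phi>nonneg sum_nonneg ennreal_mult[symmetric] ennreal_plus[symmetric] sum_ennreal ennreal_leI del: ennreal_plus)
      qed
      also have "\<dots> = ennreal (\<Phi> j w) + ennreal (3 * q) * (\<Sum>k\<in>I. (\<integral>\<^sup>+ x. ennreal ((ip I (?v x) (?u k))\<^sup>2) \<partial>M))"
        using ipmeas
        by (simp add: nn_integral_add nn_integral_cmult nn_integral_sum[symmetric] M.emeasure_space_1 del: sum_ennreal)
      also have "\<dots> \<le> ennreal (\<Phi> j w) + ennreal (3 * q) * (\<Sum>k\<in>I. ennreal (\<sigma> * ip I (?u k) (?u k)))"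
        using var[of "Suc j" w] w jI by (intro add_left_mono mult_left_mono sum_mono) (auto simp: I_def)
      also have "(\<Sum>k\<in>I. ennreal (\<sigma> * ip I (?u k) (?u k))) = ennreal (\<sigma> * op_trace I (B j w ^^ (q - 1)))"
        unfolding op_trace_def sum_distrib_left Bj.ip_pow_pow qi
        using \<sigma> by (simp add: Bj.pow_form_nonneg)
      also have "ennreal (\<Phi> j w) + ennreal (3 * q) * \<dots> = ennreal (\<Phi> j w + 3 * q * (\<sigma> * op_trace I (B j w ^^ (q - 1))))"
        using \<sigma> by (simp add: \<Phi>nonneg ennreal_mult[symmetric] Bj.trace_pow_nonneg)
      also have "\<dots> \<le> ennreal ((1 + 3 * \<sigma> / R) * \<Phi> j w)"
      proof (rule ennreal_leI)
        \<comment> \<open>The lost power is regained from the shift: c tr B^(q - 1) \<le> tr B^q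
          turns the increment 3 q \<sigma> tr B^(q - 1) into at most (3 \<sigma> / R) tr
          B^q.\<close>
        have "c * op_trace I (B j w ^^ (q - 1)) \<le> \<Phi> j w"
          using Bj.trace_pow_growth[of "q - 1"] q0 by (simp add: \<Phi>_def)
        then have "3 * \<sigma> / R * (q * R * op_trace I (B j w ^^ (q - 1))) \<le> 3 * \<sigma> / R * \<Phi> j w"
          using \<sigma> R by (intro mult_left_mono) (auto simp: c_def)
        then show "\<Phi> j w + 3 * q * (\<sigma> * op_trace I (B j w ^^ (q - 1))) \<le> (1 + 3 * \<sigma> / R) * \<Phi> j w"
          using R by (simp add: field_simps)
      qed
      also have "\<dots> = ennreal (1 + 3 * \<sigma> / R) * \<Phi> j w"
        using \<sigma> R by (intro ennreal_mult) (auto simp: \<Phi>nonneg)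
      finally show "(\<integral>\<^sup>+ x. \<Phi> (Suc j) (w(Suc j := x)) \<partial>M) \<le> ennreal (1 + 3 * \<sigma> / R) * \<Phi> j w" .
    qed
    also have "\<dots> = ennreal (1 + 3 * \<sigma> / R) * (\<integral>\<^sup>+ w. \<Phi> j w \<partial>P n)"
      using \<Phi>meas[of j] j by (intro nn_integral_cmult) auto
    finally show ?thesis .
  qed
  have all: "(\<integral>\<^sup>+ w. \<Phi> j w \<partial>P n) \<le> ennreal ((1 + 3 * \<sigma> / R) ^ j * (n * c ^ q))" if "j \<le> n" for j
    using that
  proof (induction j)
    case 0
    have "\<Phi> 0 w = n * c ^ q" for w
      unfolding \<Phi>_def B_def using shifted_gram_empty_trace[OF fin] by (simp add: I_def)
    then show ?case by (simp add: P.emeasure_space_1)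
  next
    case (Suc j)
    have "(\<integral>\<^sup>+ w. \<Phi> (Suc j) w \<partial>P n) \<le> ennreal (1 + 3 * \<sigma> / R) * ennreal ((1 + 3 * \<sigma> / R) ^ j * (n * c ^ q))"
      using Suc by (intro order_trans[OF step] mult_left_mono) auto
    also have "\<dots> = ennreal ((1 + 3 * \<sigma> / R) ^ Suc j * (n * c ^ q))"
      using \<sigma> R c by (subst ennreal_mult[symmetric]) (auto simp: mult_ac)
    finally show ?case .
  qed
  \<comment> \<open>A violation by any vector x forces the trace up to L^q, so this one event serves
    all x simultaneously.\<close>
  define N where "N = {w \<in> space (P n). L ^ q \<le> \<Phi> n w}"
  have Nsets: "N \<in> sets (P n)" unfolding N_def using \<Phi>meas[of n] by measurable
  show ?thesis
  proof
    show "N \<in> sets (P n)" by (rule Nsets)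
    have "emeasure (P n) N = emeasure (P n) {w \<in> space (P n). 1 \<le> ennreal (1 / L ^ q) * \<Phi> n w}"
    proof -
      have "(1 \<le> ennreal (1 / L ^ q) * ennreal y) = (L ^ q \<le> y)" if "y \<ge> 0" for y
        using lam that by (simp add: ennreal_mult[symmetric] field_simps flip: ennreal_1)
      then show ?thesis unfolding N_def by (intro arg_cong2[of _ _ _ _ emeasure] refl) (auto simp: \<Phi>nonneg)
    qed
    also have "\<dots> \<le> ennreal (1 / L ^ q) * (\<integral>\<^sup>+ w. ennreal (\<Phi> n w) * indicator (space (P n)) w \<partial>P n)"
      using nn_integral_Markov_inequality[of "\<lambda>w. ennreal (\<Phi> n w)" "space (P n)" "P n" "ennreal (1 / L ^ q)"] \<Phi>meas[of n]
      by simp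
    also have "(\<integral>\<^sup>+ w. ennreal (\<Phi> n w) * indicator (space (P n)) w \<partial>P n) = (\<integral>\<^sup>+ w. \<Phi> n w \<partial>P n)"
      by (intro nn_integral_cong) simp
    also have "\<dots> \<le> ennreal ((1 + 3 * \<sigma> / R) ^ n * (n * c ^ q))" by (rule all) simp
    also have "\<dots> \<le> ennreal (exp (3 * real n * \<sigma> / R) * (n * c ^ q))"
    proof (intro ennreal_leI mult_right_mono)
      have "(1 + 3 * \<sigma> / R) ^ n \<le> exp (3 * \<sigma> / R) ^ n"
        using \<sigma> R by (intro power_mono exp_ge_add_one_self) auto
      also have "\<dots> = exp (3 * real n * \<sigma> / R)" by (simp add: exp_of_nat_mult[symmetric] mult_ac)
      finally show "(1 + 3 * \<sigma> / R) ^ n \<le> exp (3 * real n * \<sigma> / R)" .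
    qed (use c in auto)
    finally have "emeasure (P n) N \<le> ennreal (1 / L ^ q) * ennreal (exp (3 * real n * \<sigma> / R) * (n * c ^ q))"
      by (auto simp: mult_left_mono)
    also have "\<dots> = ennreal (n * (q * R / L) ^ q * exp (3 * real n * \<sigma> / R))"
      using lam c by (simp add: ennreal_mult[symmetric] c_def power_divide mult_ac)
    finally show "measure (P n) N \<le> n * (q * R / L) ^ q * exp (3 * real n * \<sigma> / R)"
      using lam R by (simp add: P.emeasure_eq_measure)
  next
    fix w x assume w: "w \<in> space (P n) - N"
    interpret Bn: coercive_op I c "B n w" by (rule B)
    show "(\<Sum>j\<in>{1..n}. (ip {1..n} (v j w) x)\<^sup>2) \<le> L * ip {1..n} x x"
    proof (rule ccontr)
      assume "\<not> (\<Sum>j\<in>{1..n}. (ip {1..n} (v j w) x)\<^sup>2) \<le> L * ip {1..n} x x"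
      then have neg: "L * ip I x x < (\<Sum>j\<in>I. (ip I (v j w) x)\<^sup>2)" by (simp add: I_def)
      have "ip I x x \<noteq> 0"
      proof
        assume "ip I x x = 0"
        then have "\<forall>i\<in>I. x i = 0" using fin by (simp add: ip_def sum_nonneg_eq_0_iff)
        then have "ip I (v j w) x = 0" for j by (simp add: ip_def)
        then show False using neg \<open>ip I x x = 0\<close> by simp
      qed
      then have pos: "ip I x x > 0" using ip_self_nonneg[of I x] by simp
      have "L * ip I x x \<le> ip I x (B n w x)"
        using neg pos c unfolding B_def ip_shifted_gram by (simp add: I_def power2_eq_square add_increasing)
      then have "L ^ q \<le> \<Phi> n w" unfolding \<Phi>_def by (rule Bn.trace_pow_ge) (use lam pos q0 in auto)
      then show False using w by (simp add: N_def)
    qed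
  qed
qed

section \<open>Gaussian vectors and the uniform distribution on the sphere\<close>

abbreviation borel_vec :: "nat \<Rightarrow> (nat \<Rightarrow> real) measure" where
  "borel_vec d \<equiv> \<Pi>\<^sub>M k\<in>{..<d}. borel"

abbreviation lborel_vec :: "nat \<Rightarrow> (nat \<Rightarrow> real) measure" where
  "lborel_vec d \<equiv> \<Pi>\<^sub>M k\<in>{..<d}. lborel"

definition std_gauss :: "real measure" where
  "std_gauss = density lborel std_normal_density"

definition gauss_vec :: "nat \<Rightarrow> (nat \<Rightarrow> real) measure" where
  "gauss_vec d = (\<Pi>\<^sub>M k\<in>{..<d}. std_gauss)"

lemma sets_std_gauss [measurable_cong, simp]: "sets std_gauss = sets borel"
  by (simp add: std_gauss_def)

lemma space_std_gauss [simp]: "space std_gauss = UNIV"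
  by (simp add: std_gauss_def)

lemma prob_space_std_gauss: "prob_space std_gauss"
  unfolding std_gauss_def by (rule prob_space_normal_density) simp

lemma sets_gauss_vec [measurable_cong, simp]: "sets (gauss_vec d) = sets (borel_vec d)"
  unfolding gauss_vec_def by (intro sets_PiM_cong) auto

lemma sets_lborel_vec [measurable_cong, simp]: "sets (lborel_vec d) = sets (borel_vec d)"
  by (intro sets_PiM_cong) auto

lemma prob_space_gauss_vec: "prob_space (gauss_vec d)"
  unfolding gauss_vec_def by (intro prob_space_PiM prob_space_std_gauss)

interpretation std_gauss: prob_space std_gauss by (rule prob_space_std_gauss)
interpretation gauss_vec: prob_space "gauss_vec d" for d by (rule prob_space_gauss_vec)
interpretation lborel_prod: product_sigma_finite "\<lambda>_::nat. lborel :: real measure" by unfold_locales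
interpretation gauss_prod: product_sigma_finite "\<lambda>_::nat. std_gauss" by unfold_locales

lemma measurable_dot [measurable]: "dot d u \<in> borel_measurable (borel_vec d)"
  unfolding dot_def by measurable

lemma measurable_dot_self [measurable]: "(\<lambda>x. dot d x x) \<in> borel_measurable (borel_vec d)"
  unfolding dot_def by measurable

lemma dot_self_nonneg: "dot d x x \<ge> 0"
  by (simp add: dot_def sum_nonneg)

lemma dot_commute: "dot d x y = dot d y x"
  by (simp add: dot_def mult.commute)

lemma L2_set_eq_sqrt_dot: "L2_set x {..<d} = sqrt (dot d x x)"
  by (simp add: L2_set_def dot_def power2_eq_square)

lemma dot_Suc_upd: "dot (Suc d) u (g(d := z)) = dot d u g + u d * z"
  by (simp add: dot_def)

lemma dot_self_Suc_upd: "dot (Suc d) (g(d := z)) (g(d := z)) = dot d g g + z\<^sup>2"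
  by (simp add: dot_def power2_eq_square)

section \<open>Integration over vectors one coordinate at a time\<close>

lemma nn_integral_std_gauss:
  assumes [measurable]: "f \<in> borel_measurable borel"
  shows "(\<integral>\<^sup>+ x. f x \<partial>std_gauss) = (\<integral>\<^sup>+ x. ennreal (std_normal_density x) * f x \<partial>lborel)"
  unfolding std_gauss_def by (subst nn_integral_density) auto

text \<open>A vector of dimension d has the indices below d, so d itself is the index of the new
  coordinate in \<open>g(d := z)\<close>.\<close>

lemma nn_integral_gauss_Suc:
  assumes "F \<in> borel_measurable (borel_vec (Suc d))"
  shows "(\<integral>\<^sup>+ g. F g \<partial>gauss_vec (Suc d)) = (\<integral>\<^sup>+ g. \<integral>\<^sup>+ z. F (g(d := z)) \<partial>std_gauss \<partial>gauss_vec d)"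
proof -
  have "F \<in> borel_measurable (Pi\<^sub>M (insert d {..<d}) (\<lambda>_. std_gauss))"
    using assms by (simp add: lessThan_Suc[symmetric] gauss_vec_def[symmetric] cong: measurable_cong_sets)
  from gauss_prod.product_nn_integral_insert[OF _ _ this] show ?thesis
    by (simp add: gauss_vec_def lessThan_Suc)
qed

lemma nn_integral_gauss_Suc_rev:
  assumes "F \<in> borel_measurable (borel_vec (Suc d))"
  shows "(\<integral>\<^sup>+ g. F g \<partial>gauss_vec (Suc d)) = (\<integral>\<^sup>+ z. \<integral>\<^sup>+ g. F (g(d := z)) \<partial>gauss_vec d \<partial>std_gauss)"
proof -
  have "F \<in> borel_measurable (Pi\<^sub>M (insert d {..<d}) (\<lambda>_. std_gauss))"
    using assms by (simp add: lessThan_Suc[symmetric] gauss_vec_def[symmetric] cong: measurable_cong_sets)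
  from gauss_prod.product_nn_integral_insert_rev[OF _ _ this] show ?thesis
    by (simp add: gauss_vec_def lessThan_Suc)
qed

lemma nn_integral_lborel_Suc:
  assumes "F \<in> borel_measurable (borel_vec (Suc d))"
  shows "(\<integral>\<^sup>+ g. F g \<partial>lborel_vec (Suc d)) =
    (\<integral>\<^sup>+ g. \<integral>\<^sup>+ z. F (g(d := z)) \<partial>lborel \<partial>lborel_vec d)"
proof -
  have "F \<in> borel_measurable (Pi\<^sub>M (insert d {..<d}) (\<lambda>_. lborel :: real measure))"
    using assms by (simp add: lessThan_Suc[symmetric] cong: measurable_cong_sets)
  from lborel_prod.product_nn_integral_insert[OF _ _ this] show ?thesis
    by (simp add: lessThan_Suc)
qed

lemma measurable_upd_Suc [measurable]:
  "(\<lambda>(g, z). g(d := z)) \<in> borel_vec d \<Otimes>\<^sub>M borel \<rightarrow>\<^sub>M borel_vec (Suc d)"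
  using measurable_add_dim[of d "{..<d}" "\<lambda>_. borel"] by (simp add: lessThan_Suc)

lemma nn_integral_lborel_scale:
  assumes r: "r > 0" and F: "F \<in> borel_measurable (borel_vec d)"
  shows "(\<integral>\<^sup>+ x. F x \<partial>lborel_vec d) =
    ennreal r ^ d * (\<integral>\<^sup>+ x. F (\<lambda>k\<in>{..<d}. r * x k) \<partial>lborel_vec d)"
  using F
proof (induction d arbitrary: F)
  case 0
  then show ?case by (simp add: PiM_empty nn_integral_count_space_finite restrict_def)
next
  case (Suc d)
  note [measurable] = Suc.prems
  have scale_upd: "(\<lambda>k\<in>{..<Suc d}. r * (x(d := z)) k) = (\<lambda>k\<in>{..<d}. r * x k)(d := r * z)" for x z
    by (auto simp: fun_eq_iff restrict_def)
  have Fd: "(\<lambda>x. F (x(d := z))) \<in> borel_measurable (borel_vec d)" for z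
    by measurable
  have FI: "(\<lambda>x. \<integral>\<^sup>+ z. F (x(d := z)) \<partial>lborel) \<in> borel_measurable (borel_vec d)"
    by measurable
  have Fs: "(\<lambda>x. F (\<lambda>k\<in>{..<Suc d}. r * x k)) \<in> borel_measurable (borel_vec (Suc d))"
    by measurable
  have "(\<integral>\<^sup>+ x. F x \<partial>lborel_vec (Suc d)) =
      ennreal r ^ d * (\<integral>\<^sup>+ x. \<integral>\<^sup>+ z. F ((\<lambda>k\<in>{..<d}. r * x k)(d := z)) \<partial>lborel \<partial>lborel_vec d)"
    unfolding nn_integral_lborel_Suc[OF Suc.prems] by (rule Suc.IH[OF FI])
  also have "\<dots> = ennreal r ^ d * (\<integral>\<^sup>+ x. ennreal r * (\<integral>\<^sup>+ z. F ((\<lambda>k\<in>{..<d}. r * x k)(d := r * z)) \<partial>lborel) \<partial>lborel_vec d)"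
  proof (intro arg_cong2[of _ _ _ _ "(*)"] refl nn_integral_cong)
    fix x assume "x \<in> space (lborel_vec d)"
    have "(\<lambda>k\<in>{..<d}. r * x k) \<in> space (borel_vec d)" by (auto simp: space_PiM)
    then have "(\<lambda>z. F ((\<lambda>k\<in>{..<d}. r * x k)(d := z))) \<in> borel_measurable borel"
      by measurable
    from nn_integral_real_affine[OF this, of r 0] r
    show "(\<integral>\<^sup>+ z. F ((\<lambda>k\<in>{..<d}. r * x k)(d := z)) \<partial>lborel) =
        ennreal r * (\<integral>\<^sup>+ z. F ((\<lambda>k\<in>{..<d}. r * x k)(d := r * z)) \<partial>lborel)" by simp
  qed
  also have "\<dots> = ennreal r ^ Suc d * (\<integral>\<^sup>+ x. \<integral>\<^sup>+ z. F ((\<lambda>k\<in>{..<d}. r * x k)(d := r * z)) \<partial>lborel \<partial>lborel_vec d)"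
  proof -
    have "(\<lambda>x. \<integral>\<^sup>+ z. F ((\<lambda>k\<in>{..<d}. r * x k)(d := r * z)) \<partial>lborel) \<in> borel_measurable (lborel_vec d)"
      by measurable
    then show ?thesis by (simp only: nn_integral_cmult power_Suc2 mult.assoc)
  qed
  also have "(\<integral>\<^sup>+ x. \<integral>\<^sup>+ z. F ((\<lambda>k\<in>{..<d}. r * x k)(d := r * z)) \<partial>lborel \<partial>lborel_vec d) =
      (\<integral>\<^sup>+ x. F (\<lambda>k\<in>{..<Suc d}. r * x k) \<partial>lborel_vec (Suc d))"
    unfolding nn_integral_lborel_Suc[OF Fs] scale_upd ..
  finally show ?case .
qed

lemma nn_integral_gauss_density:
  assumes "F \<in> borel_measurable (borel_vec d)"
  shows "(\<integral>\<^sup>+ g. F g \<partial>gauss_vec d) =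
    ennreal ((1 / sqrt (2 * pi)) ^ d) * (\<integral>\<^sup>+ x. ennreal (exp (- dot d x x / 2)) * F x \<partial>lborel_vec d)"
  using assms
proof (induction d arbitrary: F)
  case 0
  then show ?case by (simp add: gauss_vec_def PiM_empty dot_def)
next
  case (Suc d)
  note [measurable] = Suc.prems
  let ?c = "1 / sqrt (2 * pi)"
  have FI: "(\<lambda>x. \<integral>\<^sup>+ z. F (x(d := z)) \<partial>std_gauss) \<in> borel_measurable (borel_vec d)"
    by measurable
  have Fe: "(\<lambda>x. ennreal (exp (- dot (Suc d) x x / 2)) * F x) \<in> borel_measurable (borel_vec (Suc d))"
    by measurable
  have inner: "ennreal (exp (- dot d x x / 2)) * (\<integral>\<^sup>+ z. F (x(d := z)) \<partial>std_gauss) =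
      ennreal ?c * (\<integral>\<^sup>+ z. ennreal (exp (- dot (Suc d) (x(d := z)) (x(d := z)) / 2)) * F (x(d := z)) \<partial>lborel)"
    if "x \<in> space (lborel_vec d)" for x
  proof -
    have "x \<in> space (borel_vec d)" using that by (simp add: space_PiM)
    then have [measurable]: "(\<lambda>z. F (x(d := z))) \<in> borel_measurable borel" by measurable
    have "ennreal (exp (- dot d x x / 2)) * (\<integral>\<^sup>+ z. F (x(d := z)) \<partial>std_gauss) =
        (\<integral>\<^sup>+ z. ennreal (exp (- dot d x x / 2)) * (ennreal (std_normal_density z) * F (x(d := z))) \<partial>lborel)"
      by (simp add: nn_integral_std_gauss nn_integral_cmult)
    also have "\<dots> = (\<integral>\<^sup>+ z. ennreal ?c * (ennreal (exp (- dot (Suc d) (x(d := z)) (x(d := z)) / 2)) * F (x(d := z))) \<partial>lborel)"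
    proof (intro nn_integral_cong)
      fix z :: real
      have "exp (- dot d x x / 2) * std_normal_density z = ?c * exp (- dot (Suc d) (x(d := z)) (x(d := z)) / 2)"
        by (simp add: dot_self_Suc_upd std_normal_density_def exp_add[symmetric] add_divide_distrib)
      then show "ennreal (exp (- dot d x x / 2)) * (ennreal (std_normal_density z) * F (x(d := z))) =
          ennreal ?c * (ennreal (exp (- dot (Suc d) (x(d := z)) (x(d := z)) / 2)) * F (x(d := z)))"
        by (simp add: mult.assoc[symmetric] ennreal_mult[symmetric])
    qed
    also have "\<dots> = ennreal ?c * (\<integral>\<^sup>+ z. ennreal (exp (- dot (Suc d) (x(d := z)) (x(d := z)) / 2)) * F (x(d := z)) \<partial>lborel)"
      unfolding dot_self_Suc_upd by (intro nn_integral_cmult) measurable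
    finally show ?thesis .
  qed
  have "(\<integral>\<^sup>+ g. F g \<partial>gauss_vec (Suc d)) =
    ennreal (?c ^ d) * (\<integral>\<^sup>+ x. ennreal (exp (- dot d x x / 2)) * (\<integral>\<^sup>+ z. F (x(d := z)) \<partial>std_gauss) \<partial>lborel_vec d)"
    unfolding nn_integral_gauss_Suc[OF Suc.prems] by (rule Suc.IH[OF FI])
  also have "\<dots> = ennreal (?c ^ d) * (\<integral>\<^sup>+ x. ennreal ?c * (\<integral>\<^sup>+ z. ennreal (exp (- dot (Suc d) (x(d := z)) (x(d := z)) / 2)) * F (x(d := z)) \<partial>lborel) \<partial>lborel_vec d)"
    by (intro arg_cong2[of _ _ _ _ "(*)"] refl nn_integral_cong inner)
  also have "\<dots> = ennreal (?c ^ Suc d) * (\<integral>\<^sup>+ x. \<integral>\<^sup>+ z. ennreal (exp (- dot (Suc d) (x(d := z)) (x(d := z)) / 2)) * F (x(d := z)) \<partial>lborel \<partial>lborel_vec d)"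
    unfolding dot_self_Suc_upd by (subst nn_integral_cmult) (measurable, simp add: mult.assoc[symmetric] ennreal_mult[symmetric] mult.commute)
  also have "\<dots> = ennreal (?c ^ Suc d) * (\<integral>\<^sup>+ x. ennreal (exp (- dot (Suc d) x x / 2)) * F x \<partial>lborel_vec (Suc d))"
    unfolding nn_integral_lborel_Suc[OF Fe] ..
  finally show ?case .
qed

section \<open>The direction of a Gaussian vector is uniform on the sphere\<close>

lemma nn_integral_exp_tail:
  "(\<integral>\<^sup>+ s. ennreal (exp (- s)) * indicator {a..} s \<partial>lborel) = ennreal (exp (- a))"
proof -
  have "(\<integral>\<^sup>+ s. ennreal (exp (- s)) * indicator {a..} s \<partial>lborel) = ennreal (0 - (- exp (- a)))"
  proof (rule nn_integral_FTC_atLeast)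
    show "((\<lambda>s. - exp (- s)) has_real_derivative exp (- s)) (at s)" for s :: real
      by (auto intro!: derivative_eq_intros)
    show "((\<lambda>s::real. - exp (- s)) \<longlongrightarrow> 0) at_top"
      by (rule tendsto_eq_intros filterlim_compose[OF exp_at_bot] filterlim_uminus_at_bot_at_top | simp)+
  qed auto
  then show ?thesis by simp
qed

lemma dot_scale: "dot d (\<lambda>k\<in>{..<d}. r * x k) (\<lambda>k\<in>{..<d}. r * x k) = r\<^sup>2 * dot d x x"
  by (simp add: dot_def power2_eq_square sum_distrib_left mult_ac)

lemma radial_proj_scale:
  assumes "r > 0"
  shows "radial_proj d (\<lambda>k\<in>{..<d}. r * x k) = radial_proj d x"
proof -
  have "L2_set (\<lambda>k\<in>{..<d}. r * x k) {..<d} = r * L2_set x {..<d}"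
    unfolding L2_set_eq_sqrt_dot dot_scale using assms by (simp add: real_sqrt_mult)
  then show ?thesis using assms by (auto simp: radial_proj_def fun_eq_iff restrict_def)
qed

text \<open>Layer cake: the radial weight is a mixture of indicators of balls.\<close>

lemma nn_integral_radial_mixture:
  assumes [measurable]: "F \<in> borel_measurable (borel_vec d)"
    and hom: "\<And>r x. r > 0 \<Longrightarrow> F (\<lambda>k\<in>{..<d}. r * x k) = F x"
  shows "(\<integral>\<^sup>+ x. ennreal (exp (- dot d x x / 2)) * F x \<partial>lborel_vec d) =
    (\<integral>\<^sup>+ s. ennreal (exp (- s)) * (indicator {0<..} s * ennreal (sqrt (2 * s)) ^ d) \<partial>lborel) *
    (\<integral>\<^sup>+ x. F x * indicator (unit_ball d) x \<partial>lborel_vec d)"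
proof -
  let ?M = "lborel_vec d"
  interpret P: pair_sigma_finite lborel ?M
    by (intro pair_sigma_finite.intro lborel_prod.sigma_finite) (simp_all add: lborel.sigma_finite_measure_axioms)
  have ball: "indicator (unit_ball d) x = (indicator {x. dot d x x \<le> 1} x :: ennreal)" if "x \<in> space ?M" for x
    using that by (auto simp: indicator_def unit_ball_def L2_set_eq_sqrt_dot)
  \<comment> \<open>The weight exp(-|x|^2 / 2) is the integral of exp(-s) over s \<ge> |x|^2 / 2. At
    level s the ball of radius sqrt(2 s) is rescaled to the unit ball, which leaves F unchanged and
    yields the factor sqrt(2 s)^d.\<close>
  have "(\<integral>\<^sup>+ x. ennreal (exp (- dot d x x / 2)) * F x \<partial>?M) =
      (\<integral>\<^sup>+ x. (\<integral>\<^sup>+ s. ennreal (exp (- s)) * (if dot d x x / 2 \<le> s then 1 else 0) * F x \<partial>lborel) \<partial>?M)"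
  proof (rule nn_integral_cong)
    fix x
    have "(if dot d x x / 2 \<le> s then 1 else 0) = (indicator {dot d x x / 2..} s :: ennreal)" for s
      by (simp add: indicator_def)
    then show "ennreal (exp (- dot d x x / 2)) * F x =
        (\<integral>\<^sup>+ s. ennreal (exp (- s)) * (if dot d x x / 2 \<le> s then 1 else 0) * F x \<partial>lborel)"
      by (subst nn_integral_multc) (auto simp: nn_integral_exp_tail)
  qed
  also have "\<dots> = (\<integral>\<^sup>+ s. (\<integral>\<^sup>+ x. ennreal (exp (- s)) * (if dot d x x / 2 \<le> s then 1 else 0) * F x \<partial>?M) \<partial>lborel)"
    by (rule P.Fubini') measurable
  also have "\<dots> = (\<integral>\<^sup>+ s. ennreal (exp (- s)) * (indicator {0<..} s * ennreal (sqrt (2 * s)) ^ d) *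
      (\<integral>\<^sup>+ x. F x * indicator (unit_ball d) x \<partial>?M) \<partial>lborel)"
  proof (rule nn_integral_cong_AE)
    \<comment> \<open>At s = 0 the dilation degenerates, so this null set is removed.\<close>
    have "AE s in lborel. s \<noteq> (0::real)" by (rule AE_lborel_singleton)
    then show "AE s in lborel. (\<integral>\<^sup>+ x. ennreal (exp (- s)) * (if dot d x x / 2 \<le> s then 1 else 0) * F x \<partial>?M) =
      ennreal (exp (- s)) * (indicator {0<..} s * ennreal (sqrt (2 * s)) ^ d) *
      (\<integral>\<^sup>+ x. F x * indicator (unit_ball d) x \<partial>?M)"
    proof eventually_elim
      case (elim s)
      show ?case
      proof (cases "s > 0")
        case False
        then have "s < 0" using elim by simp
        then have "\<not> dot d x x / 2 \<le> s" for x using dot_self_nonneg[of d x] by simp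
        then show ?thesis using False by simp
      next
        case True
        define r where "r = sqrt (2 * s)"
        have r: "r > 0" "r\<^sup>2 = 2 * s" using True by (simp_all add: r_def)
        define G where "G x = indicator {x. dot d x x \<le> 2 * s} x * F x" for x
        have [measurable]: "G \<in> borel_measurable (borel_vec d)" unfolding G_def by measurable
        have "(\<integral>\<^sup>+ x. ennreal (exp (- s)) * (if dot d x x / 2 \<le> s then 1 else 0) * F x \<partial>?M) =
            ennreal (exp (- s)) * (\<integral>\<^sup>+ x. G x \<partial>?M)"
          by (subst nn_integral_cmult[symmetric]) (auto simp: G_def indicator_def intro!: nn_integral_cong)
        also have "(\<integral>\<^sup>+ x. G x \<partial>?M) = ennreal r ^ d * (\<integral>\<^sup>+ x. G (\<lambda>k\<in>{..<d}. r * x k) \<partial>?M)"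
          by (rule nn_integral_lborel_scale[OF r(1)]) measurable
        also have "(\<integral>\<^sup>+ x. G (\<lambda>k\<in>{..<d}. r * x k) \<partial>?M) = (\<integral>\<^sup>+ x. F x * indicator (unit_ball d) x \<partial>?M)"
        proof (rule nn_integral_cong)
          fix x assume "x \<in> space ?M"
          then show "G (\<lambda>k\<in>{..<d}. r * x k) = F x * indicator (unit_ball d) x"
            unfolding G_def hom[OF r(1)] ball[OF \<open>x \<in> space ?M\<close>] using r True
            by (auto simp: indicator_def dot_scale mult_le_cancel_left1 mult_le_cancel_left2)
        qed
        finally show ?thesis using True by (simp add: r_def mult.assoc)
      qed
    qed
  qed
  also have "\<dots> = (\<integral>\<^sup>+ s. ennreal (exp (- s)) * (indicator {0<..} s * ennreal (sqrt (2 * s)) ^ d) \<partial>lborel) *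
    (\<integral>\<^sup>+ x. F x * indicator (unit_ball d) x \<partial>?M)"
    by (rule nn_integral_multc) measurable
  finally show ?thesis .
qed

text \<open>For a function of the direction, the Gaussian integral and the integral over the unit
  ball are proportional with a factor \<open>C\<close> independent of the function. The constant
  function 1 identifies it as the inverse of the volume of the ball, so no Gamma integral is
  evaluated.\<close>

lemma nn_integral_uniform_sphere:
  assumes F [measurable]: "F \<in> borel_measurable (borel_vec d)"
  shows "(\<integral>\<^sup>+ x. F x \<partial>uniform_sphere d) = (\<integral>\<^sup>+ g. F (radial_proj d g) \<partial>gauss_vec d)"
proof -
  let ?M = "lborel_vec d"
  have rp [measurable]: "radial_proj d \<in> borel_vec d \<rightarrow>\<^sub>M borel_vec d"
    using measurable_radial_proj[of d] by (simp cong: measurable_cong_sets)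
  have [measurable]: "unit_ball d \<in> sets (borel_vec d)"
    using unit_ball_sets[of d] by simp
  define V where "V = emeasure ?M (unit_ball d)"
  have V: "V \<noteq> 0" "V \<noteq> \<infinity>" unfolding V_def by (rule emeasure_unit_ball)+
  define C where "C = ennreal ((1 / sqrt (2 * pi)) ^ d) *
    (\<integral>\<^sup>+ s. ennreal (exp (- s)) * (indicator {0<..} s * ennreal (sqrt (2 * s)) ^ d) \<partial>lborel)"
  have gen: "(\<integral>\<^sup>+ g. H (radial_proj d g) \<partial>gauss_vec d) =
      C * (\<integral>\<^sup>+ x. H (radial_proj d x) * indicator (unit_ball d) x \<partial>?M)"
    if [measurable]: "H \<in> borel_measurable (borel_vec d)" for H
    by (subst nn_integral_gauss_density, measurable, subst nn_integral_radial_mixture)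
      (auto simp: radial_proj_scale C_def mult.assoc)
  have "1 = C * V"
    using gen[of "\<lambda>_. 1"] by (simp add: gauss_vec.emeasure_space_1 V_def)
  then have CV: "C = 1 / V" using V by (metis ennreal_divide_times ennreal_divide_self mult.right_neutral mult_divide_eq_ennreal infinity_ennreal_def)
  have "(\<integral>\<^sup>+ x. F x \<partial>uniform_sphere d) = (\<integral>\<^sup>+ x. F (radial_proj d x) \<partial>uniform_measure ?M (unit_ball d))"
    unfolding uniform_sphere_def by (rule nn_integral_distr) (auto cong: measurable_cong_sets)
  also have "\<dots> = (\<integral>\<^sup>+ x. F (radial_proj d x) * indicator (unit_ball d) x \<partial>?M) / V"
    unfolding V_def by (rule nn_integral_uniform_measure) measurable
  also have "\<dots> = C * (\<integral>\<^sup>+ x. F (radial_proj d x) * indicator (unit_ball d) x \<partial>?M)"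
    unfolding CV by (simp add: divide_ennreal_def mult.commute)
  also have "\<dots> = (\<integral>\<^sup>+ g. F (radial_proj d g) \<partial>gauss_vec d)" using gen[OF F] by simp
  finally show ?thesis .
qed

text \<open>A plane rotation with \<open>c \<noteq> 0\<close> is a product of two shears and a scaling of determinant one.\<close>

lemma nn_integral_lborel_rotate:
  fixes c s :: real and H :: "real \<Rightarrow> real \<Rightarrow> ennreal"
  assumes cs: "c\<^sup>2 + s\<^sup>2 = 1" and [measurable]: "case_prod H \<in> borel_measurable (borel \<Otimes>\<^sub>M borel)"
  shows "(\<integral>\<^sup>+ z. \<integral>\<^sup>+ x. H (c * x - s * z) (s * x + c * z) \<partial>lborel \<partial>lborel) =
    (\<integral>\<^sup>+ z. \<integral>\<^sup>+ x. H x z \<partial>lborel \<partial>lborel)"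
proof -
  have sf: "pair_sigma_finite (lborel :: real measure) (lborel :: real measure)"
    by (intro pair_sigma_finite.intro lborel.sigma_finite_measure_axioms)
  show ?thesis
  proof (cases "c = 0")
    \<comment> \<open>The factorisation into shears divides by c. For c = 0 the map exchanges the
      axes up to a sign.\<close>
    case True
    then have s: "\<bar>s\<bar> = 1" using cs by (auto simp: abs_square_eq_1)
    have s0: "s \<noteq> 0" using s by auto
    have "(\<integral>\<^sup>+ z. \<integral>\<^sup>+ x. H (c * x - s * z) (s * x + c * z) \<partial>lborel \<partial>lborel) =
        (\<integral>\<^sup>+ z. \<integral>\<^sup>+ x. H (- s * z) x \<partial>lborel \<partial>lborel)"
    proof (rule nn_integral_cong)
      fix z :: real
      show "(\<integral>\<^sup>+ x. H (c * x - s * z) (s * x + c * z) \<partial>lborel) = (\<integral>\<^sup>+ x. H (- s * z) x \<partial>lborel)"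
        using nn_integral_real_affine[of "\<lambda>x. H (- s * z) x" s 0] s s0 True by simp
    qed
    also have "\<dots> = (\<integral>\<^sup>+ z. \<integral>\<^sup>+ x. H z x \<partial>lborel \<partial>lborel)"
      using nn_integral_real_affine[of "\<lambda>z. \<integral>\<^sup>+ x. H z x \<partial>lborel" "- s" 0] s s0 by simp
    also have "\<dots> = (\<integral>\<^sup>+ z. \<integral>\<^sup>+ x. H x z \<partial>lborel \<partial>lborel)"
      by (rule pair_sigma_finite.Fubini'[OF sf, symmetric]) measurable
    finally show ?thesis .
  next
    case False
    have "\<bar>c\<bar> * (\<integral>\<^sup>+ z. \<integral>\<^sup>+ x. H (c * x - s * z) (s * x + c * z) \<partial>lborel \<partial>lborel) =
        (\<integral>\<^sup>+ z. \<bar>c\<bar> * (\<integral>\<^sup>+ x. H (c * x - s * z) (s * x + c * z) \<partial>lborel) \<partial>lborel)"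
      by (rule nn_integral_cmult[symmetric]) measurable
    also have "\<dots> = (\<integral>\<^sup>+ z. \<integral>\<^sup>+ x. H x (s / c * x + z / c) \<partial>lborel \<partial>lborel)"
    proof (rule nn_integral_cong)
      fix z :: real
      have eq: "s / c * (- s * z + c * x) + z / c = s * x + c * z" for x
      proof -
        have "s / c * (- s * z + c * x) + z / c = (s * c * x + z * (1 - s\<^sup>2)) / c"
          using False by (simp add: field_simps power2_eq_square)
        also have "1 - s\<^sup>2 = c\<^sup>2" using cs by simp
        also have "(s * c * x + z * c\<^sup>2) / c = s * x + c * z"
          using False by (simp add: field_simps power2_eq_square)
        finally show ?thesis .
      qed
      show "\<bar>c\<bar> * (\<integral>\<^sup>+ x. H (c * x - s * z) (s * x + c * z) \<partial>lborel) =
          (\<integral>\<^sup>+ x. H x (s / c * x + z / c) \<partial>lborel)"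
        using nn_integral_real_affine[of "\<lambda>x. H x (s / c * x + z / c)" c "- s * z"] False
        by (simp only: eq) simp
    qed
    also have "\<dots> = (\<integral>\<^sup>+ x. \<integral>\<^sup>+ z. H x (s / c * x + z / c) \<partial>lborel \<partial>lborel)"
      by (rule pair_sigma_finite.Fubini'[OF sf]) measurable
    also have "\<dots> = (\<integral>\<^sup>+ x. \<bar>c\<bar> * (\<integral>\<^sup>+ z. H x z \<partial>lborel) \<partial>lborel)"
    proof (rule nn_integral_cong)
      fix x :: real
      have "(\<integral>\<^sup>+ z. H x z \<partial>lborel) = \<bar>1 / c\<bar> * (\<integral>\<^sup>+ z. H x (s / c * x + 1 / c * z) \<partial>lborel)"
        using False by (intro nn_integral_real_affine) auto
      then have "\<bar>c\<bar> * (\<integral>\<^sup>+ z. H x z \<partial>lborel) =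
          (ennreal \<bar>c\<bar> * ennreal \<bar>1 / c\<bar>) * (\<integral>\<^sup>+ z. H x (s / c * x + 1 / c * z) \<partial>lborel)"
        by (simp add: mult.assoc)
      also have "ennreal \<bar>c\<bar> * ennreal \<bar>1 / c\<bar> = 1"
        using False by (subst ennreal_mult[symmetric]) (auto simp: abs_mult[symmetric])
      finally show "(\<integral>\<^sup>+ z. H x (s / c * x + z / c) \<partial>lborel) = \<bar>c\<bar> * (\<integral>\<^sup>+ z. H x z \<partial>lborel)" by simp
    qed
    also have "\<dots> = \<bar>c\<bar> * (\<integral>\<^sup>+ x. \<integral>\<^sup>+ z. H x z \<partial>lborel \<partial>lborel)"
      by (rule nn_integral_cmult) measurable
    also have "(\<integral>\<^sup>+ x. \<integral>\<^sup>+ z. H x z \<partial>lborel \<partial>lborel) = (\<integral>\<^sup>+ z. \<integral>\<^sup>+ x. H x z \<partial>lborel \<partial>lborel)"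
      by (rule pair_sigma_finite.Fubini'[OF sf, symmetric]) measurable
    finally show ?thesis
      using False by (simp add: ennreal_mult_cancel_left)
  qed
qed

text \<open>The product of the two densities depends only on x^2 + z^2, which reduces the claim to
  Lebesgue measure.\<close>

lemma nn_integral_gauss_rotate:
  fixes c s :: real and H :: "real \<Rightarrow> real \<Rightarrow> ennreal"
  assumes cs: "c\<^sup>2 + s\<^sup>2 = 1" and [measurable]: "case_prod H \<in> borel_measurable (borel \<Otimes>\<^sub>M borel)"
  shows "(\<integral>\<^sup>+ z. \<integral>\<^sup>+ x. H x z \<partial>std_gauss \<partial>std_gauss) =
    (\<integral>\<^sup>+ z. \<integral>\<^sup>+ x. H (c * x - s * z) (s * x + c * z) \<partial>std_gauss \<partial>std_gauss)"
proof -
  define \<phi> where "\<phi> x = std_normal_density x" for x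
  have [measurable]: "\<phi> \<in> borel_measurable borel" by (simp add: \<phi>_def[abs_def])
  have expand: "(\<integral>\<^sup>+ z. \<integral>\<^sup>+ x. G x z \<partial>std_gauss \<partial>std_gauss) =
      (\<integral>\<^sup>+ z. \<integral>\<^sup>+ x. ennreal (\<phi> x * \<phi> z) * G x z \<partial>lborel \<partial>lborel)"
    if [measurable]: "case_prod G \<in> borel_measurable (borel \<Otimes>\<^sub>M borel)" for G :: "real \<Rightarrow> real \<Rightarrow> ennreal"
  proof -
    have "(\<integral>\<^sup>+ z. \<integral>\<^sup>+ x. G x z \<partial>std_gauss \<partial>std_gauss) =
        (\<integral>\<^sup>+ z. ennreal (\<phi> z) * (\<integral>\<^sup>+ x. ennreal (\<phi> x) * G x z \<partial>lborel) \<partial>lborel)"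
      by (simp add: nn_integral_std_gauss \<phi>_def)
    also have "\<dots> = (\<integral>\<^sup>+ z. (\<integral>\<^sup>+ x. ennreal (\<phi> z) * (ennreal (\<phi> x) * G x z) \<partial>lborel) \<partial>lborel)"
      by (intro nn_integral_cong nn_integral_cmult[symmetric]) measurable
    also have "\<dots> = (\<integral>\<^sup>+ z. \<integral>\<^sup>+ x. ennreal (\<phi> x * \<phi> z) * G x z \<partial>lborel \<partial>lborel)"
    proof (intro nn_integral_cong)
      fix z x :: real
      have "ennreal (\<phi> x * \<phi> z) = ennreal (\<phi> z) * ennreal (\<phi> x)"
        by (simp add: ennreal_mult[symmetric] \<phi>_def mult.commute)
      then show "ennreal (\<phi> z) * (ennreal (\<phi> x) * G x z) = ennreal (\<phi> x * \<phi> z) * G x z"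
        by (simp only: mult.assoc)
    qed
    finally show ?thesis .
  qed
  have inv: "\<phi> (c * x - s * z) * \<phi> (s * x + c * z) = \<phi> x * \<phi> z" for x z
  proof -
    have "(c * x - s * z)\<^sup>2 + (s * x + c * z)\<^sup>2 = (c\<^sup>2 + s\<^sup>2) * (x\<^sup>2 + z\<^sup>2)"
      by (simp add: power2_eq_square algebra_simps)
    then have "- (c * x - s * z)\<^sup>2 / 2 + - (s * x + c * z)\<^sup>2 / 2 = - x\<^sup>2 / 2 + - z\<^sup>2 / 2"
      using cs by (simp add: field_simps)
    then have "exp (- (c * x - s * z)\<^sup>2 / 2) * exp (- (s * x + c * z)\<^sup>2 / 2) = exp (- x\<^sup>2 / 2) * exp (- z\<^sup>2 / 2)"
      by (simp only: exp_add[symmetric])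
    then show ?thesis by (simp add: \<phi>_def std_normal_density_def)
  qed
  have "(\<integral>\<^sup>+ z. \<integral>\<^sup>+ x. H (c * x - s * z) (s * x + c * z) \<partial>std_gauss \<partial>std_gauss) =
     (\<integral>\<^sup>+ z. \<integral>\<^sup>+ x. ennreal (\<phi> (c * x - s * z) * \<phi> (s * x + c * z)) * H (c * x - s * z) (s * x + c * z) \<partial>lborel \<partial>lborel)"
    unfolding inv by (rule expand) measurable
  also have "\<dots> = (\<integral>\<^sup>+ z. \<integral>\<^sup>+ x. ennreal (\<phi> x * \<phi> z) * H x z \<partial>lborel \<partial>lborel)"
    by (rule nn_integral_lborel_rotate[OF cs, of "\<lambda>x z. ennreal (\<phi> x * \<phi> z) * H x z"]) measurable
  also have "\<dots> = (\<integral>\<^sup>+ z. \<integral>\<^sup>+ x. H x z \<partial>std_gauss \<partial>std_gauss)"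
    by (rule expand[symmetric]) measurable
  finally show ?thesis ..
qed

section \<open>Joint laws of linear functionals and of the norm of a Gaussian vector\<close>

lemma polar_decomposition:
  fixes a b :: real
  obtains r c s where "r \<ge> 0" "c\<^sup>2 + s\<^sup>2 = 1" "a = r * c" "b = r * s" "r\<^sup>2 = a\<^sup>2 + b\<^sup>2"
proof (cases "a = 0 \<and> b = 0")
  case True
  then show ?thesis using that[of 0 1 0] by simp
next
  case False
  define r where "r = sqrt (a\<^sup>2 + b\<^sup>2)"
  have r: "r > 0" "r\<^sup>2 = a\<^sup>2 + b\<^sup>2" using False by (auto simp: r_def sum_power2_gt_zero_iff)
  show ?thesis
  proof (rule that[of r "a / r" "b / r"])
    show "(a / r)\<^sup>2 + (b / r)\<^sup>2 = 1"
      using r by (simp add: power_divide add_divide_distrib[symmetric] r(2)[symmetric])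
  qed (use r in auto)
qed

lemma rotation_aligns:
  fixes a b c s r x z :: real
  assumes cs: "c\<^sup>2 + s\<^sup>2 = 1" and ab: "a = r * c" "b = r * s"
  shows "a * (c * x - s * z) + b * (s * x + c * z) = r * x"
proof -
  have "a * (c * x - s * z) + b * (s * x + c * z) = r * x * (c\<^sup>2 + s\<^sup>2)"
    unfolding ab by (simp add: power2_eq_square algebra_simps)
  then show ?thesis using cs by simp
qed

lemma std_gauss_Fubini:
  fixes H :: "real \<Rightarrow> real \<Rightarrow> ennreal"
  assumes "case_prod H \<in> borel_measurable (borel \<Otimes>\<^sub>M borel)"
  shows "(\<integral>\<^sup>+ x. \<integral>\<^sup>+ z. H x z \<partial>std_gauss \<partial>std_gauss) = (\<integral>\<^sup>+ z. \<integral>\<^sup>+ x. H x z \<partial>std_gauss \<partial>std_gauss)"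
proof -
  have "pair_sigma_finite std_gauss std_gauss"
    by (intro pair_sigma_finite.intro prob_space_imp_sigma_finite prob_space_std_gauss)
  from pair_sigma_finite.Fubini'[OF this, of H] assms show ?thesis by (simp cong: measurable_cong_sets)
qed

text \<open>\<alpha>, \<beta>, \<gamma> form a Cholesky factor of the Gram matrix of u and u'. Each
  new coordinate z is absorbed by two plane rotations: one aligns the functional u with a single
  variable x, the other merges the remaining noise \<gamma> y + \<delta> z of u' into one variable.
  Only plane rotations are used, whatever the dimension. The factor is asserted to exist because a
  degenerate Gram matrix does not determine it.\<close>

lemma pair_law:
  obtains \<alpha> \<beta> \<gamma> where "\<alpha> \<ge> 0" "\<gamma> \<ge> 0" "\<alpha>\<^sup>2 = dot d u u" "\<alpha> * \<beta> = dot d u u'" "\<beta>\<^sup>2 + \<gamma>\<^sup>2 = dot d u' u'"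
    "\<And>F. case_prod F \<in> borel_measurable (borel \<Otimes>\<^sub>M borel) \<Longrightarrow>
      (\<integral>\<^sup>+ g. F (dot d u g) (dot d u' g) \<partial>gauss_vec d) =
      (\<integral>\<^sup>+ x. \<integral>\<^sup>+ y. F (\<alpha> * x) (\<beta> * x + \<gamma> * y) \<partial>std_gauss \<partial>std_gauss)"
proof -
  have "\<exists>\<alpha> \<beta> \<gamma>. \<alpha> \<ge> 0 \<and> \<gamma> \<ge> 0 \<and> \<alpha>\<^sup>2 = dot d u u \<and> \<alpha> * \<beta> = dot d u u' \<and> \<beta>\<^sup>2 + \<gamma>\<^sup>2 = dot d u' u' \<and>
    (\<forall>F :: real \<Rightarrow> real \<Rightarrow> ennreal. case_prod F \<in> borel_measurable (borel \<Otimes>\<^sub>M borel) \<longrightarrow>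
      (\<integral>\<^sup>+ g. F (dot d u g) (dot d u' g) \<partial>gauss_vec d) =
      (\<integral>\<^sup>+ x. \<integral>\<^sup>+ y. F (\<alpha> * x) (\<beta> * x + \<gamma> * y) \<partial>std_gauss \<partial>std_gauss))"
  proof (induction d)
    case 0
    show ?case
      using std_gauss.emeasure_space_1
      by (intro exI[of _ 0]) (simp add: dot_def gauss_vec.emeasure_space_1)
  next
    case (Suc d)
    then obtain \<alpha> \<beta> \<gamma> where abc: "\<alpha> \<ge> 0" "\<gamma> \<ge> 0" "\<alpha>\<^sup>2 = dot d u u" "\<alpha> * \<beta> = dot d u u'" "\<beta>\<^sup>2 + \<gamma>\<^sup>2 = dot d u' u'"
      and IH: "\<And>F :: real \<Rightarrow> real \<Rightarrow> ennreal. case_prod F \<in> borel_measurable (borel \<Otimes>\<^sub>M borel) \<Longrightarrow>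
      (\<integral>\<^sup>+ g. F (dot d u g) (dot d u' g) \<partial>gauss_vec d) =
      (\<integral>\<^sup>+ x. \<integral>\<^sup>+ y. F (\<alpha> * x) (\<beta> * x + \<gamma> * y) \<partial>std_gauss \<partial>std_gauss)"
      by blast
    obtain \<alpha>' c s where r1: "\<alpha>' \<ge> 0" "c\<^sup>2 + s\<^sup>2 = 1" "\<alpha> = \<alpha>' * c" "u d = \<alpha>' * s" "\<alpha>'\<^sup>2 = \<alpha>\<^sup>2 + (u d)\<^sup>2"
      by (rule polar_decomposition)
    define \<beta>' where "\<beta>' = \<beta> * c + u' d * s"
    define \<delta> where "\<delta> = u' d * c - \<beta> * s"
    obtain \<gamma>' k l where r2: "\<gamma>' \<ge> 0" "k\<^sup>2 + l\<^sup>2 = 1" "\<gamma> = \<gamma>' * k" "\<delta> = \<gamma>' * l" "\<gamma>'\<^sup>2 = \<gamma>\<^sup>2 + \<delta>\<^sup>2"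
      by (rule polar_decomposition)
    show ?case
    proof (rule exI[of _ \<alpha>'], rule exI[of _ \<beta>'], rule exI[of _ \<gamma>'], intro conjI allI impI)
      show "\<alpha>' \<ge> 0" "\<gamma>' \<ge> 0" by (rule r1 r2)+
      show "\<alpha>'\<^sup>2 = dot (Suc d) u u" using r1 abc by (simp add: dot_def power2_eq_square)
      have "\<alpha>' * \<beta>' = \<alpha> * \<beta> + u d * u' d" unfolding \<beta>'_def r1(3,4) by (simp add: algebra_simps)
      then show "\<alpha>' * \<beta>' = dot (Suc d) u u'" using abc by (simp add: dot_def)
      have "\<beta>'\<^sup>2 + \<delta>\<^sup>2 = (c\<^sup>2 + s\<^sup>2) * (\<beta>\<^sup>2 + (u' d)\<^sup>2)"
        unfolding \<beta>'_def \<delta>_def by (simp add: power2_eq_square algebra_simps)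
      then show "\<beta>'\<^sup>2 + \<gamma>'\<^sup>2 = dot (Suc d) u' u'"
        using r2 r1 abc by (simp add: dot_def power2_eq_square)
    next
      fix F :: "real \<Rightarrow> real \<Rightarrow> ennreal"
      assume Fm [measurable]: "case_prod F \<in> borel_measurable (borel \<Otimes>\<^sub>M borel)"
      have "(\<integral>\<^sup>+ g. F (dot (Suc d) u g) (dot (Suc d) u' g) \<partial>gauss_vec (Suc d)) =
          (\<integral>\<^sup>+ z. \<integral>\<^sup>+ g. F (dot d u g + u d * z) (dot d u' g + u' d * z) \<partial>gauss_vec d \<partial>std_gauss)"
        by (subst nn_integral_gauss_Suc_rev) (auto simp: dot_Suc_upd)
      also have "\<dots> = (\<integral>\<^sup>+ z. \<integral>\<^sup>+ x. \<integral>\<^sup>+ y. F (\<alpha> * x + u d * z) (\<beta> * x + \<gamma> * y + u' d * z) \<partial>std_gauss \<partial>std_gauss \<partial>std_gauss)"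
        by (intro nn_integral_cong IH[of "\<lambda>a b. F (a + u d * z) (b + u' d * z)" for z]) measurable
      also have "\<dots> = (\<integral>\<^sup>+ z. \<integral>\<^sup>+ x. \<integral>\<^sup>+ y. F (\<alpha> * (c * x - s * z) + u d * (s * x + c * z))
          (\<beta> * (c * x - s * z) + \<gamma> * y + u' d * (s * x + c * z)) \<partial>std_gauss \<partial>std_gauss \<partial>std_gauss)"
        by (rule nn_integral_gauss_rotate[OF r1(2), of "\<lambda>x z. \<integral>\<^sup>+ y. F (\<alpha> * x + u d * z) (\<beta> * x + \<gamma> * y + u' d * z) \<partial>std_gauss"]) measurable
      also have "\<dots> = (\<integral>\<^sup>+ z. \<integral>\<^sup>+ x. \<integral>\<^sup>+ y. F (\<alpha>' * x) (\<beta>' * x + (\<gamma> * y + \<delta> * z)) \<partial>std_gauss \<partial>std_gauss \<partial>std_gauss)"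
      proof -
        have "\<alpha> * (c * x - s * z) + u d * (s * x + c * z) = \<alpha>' * x" for x z
          by (rule rotation_aligns[OF r1(2-4)])
        moreover have "\<beta> * (c * x - s * z) + \<gamma> * y + u' d * (s * x + c * z) = \<beta>' * x + (\<gamma> * y + \<delta> * z)" for x y z
          unfolding \<beta>'_def \<delta>_def by (simp add: algebra_simps)
        ultimately show ?thesis by (simp only:)
      qed
      also have "\<dots> = (\<integral>\<^sup>+ x. \<integral>\<^sup>+ z. \<integral>\<^sup>+ y. F (\<alpha>' * x) (\<beta>' * x + (\<gamma> * y + \<delta> * z)) \<partial>std_gauss \<partial>std_gauss \<partial>std_gauss)"
        by (rule std_gauss_Fubini[symmetric]) measurable
      also have "\<dots> = (\<integral>\<^sup>+ x. \<integral>\<^sup>+ z. \<integral>\<^sup>+ y. F (\<alpha>' * x) (\<beta>' * x + \<gamma>' * y) \<partial>std_gauss \<partial>std_gauss \<partial>std_gauss)"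
      proof (rule nn_integral_cong)
        fix x :: real
        have eq: "\<gamma> * (k * y - l * z) + \<delta> * (l * y + k * z) = \<gamma>' * y" for y z
          by (rule rotation_aligns[OF r2(2-4)])
        show "(\<integral>\<^sup>+ z. \<integral>\<^sup>+ y. F (\<alpha>' * x) (\<beta>' * x + (\<gamma> * y + \<delta> * z)) \<partial>std_gauss \<partial>std_gauss) =
            (\<integral>\<^sup>+ z. \<integral>\<^sup>+ y. F (\<alpha>' * x) (\<beta>' * x + \<gamma>' * y) \<partial>std_gauss \<partial>std_gauss)"
          by (subst nn_integral_gauss_rotate[OF r2(2), of "\<lambda>y z. F (\<alpha>' * x) (\<beta>' * x + (\<gamma> * y + \<delta> * z))"])
            (measurable, simp only: eq)
      qed
      also have "\<dots> = (\<integral>\<^sup>+ x. \<integral>\<^sup>+ y. F (\<alpha>' * x) (\<beta>' * x + \<gamma>' * y) \<partial>std_gauss \<partial>std_gauss)"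
        using std_gauss.emeasure_space_1 by simp
      finally show "(\<integral>\<^sup>+ g. F (dot (Suc d) u g) (dot (Suc d) u' g) \<partial>gauss_vec (Suc d)) =
          (\<integral>\<^sup>+ x. \<integral>\<^sup>+ y. F (\<alpha>' * x) (\<beta>' * x + \<gamma>' * y) \<partial>std_gauss \<partial>std_gauss)" .
    qed
  qed
  then show ?thesis using that by blast
qed

lemma gauss_vec_Fubini:
  fixes H :: "(nat \<Rightarrow> real) \<Rightarrow> real \<Rightarrow> ennreal"
  assumes "case_prod H \<in> borel_measurable (borel_vec d \<Otimes>\<^sub>M borel)"
  shows "(\<integral>\<^sup>+ z. \<integral>\<^sup>+ h. H h z \<partial>gauss_vec d \<partial>std_gauss) = (\<integral>\<^sup>+ h. \<integral>\<^sup>+ z. H h z \<partial>std_gauss \<partial>gauss_vec d)"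
proof -
  have "pair_sigma_finite (gauss_vec d) std_gauss"
    by (intro pair_sigma_finite.intro prob_space_imp_sigma_finite prob_space_std_gauss prob_space_gauss_vec)
  from pair_sigma_finite.Fubini'[OF this, of H] assms show ?thesis by (simp cong: measurable_cong_sets)
qed

text \<open>Decomposition of g into its component x along u and an orthogonal part h of dimension
  one less. The base case is dimension 1, where \<alpha> is the entry of u and may be negative;
  every later step passes through a polar decomposition, whence the sign condition only for d >
  0.\<close>

lemma norm_law_aux:
  "\<exists>\<alpha>. (d > 0 \<longrightarrow> \<alpha> \<ge> 0) \<and> \<alpha>\<^sup>2 = dot (Suc d) u u \<and>
    (\<forall>F :: real \<Rightarrow> real \<Rightarrow> ennreal. case_prod F \<in> borel_measurable (borel \<Otimes>\<^sub>M borel) \<longrightarrow>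
      (\<integral>\<^sup>+ g. F (dot (Suc d) u g) (dot (Suc d) g g) \<partial>gauss_vec (Suc d)) =
      (\<integral>\<^sup>+ h. \<integral>\<^sup>+ x. F (\<alpha> * x) (x\<^sup>2 + dot d h h) \<partial>std_gauss \<partial>gauss_vec d))"
proof (induction d)
  case 0
  have "(\<integral>\<^sup>+ g. F (dot (Suc 0) u g) (dot (Suc 0) g g) \<partial>gauss_vec (Suc 0)) =
      (\<integral>\<^sup>+ h. \<integral>\<^sup>+ x. F (u 0 * x) (x\<^sup>2 + dot 0 h h) \<partial>std_gauss \<partial>gauss_vec 0)"
    if [measurable]: "case_prod F \<in> borel_measurable (borel \<Otimes>\<^sub>M borel)" for F :: "real \<Rightarrow> real \<Rightarrow> ennreal"
    by (subst nn_integral_gauss_Suc, measurable) (simp add: dot_Suc_upd dot_self_Suc_upd, simp add: dot_def power2_eq_square)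
  then show ?case by (intro exI[of _ "u 0"]) (auto simp: dot_def power2_eq_square)
next
  case (Suc d)
  then obtain \<alpha> where a: "\<alpha>\<^sup>2 = dot (Suc d) u u"
    and IH: "\<And>F :: real \<Rightarrow> real \<Rightarrow> ennreal. case_prod F \<in> borel_measurable (borel \<Otimes>\<^sub>M borel) \<Longrightarrow>
      (\<integral>\<^sup>+ g. F (dot (Suc d) u g) (dot (Suc d) g g) \<partial>gauss_vec (Suc d)) =
      (\<integral>\<^sup>+ h. \<integral>\<^sup>+ x. F (\<alpha> * x) (x\<^sup>2 + dot d h h) \<partial>std_gauss \<partial>gauss_vec d)"
    by blast
  obtain \<alpha>' c s where r1: "\<alpha>' \<ge> 0" "c\<^sup>2 + s\<^sup>2 = 1" "\<alpha> = \<alpha>' * c" "u (Suc d) = \<alpha>' * s" "\<alpha>'\<^sup>2 = \<alpha>\<^sup>2 + (u (Suc d))\<^sup>2"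
    by (rule polar_decomposition)
  show ?case
  proof (intro exI[of _ \<alpha>'] conjI allI impI)
    show "\<alpha>' \<ge> 0" by (rule r1)
    show "\<alpha>'\<^sup>2 = dot (Suc (Suc d)) u u" using r1 a by (simp add: dot_def power2_eq_square)
    fix F :: "real \<Rightarrow> real \<Rightarrow> ennreal"
    assume Fm [measurable]: "case_prod F \<in> borel_measurable (borel \<Otimes>\<^sub>M borel)"
    have "(\<integral>\<^sup>+ g. F (dot (Suc (Suc d)) u g) (dot (Suc (Suc d)) g g) \<partial>gauss_vec (Suc (Suc d))) =
        (\<integral>\<^sup>+ z. \<integral>\<^sup>+ g. F (dot (Suc d) u g + u (Suc d) * z) (dot (Suc d) g g + z\<^sup>2) \<partial>gauss_vec (Suc d) \<partial>std_gauss)"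
      by (subst nn_integral_gauss_Suc_rev, measurable) (simp only: dot_self_Suc_upd, simp only: dot_Suc_upd)
    also have "\<dots> = (\<integral>\<^sup>+ z. \<integral>\<^sup>+ h. \<integral>\<^sup>+ x. F (\<alpha> * x + u (Suc d) * z) (x\<^sup>2 + dot d h h + z\<^sup>2) \<partial>std_gauss \<partial>gauss_vec d \<partial>std_gauss)"
      by (intro nn_integral_cong IH[of "\<lambda>a b. F (a + u (Suc d) * z) (b + z\<^sup>2)" for z]) measurable
    also have "\<dots> = (\<integral>\<^sup>+ h. \<integral>\<^sup>+ z. \<integral>\<^sup>+ x. F (\<alpha> * x + u (Suc d) * z) (x\<^sup>2 + dot d h h + z\<^sup>2) \<partial>std_gauss \<partial>std_gauss \<partial>gauss_vec d)"
      by (rule gauss_vec_Fubini) measurable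
    also have "\<dots> = (\<integral>\<^sup>+ h. \<integral>\<^sup>+ z. \<integral>\<^sup>+ x. F (\<alpha>' * x) (x\<^sup>2 + dot d h h + z\<^sup>2) \<partial>std_gauss \<partial>std_gauss \<partial>gauss_vec d)"
    proof (rule nn_integral_cong)
      fix h :: "nat \<Rightarrow> real"
      have 1: "\<alpha> * (c * x - s * z) + u (Suc d) * (s * x + c * z) = \<alpha>' * x" for x z
        by (rule rotation_aligns[OF r1(2-4)])
      have 2: "(c * x - s * z)\<^sup>2 + dot d h h + (s * x + c * z)\<^sup>2 = x\<^sup>2 + dot d h h + z\<^sup>2" for x z
      proof -
        have "(c * x - s * z)\<^sup>2 + (s * x + c * z)\<^sup>2 = (c\<^sup>2 + s\<^sup>2) * (x\<^sup>2 + z\<^sup>2)"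
          by (simp add: power2_eq_square algebra_simps)
        then show ?thesis using r1(2) by simp
      qed
      show "(\<integral>\<^sup>+ z. \<integral>\<^sup>+ x. F (\<alpha> * x + u (Suc d) * z) (x\<^sup>2 + dot d h h + z\<^sup>2) \<partial>std_gauss \<partial>std_gauss) =
         (\<integral>\<^sup>+ z. \<integral>\<^sup>+ x. F (\<alpha>' * x) (x\<^sup>2 + dot d h h + z\<^sup>2) \<partial>std_gauss \<partial>std_gauss)"
        using nn_integral_gauss_rotate[OF r1(2), of "\<lambda>x z. F (\<alpha> * x + u (Suc d) * z) (x\<^sup>2 + dot d h h + z\<^sup>2)"]
        by (simp add: 1 2)
    qed
    also have "\<dots> = (\<integral>\<^sup>+ h. \<integral>\<^sup>+ x. F (\<alpha>' * x) (x\<^sup>2 + dot (Suc d) h h) \<partial>std_gauss \<partial>gauss_vec (Suc d))"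
      by (subst nn_integral_gauss_Suc, measurable) (simp add: dot_self_Suc_upd add.assoc)
    finally show "(\<integral>\<^sup>+ g. F (dot (Suc (Suc d)) u g) (dot (Suc (Suc d)) g g) \<partial>gauss_vec (Suc (Suc d))) =
      (\<integral>\<^sup>+ h. \<integral>\<^sup>+ x. F (\<alpha>' * x) (x\<^sup>2 + dot (Suc d) h h) \<partial>std_gauss \<partial>gauss_vec (Suc d))" .
  qed
qed

lemma norm_law:
  assumes d: "d > 0" and u: "dot (Suc d) u u = 1"
    and F: "case_prod F \<in> borel_measurable (borel \<Otimes>\<^sub>M borel)"
  shows "(\<integral>\<^sup>+ g. F (dot (Suc d) u g) (dot (Suc d) g g) \<partial>gauss_vec (Suc d)) =
      (\<integral>\<^sup>+ h. \<integral>\<^sup>+ x. F x (x\<^sup>2 + dot d h h) \<partial>std_gauss \<partial>gauss_vec d)"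
proof -
  obtain \<alpha> where a: "\<alpha> \<ge> 0" "\<alpha>\<^sup>2 = 1"
    and IH: "\<And>F :: real \<Rightarrow> real \<Rightarrow> ennreal. case_prod F \<in> borel_measurable (borel \<Otimes>\<^sub>M borel) \<Longrightarrow>
      (\<integral>\<^sup>+ g. F (dot (Suc d) u g) (dot (Suc d) g g) \<partial>gauss_vec (Suc d)) =
      (\<integral>\<^sup>+ h. \<integral>\<^sup>+ x. F (\<alpha> * x) (x\<^sup>2 + dot d h h) \<partial>std_gauss \<partial>gauss_vec d)"
    using norm_law_aux[of d u] d u by auto
  have "\<alpha> = 1" using a by (simp add: power2_eq_1_iff)
  with IH[OF F] show ?thesis by simp
qed

section \<open>One-dimensional marginals of the sphere and the edge threshold\<close>

interpretation sphere: prob_space "uniform_sphere d" for d by (rule prob_space_uniform_sphere)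

lemma emeasure_std_gauss_singleton: "emeasure std_gauss {x} = 0"
proof -
  have "AE y in lborel. y \<in> {x} \<longrightarrow> ennreal (std_normal_density y) = 0"
    using AE_lborel_singleton[of x] by eventually_elim simp
  then have "{x} \<in> null_sets std_gauss"
    unfolding std_gauss_def by (subst null_sets_density_iff) auto
  then show ?thesis by blast
qed

lemma emeasure_std_gauss_open_pos:
  assumes "open S" "S \<noteq> {}"
  shows "emeasure std_gauss S \<noteq> 0"
proof
  assume "emeasure std_gauss S = 0"
  then have "S \<in> null_sets std_gauss" using assms by (intro null_setsI) auto
  then have "AE x in lborel. x \<in> S \<longrightarrow> ennreal (std_normal_density x) = 0"
    unfolding std_gauss_def by (subst (asm) null_sets_density_iff) auto
  moreover have "ennreal (std_normal_density x) \<noteq> 0" for x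
    using normal_density_pos[of 1 0 x] by simp
  ultimately have "AE x in lborel. x \<notin> S" by simp
  then have "S \<in> null_sets lborel" using assms by (subst (asm) AE_iff_null_sets[symmetric]) auto
  moreover obtain x e where "e > 0" "ball x e \<subseteq> S" using assms by (meson ex_in_conv openE)
  ultimately have "ball x e \<in> null_sets lborel" by (intro null_sets_subset[of S lborel "ball x e"]) auto
  then have "emeasure lborel (ball x e) = 0" by blast
  moreover have "ball x e = {x - e<..<x + e}" by (auto simp: ball_def dist_real_def)
  ultimately show False using \<open>e > 0\<close> by simp
qed

lemma AE_gauss_vec_nonzero: "d > 0 \<Longrightarrow> AE g in gauss_vec d. dot d g g > 0"
proof -
  assume "d > 0"
  then obtain m where d: "d = Suc m" by (metis gr0_implies_Suc)
  have "(\<integral>\<^sup>+ g. indicator {g. dot d g g = 0} g \<partial>gauss_vec d) =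
      (\<integral>\<^sup>+ g. \<integral>\<^sup>+ z. indicator {g. dot d g g = 0} (g(m := z)) \<partial>std_gauss \<partial>gauss_vec m)"
    unfolding d by (rule nn_integral_gauss_Suc) measurable
  also have "\<dots> \<le> (\<integral>\<^sup>+ g. \<integral>\<^sup>+ z. indicator {0} z \<partial>std_gauss \<partial>gauss_vec m)"
  proof (intro nn_integral_mono)
    fix g z
    have "z = 0" if "dot m g g + z\<^sup>2 = 0"
      using that dot_self_nonneg[of m g] by (simp add: add_nonneg_eq_0_iff)
    then show "indicator {g. dot d g g = 0} (g(m := z)) \<le> (indicator {0} z :: ennreal)"
      by (auto simp: indicator_def d dot_self_Suc_upd)
  qed
  also have "\<dots> = 0" by (simp add: emeasure_std_gauss_singleton)
  finally have "(\<integral>\<^sup>+ g. indicator {g. dot d g g = 0} g \<partial>gauss_vec d) = 0" by simp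
  then have "AE g in gauss_vec d. indicator {g. dot d g g = 0} g = (0::ennreal)"
    by (subst (asm) nn_integral_0_iff_AE) measurable
  then show ?thesis
    by eventually_elim (metis (mono_tags) dot_self_nonneg indicator_simps(1) mem_Collect_eq order_le_less zero_neq_one)
qed

lemma dot_radial_proj: "dot d u (radial_proj d g) = dot d u g / sqrt (dot d g g)"
  by (simp add: dot_def radial_proj_def L2_set_eq_sqrt_dot sum_divide_distrib)

lemma nn_integral_sphere_dots:
  assumes [measurable]: "case_prod F \<in> borel_measurable (borel \<Otimes>\<^sub>M borel)"
  shows "(\<integral>\<^sup>+ x. F (dot d u x) (dot d u' x) \<partial>uniform_sphere d) =
    (\<integral>\<^sup>+ g. F (dot d u g / sqrt (dot d g g)) (dot d u' g / sqrt (dot d g g)) \<partial>gauss_vec d)"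
  by (subst nn_integral_uniform_sphere) (measurable, simp add: dot_radial_proj)

lemma AE_sphere_unit:
  assumes "d > 0"
  shows "AE x in uniform_sphere d. dot d x x = 1"
proof -
  have "(\<integral>\<^sup>+ x. indicator {x. dot d x x \<noteq> 1} x \<partial>uniform_sphere d) =
      (\<integral>\<^sup>+ g. indicator {x. dot d x x \<noteq> 1} (radial_proj d g) \<partial>gauss_vec d)"
    by (rule nn_integral_uniform_sphere) measurable
  also have "\<dots> = (\<integral>\<^sup>+ g. 0 \<partial>gauss_vec d)"
  proof (rule nn_integral_cong_AE)
    show "AE g in gauss_vec d. indicator {x. dot d x x \<noteq> 1} (radial_proj d g) = (0::ennreal)"
      using AE_gauss_vec_nonzero[OF assms]
    proof eventually_elim
      case (elim g)
      have "dot d (radial_proj d g) (radial_proj d g) = (\<Sum>k<d. g k * g k / dot d g g)"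
        unfolding dot_def[of d "radial_proj d g"] using elim
        by (intro sum.cong) (auto simp: radial_proj_def L2_set_eq_sqrt_dot)
      also have "\<dots> = 1" using elim by (simp add: sum_divide_distrib[symmetric] dot_def)
      finally show ?case by simp
    qed
  qed
  finally have "(\<integral>\<^sup>+ x. indicator {x. dot d x x \<noteq> 1} x \<partial>uniform_sphere d) = 0" by simp
  then have "AE x in uniform_sphere d. indicator {x. dot d x x \<noteq> 1} x = (0::ennreal)"
    by (subst (asm) nn_integral_0_iff_AE) measurable
  then show ?thesis by eventually_elim (auto simp: indicator_def split: if_splits)
qed

text \<open>The law of the first coordinate. Rotation invariance makes it the law of the inner
  product with every fixed unit vector; this is shown for d \<ge> 2.\<close>

definition sphere_marginal :: "nat \<Rightarrow> real measure" where
  "sphere_marginal d = distr (uniform_sphere d) borel (dot d (unit_vec 0))"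

interpretation marginal: real_distribution "sphere_marginal d" for d
  unfolding sphere_marginal_def
  by (intro real_distribution.intro sphere.prob_space_distr)
    (auto simp: real_distribution_axioms_def)

lemma dot_unit_vec: "d > 0 \<Longrightarrow> dot d (unit_vec 0) (unit_vec 0) = 1"
  by (simp add: dot_def unit_vec_def)

text \<open>The right-hand side does not mention u: this is the rotation invariance. On the fibre
  over a fixed orthogonal part h, only one Gaussian variable x remains.\<close>

lemma nn_integral_sphere_dot:
  assumes d: "d > 0" and u: "dot (Suc d) u u = 1" and [measurable]: "F \<in> borel_measurable borel"
  shows "(\<integral>\<^sup>+ x. F (dot (Suc d) u x) \<partial>uniform_sphere (Suc d)) =
    (\<integral>\<^sup>+ h. \<integral>\<^sup>+ x. F (x / sqrt (x\<^sup>2 + dot d h h)) \<partial>std_gauss \<partial>gauss_vec d)"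
proof -
  have "(\<integral>\<^sup>+ x. F (dot (Suc d) u x) \<partial>uniform_sphere (Suc d)) =
      (\<integral>\<^sup>+ g. F (dot (Suc d) u g / sqrt (dot (Suc d) g g)) \<partial>gauss_vec (Suc d))"
    by (rule nn_integral_sphere_dots[of "\<lambda>a b. F a" "Suc d" u u]) measurable
  also have "\<dots> = (\<integral>\<^sup>+ h. \<integral>\<^sup>+ x. F (x / sqrt (x\<^sup>2 + dot d h h)) \<partial>std_gauss \<partial>gauss_vec d)"
    by (rule norm_law[OF d u, of "\<lambda>a b. F (a / sqrt b)"]) measurable
  finally show ?thesis .
qed

lemma nn_integral_sphere_marginal:
  assumes "d \<ge> 2" "dot d u u = 1" "F \<in> borel_measurable borel"
  shows "(\<integral>\<^sup>+ x. F (dot d u x) \<partial>uniform_sphere d) = (\<integral>\<^sup>+ y. F y \<partial>sphere_marginal d)"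
proof -
  obtain m where m: "d = Suc m" "m > 0" using assms(1) by (cases d) auto
  have "(\<integral>\<^sup>+ y. F y \<partial>sphere_marginal d) = (\<integral>\<^sup>+ x. F (dot d (unit_vec 0) x) \<partial>uniform_sphere d)"
    unfolding sphere_marginal_def using assms(3) by (subst nn_integral_distr) auto
  then show ?thesis
    using nn_integral_sphere_dot[OF m(2), of u F] nn_integral_sphere_dot[OF m(2), of "unit_vec 0" F]
      dot_unit_vec[of d] assms m by simp
qed

lemma nn_integral_marginal_fibre:
  assumes "d > 0" "F \<in> borel_measurable borel"
  shows "(\<integral>\<^sup>+ y. F y \<partial>sphere_marginal (Suc d)) =
    (\<integral>\<^sup>+ h. \<integral>\<^sup>+ x. F (x / sqrt (x\<^sup>2 + dot d h h)) \<partial>std_gauss \<partial>gauss_vec d)"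
  using nn_integral_sphere_marginal[of "Suc d" "unit_vec 0" F]
    nn_integral_sphere_dot[OF assms(1), of "unit_vec 0" F] dot_unit_vec[of "Suc d"] assms by simp

text \<open>For fixed h different from 0, the value t is attained by x / sqrt(x^2 + |h|^2) for at
  most two values of x. In dimension 1, where there is no h, the marginal has atoms at 1 and
  -1.\<close>

lemma marginal_singleton:
  assumes "d \<ge> 2"
  shows "measure (sphere_marginal d) {t} = 0"
proof -
  obtain m where m: "d = Suc m" "m > 0" using assms by (cases d) auto
  have "emeasure (sphere_marginal d) {t} = (\<integral>\<^sup>+ y. indicator {t} y \<partial>sphere_marginal d)"
    by simp
  also have "\<dots> = (\<integral>\<^sup>+ h. \<integral>\<^sup>+ x. indicator {t} (x / sqrt (x\<^sup>2 + dot m h h)) \<partial>std_gauss \<partial>gauss_vec m)"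
    unfolding m(1) by (rule nn_integral_marginal_fibre[OF m(2)]) measurable
  also have "\<dots> = (\<integral>\<^sup>+ h. 0 \<partial>gauss_vec m)"
  proof (rule nn_integral_cong_AE)
    show "AE h in gauss_vec m. (\<integral>\<^sup>+ x. indicator {t} (x / sqrt (x\<^sup>2 + dot m h h)) \<partial>std_gauss) = 0"
      using AE_gauss_vec_nonzero[OF m(2)]
    proof eventually_elim
      case (elim h)
      define e where "e = dot m h h"
      have e: "e > 0" using elim by (simp add: e_def)
      define w where "w = sqrt (t\<^sup>2 * e / (1 - t\<^sup>2))"
      have sol: "x \<in> {w, - w}" if "x / sqrt (x\<^sup>2 + e) = t" for x
      proof -
        have pos: "x\<^sup>2 + e > 0" using e by (simp add: add_nonneg_pos)
        have "t\<^sup>2 = x\<^sup>2 / (x\<^sup>2 + e)" using that pos by (auto simp: power_divide)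
        then have "t\<^sup>2 * (x\<^sup>2 + e) = x\<^sup>2" using pos by (simp add: field_simps)
        then have 1: "t\<^sup>2 * e = x\<^sup>2 * (1 - t\<^sup>2)" by (simp add: algebra_simps)
        have "1 - t\<^sup>2 \<noteq> 0"
        proof
          assume "1 - t\<^sup>2 = 0"
          with 1 e have "t\<^sup>2 = 0" by simp
          with \<open>1 - t\<^sup>2 = 0\<close> show False by simp
        qed
        then have "x\<^sup>2 = t\<^sup>2 * e / (1 - t\<^sup>2)" using 1 by (simp add: field_simps)
        then have "\<bar>x\<bar> = w" by (simp add: w_def flip: real_sqrt_abs)
        then show ?thesis by auto
      qed
      have "(\<integral>\<^sup>+ x. indicator {t} (x / sqrt (x\<^sup>2 + e)) \<partial>std_gauss) \<le>
          (\<integral>\<^sup>+ x. indicator {w} x + indicator {- w} x \<partial>std_gauss)"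
      proof (rule nn_integral_mono)
        fix x
        show "indicator {t} (x / sqrt (x\<^sup>2 + e)) \<le> indicator {w} x + (indicator {- w} x :: ennreal)"
          using sol[of x] by (auto simp: indicator_def)
      qed
      also have "\<dots> = 0"
        by (subst nn_integral_add) (auto simp: emeasure_std_gauss_singleton)
      finally show ?case by (simp add: e_def)
    qed
  qed
  finally show ?thesis by (simp add: marginal.emeasure_eq_measure)
qed

text \<open>For fixed h different from 0 the map x / sqrt(x^2 + |h|^2) is continuous, and r in (-1,
  1) is attained at x = r |h| / sqrt(1 - r^2). The preimage of the interval is thus open and
  nonempty, and Gaussian measure charges such sets.\<close>

lemma marginal_interval_pos:
  assumes "d \<ge> 2" "-1 \<le> s" "s < t" "t \<le> 1"
  shows "measure (sphere_marginal d) {s<..<t} > 0"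
proof (rule ccontr)
  obtain m where m: "d = Suc m" "m > 0" using assms by (cases d) auto
  assume "\<not> ?thesis"
  then have "measure (sphere_marginal d) {s<..<t} = 0" by (simp add: zero_less_measure_iff)
  then have "0 = emeasure (sphere_marginal d) {s<..<t}" by (simp add: marginal.emeasure_eq_measure)
  also have "\<dots> = (\<integral>\<^sup>+ y. indicator {s<..<t} y \<partial>sphere_marginal d)" by simp
  also have "\<dots> = (\<integral>\<^sup>+ h. \<integral>\<^sup>+ x. indicator {s<..<t} (x / sqrt (x\<^sup>2 + dot m h h)) \<partial>std_gauss \<partial>gauss_vec m)"
    unfolding m(1) by (rule nn_integral_marginal_fibre[OF m(2)]) measurable
  finally have "AE h in gauss_vec m. (\<integral>\<^sup>+ x. indicator {s<..<t} (x / sqrt (x\<^sup>2 + dot m h h)) \<partial>std_gauss) = 0"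
    by (subst (asm) eq_commute, subst (asm) nn_integral_0_iff_AE) measurable
  with AE_gauss_vec_nonzero[OF m(2)] have "AE h in gauss_vec m. False"
  proof eventually_elim
    case (elim h)
    define e where "e = dot m h h"
    have e: "e > 0" using elim by (simp add: e_def)
    define S where "S = (\<lambda>x. x / sqrt (x\<^sup>2 + e)) -` {s<..<t}"
    have pos: "x\<^sup>2 + e > 0" for x using e by (simp add: add_nonneg_pos)
    have op: "open S"
      unfolding S_def
    proof (rule open_vimage)
      show "continuous_on UNIV (\<lambda>x. x / sqrt (x\<^sup>2 + e))"
        using pos by (intro continuous_intros) (auto simp: less_imp_neq[symmetric] pos)
    qed auto
    define r where "r = (s + t) / 2"
    have r: "s < r" "r < t" "-1 < r" "r < 1" using assms by (auto simp: r_def)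
    have r2: "1 - r\<^sup>2 > 0" using r by (simp add: abs_square_less_1)
    define x where "x = r * sqrt (e / (1 - r\<^sup>2))"
    have "x\<^sup>2 + e = e / (1 - r\<^sup>2)"
      using r2 e by (simp add: x_def power_mult_distrib field_simps)
    then have "x / sqrt (x\<^sup>2 + e) = r" using r2 e by (simp add: x_def)
    then have "x \<in> S" using r by (simp add: S_def)
    then have "emeasure std_gauss S \<noteq> 0" using op by (intro emeasure_std_gauss_open_pos) auto
    moreover have "(\<integral>\<^sup>+ x. indicator {s<..<t} (x / sqrt (x\<^sup>2 + e)) \<partial>std_gauss) = emeasure std_gauss S"
    proof -
      have "indicator {s<..<t} (x / sqrt (x\<^sup>2 + e)) = (indicator S x :: ennreal)" for x
        by (simp add: S_def indicator_def)
      then show ?thesis using op by simp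
    qed
    ultimately show False using elim(2) by (simp add: e_def)
  qed
  then show False by simp
qed

lemma marginal_support:
  assumes "d \<ge> 2"
  shows "measure (sphere_marginal d) {-1..1} = 1"
proof -
  obtain m where m: "d = Suc m" "m > 0" using assms by (cases d) auto
  have "emeasure (sphere_marginal d) {-1..1} = (\<integral>\<^sup>+ y. indicator {-1..1} y \<partial>sphere_marginal d)" by simp
  also have "\<dots> = (\<integral>\<^sup>+ h. \<integral>\<^sup>+ x. indicator {-1..1} (x / sqrt (x\<^sup>2 + dot m h h)) \<partial>std_gauss \<partial>gauss_vec m)"
    unfolding m(1) by (rule nn_integral_marginal_fibre[OF m(2)]) measurable
  also have "\<dots> = (\<integral>\<^sup>+ h. \<integral>\<^sup>+ x. 1 \<partial>std_gauss \<partial>gauss_vec m)"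
  proof (intro nn_integral_cong)
    fix h x
    have "\<bar>x\<bar> \<le> sqrt (x\<^sup>2 + dot m h h)" using dot_self_nonneg[of m h] by (intro real_le_rsqrt) simp
    then have "\<bar>x / y\<bar> \<le> 1" if "y = sqrt (x\<^sup>2 + dot m h h)" for y
      unfolding abs_divide using that by (cases "y = 0") (auto simp: divide_le_eq_1)
    from this[OF refl] have "-1 \<le> x / sqrt (x\<^sup>2 + dot m h h)" "x / sqrt (x\<^sup>2 + dot m h h) \<le> 1"
      by linarith+
    then show "indicator {-1..1} (x / sqrt (x\<^sup>2 + dot m h h)) = (1::ennreal)"
      by simp
  qed
  also have "\<dots> = 1" using std_gauss.emeasure_space_1 gauss_vec.emeasure_space_1 by simp
  finally show ?thesis by (simp add: marginal.emeasure_eq_measure)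
qed

lemma marginal_tail_cdf:
  assumes "d \<ge> 2"
  shows "measure (sphere_marginal d) {t..} = 1 - cdf (sphere_marginal d) t"
proof -
  have "measure (sphere_marginal d) {t..} = measure (sphere_marginal d) {t<..}"
  proof -
    have "{t..} = {t} \<union> {t<..}" by auto
    moreover have "measure (sphere_marginal d) ({t} \<union> {t<..}) =
        measure (sphere_marginal d) {t} + measure (sphere_marginal d) {t<..}"
      by (rule marginal.finite_measure_Union) auto
    ultimately show ?thesis using marginal_singleton[OF assms, of t] by (simp only: add_0_left)
  qed
  also have "{t<..} = space (sphere_marginal d) - {..t}" by auto
  also have "measure (sphere_marginal d) \<dots> = 1 - measure (sphere_marginal d) {..t}"
    by (rule marginal.prob_compl) simp
  finally show ?thesis by (simp add: cdf_def)
qed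

text \<open>By Fubini one point can be frozen; it is a unit vector only almost surely, hence the
  almost everywhere argument.\<close>

lemma pair_tail_eq_marginal:
  assumes d: "d \<ge> 2"
  shows "\<P>(z in uniform_sphere d \<Otimes>\<^sub>M uniform_sphere d. dot d (fst z) (snd z) \<ge> t) =
    measure (sphere_marginal d) {t..}"
proof -
  interpret P: pair_prob_space "uniform_sphere d" "uniform_sphere d" ..
  have [measurable]: "(\<lambda>z. dot d (fst z) (snd z)) \<in> borel_measurable (uniform_sphere d \<Otimes>\<^sub>M uniform_sphere d)"
    unfolding dot_def by measurable
  have "emeasure (uniform_sphere d \<Otimes>\<^sub>M uniform_sphere d)
      {z \<in> space (uniform_sphere d \<Otimes>\<^sub>M uniform_sphere d). dot d (fst z) (snd z) \<ge> t} =
    (\<integral>\<^sup>+ z. indicator {t..} (dot d (fst z) (snd z)) \<partial>(uniform_sphere d \<Otimes>\<^sub>M uniform_sphere d))"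
  proof -
    have "{z \<in> space (uniform_sphere d \<Otimes>\<^sub>M uniform_sphere d). dot d (fst z) (snd z) \<ge> t}
        \<in> sets (uniform_sphere d \<Otimes>\<^sub>M uniform_sphere d)" by measurable
    then show ?thesis
      by (subst nn_integral_indicator[symmetric], assumption)
        (intro nn_integral_cong, auto split: split_indicator)
  qed
  also have "\<dots> = (\<integral>\<^sup>+ u. \<integral>\<^sup>+ x. indicator {t..} (dot d u x) \<partial>uniform_sphere d \<partial>uniform_sphere d)"
    by (subst sphere.nn_integral_fst[symmetric]) (auto simp: case_prod_beta')
  also have "\<dots> = (\<integral>\<^sup>+ u. emeasure (sphere_marginal d) {t..} \<partial>uniform_sphere d)"
  proof (rule nn_integral_cong_AE)
    have "d > 0" using d by simp
    from AE_sphere_unit[OF this]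
    show "AE u in uniform_sphere d. (\<integral>\<^sup>+ x. indicator {t..} (dot d u x) \<partial>uniform_sphere d) = emeasure (sphere_marginal d) {t..}"
    proof eventually_elim
      case (elim u)
      then show ?case using nn_integral_sphere_marginal[OF d, of u "indicator {t..}"] by simp
    qed
  qed
  also have "\<dots> = emeasure (sphere_marginal d) {t..}" by (simp add: sphere.emeasure_space_1)
  finally show ?thesis by (simp add: P.emeasure_eq_measure marginal.emeasure_eq_measure)
qed

text \<open>The distribution function of the marginal is continuous, runs from 0 to 1 on [-1, 1] and
  is strictly increasing there. Existence and uniqueness of the threshold follow, so that the
  definite description denotes it.\<close>

lemma threshold_spec:
  assumes d: "d \<ge> 2" and p: "0 < p" "p < 1"
  shows "threshold p d \<in> {-1..1}" and "measure (sphere_marginal d) {threshold p d..} = p"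
proof -
  let ?D = "sphere_marginal d"
  have cont: "isCont (cdf ?D) x" for x
    unfolding marginal.isCont_cdf by (rule marginal_singleton[OF d])
  have lo: "cdf ?D (-1) = 0"
  proof -
    have "measure ?D {..-1} = measure ?D {..<-1} + measure ?D {-1}"
      by (subst marginal.finite_measure_Union[symmetric]) (auto intro: arg_cong2[of _ _ _ _ measure])
    also have "measure ?D {..<-1} \<le> measure ?D (space ?D - {-1..1})"
      by (intro marginal.finite_measure_mono) auto
    also have "\<dots> = 0" using marginal.prob_compl[of "{-1..1}" d] marginal_support[OF d] by simp
    finally have "measure ?D {..-1} \<le> 0" using marginal_singleton[OF d] by simp
    then show ?thesis by (simp add: cdf_def measure_le_0_iff)
  qed
  have hi: "cdf ?D 1 = 1"
  proof -
    have "1 \<le> measure ?D {..1}"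
      using marginal.finite_measure_mono[of "{-1..1}" "{..1}" d] marginal_support[OF d] by simp
    then show ?thesis unfolding cdf_def by (intro order_antisym marginal.prob_le_1)
  qed
  have "\<exists>t\<ge>-1. t \<le> 1 \<and> cdf ?D t = 1 - p"
    using lo hi p cont by (intro IVT) auto
  then obtain t where t: "-1 \<le> t" "t \<le> 1" "cdf ?D t = 1 - p" by blast
  have strict: "cdf ?D a < cdf ?D b" if "-1 \<le> a" "a < b" "b \<le> 1" for a b
  proof -
    have "0 < measure ?D {a<..<b}" using that by (intro marginal_interval_pos[OF d])
    also have "\<dots> \<le> measure ?D {a<..b}" by (intro marginal.finite_measure_mono) auto
    also have "\<dots> = cdf ?D b - cdf ?D a" using that by (simp add: marginal.cdf_diff_eq)
    finally show ?thesis by simp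
  qed
  have "threshold p d = t"
    unfolding threshold_def pair_tail_eq_marginal[OF d] marginal_tail_cdf[OF d]
  proof (rule the_equality)
    show "t \<in> {-1..1} \<and> 1 - cdf ?D t = p" using t by simp
    fix r assume r: "r \<in> {-1..1} \<and> 1 - cdf ?D r = p"
    show "r = t"
    proof (rule ccontr)
      assume "r \<noteq> t"
      then consider "r < t" | "t < r" by linarith
      then show False using strict[of r t] strict[of t r] r t by cases auto
    qed
  qed
  then show "threshold p d \<in> {-1..1}" "measure ?D {threshold p d..} = p"
    using t marginal_tail_cdf[OF d] by auto
qed

section \<open>Caps with nearly orthogonal centres\<close>

definition gauss_tail :: "real \<Rightarrow> real" where
  "gauss_tail \<tau> = measure std_gauss {\<tau>..}"

lemma gauss_tail_nonneg: "gauss_tail \<tau> \<ge> 0" and gauss_tail_le_1: "gauss_tail \<tau> \<le> 1"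
  by (simp_all add: gauss_tail_def std_gauss.prob_le_1)

lemma gauss_tail_antimono: "a \<le> b \<Longrightarrow> gauss_tail b \<le> gauss_tail a"
  unfolding gauss_tail_def by (intro std_gauss.finite_measure_mono) auto

lemma ennreal_gauss_tail:
  "ennreal (gauss_tail \<tau>) = (\<integral>\<^sup>+ x. ennreal (std_normal_density x) * indicator {\<tau>..} x \<partial>lborel)"
proof -
  have "ennreal (gauss_tail \<tau>) = (\<integral>\<^sup>+ x. indicator {\<tau>..} x \<partial>std_gauss)"
    by (simp add: gauss_tail_def std_gauss.emeasure_eq_measure)
  then show ?thesis using nn_integral_std_gauss[of "indicator {\<tau>..}"] by simp
qed

lemma ennreal_gauss_tail_shift:
  "ennreal (gauss_tail (\<tau> - k)) = (\<integral>\<^sup>+ x. ennreal (std_normal_density (x - k)) * indicator {\<tau>..} x \<partial>lborel)"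
proof -
  have "ennreal (gauss_tail (\<tau> - k)) =
      ennreal \<bar>1::real\<bar> * (\<integral>\<^sup>+ x. ennreal (std_normal_density (- k + 1 * x)) * indicator {\<tau> - k..} (- k + 1 * x) \<partial>lborel)"
    unfolding ennreal_gauss_tail by (rule nn_integral_real_affine) auto
  then show ?thesis by (simp add: indicator_def)
qed

lemma std_normal_density_shift:
  "std_normal_density (x - k) = std_normal_density x * exp (k * x - k\<^sup>2 / 2)"
proof -
  have "- (x - k)\<^sup>2 / 2 = - x\<^sup>2 / 2 + (k * x - k\<^sup>2 / 2)"
    by (simp add: power2_eq_square field_simps)
  then have "exp (- (x - k)\<^sup>2 / 2) = exp (- x\<^sup>2 / 2) * exp (k * x - k\<^sup>2 / 2)"
    by (simp only: exp_add)
  then show ?thesis by (simp add: std_normal_density_def)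
qed

text \<open>Change of measure: the density of a Gaussian with mean k relative to the centred one is
  exp(k x - k^2 / 2), at most exp(k r) for x \<le> r, and the part beyond r is kept as the last
  term. This makes the effect of a shift multiplicative, hence useful even when the tail is as small
  as p.\<close>

lemma gauss_tail_shift:
  assumes "k \<ge> 0"
  shows "gauss_tail (\<tau> - k) \<le> exp (k * r) * gauss_tail \<tau> + gauss_tail (r - k)"
proof -
  have "ennreal (gauss_tail (\<tau> - k)) \<le>
      (\<integral>\<^sup>+ x. ennreal (exp (k * r)) * (ennreal (std_normal_density x) * indicator {\<tau>..} x) +
        ennreal (std_normal_density (x - k)) * indicator {r..} x \<partial>lborel)"
    unfolding ennreal_gauss_tail_shift
  proof (rule nn_integral_mono)
    fix x :: real
    show "ennreal (std_normal_density (x - k)) * indicator {\<tau>..} x \<le>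
      ennreal (exp (k * r)) * (ennreal (std_normal_density x) * indicator {\<tau>..} x) +
        ennreal (std_normal_density (x - k)) * indicator {r..} x"
    proof (cases "x \<ge> r")
      case True
      then show ?thesis by (auto simp: indicator_def)
    next
      case False
      have "k * x - k\<^sup>2 / 2 \<le> k * r"
        using False assms mult_left_mono[of x r k] zero_le_power2[of k] by linarith
      then have "std_normal_density (x - k) \<le> exp (k * r) * std_normal_density x"
        unfolding std_normal_density_shift by (simp add: mult.commute mult_left_mono)
      then have "ennreal (std_normal_density (x - k)) \<le> ennreal (exp (k * r)) * ennreal (std_normal_density x)"
        by (subst ennreal_mult[symmetric]) (auto intro: ennreal_leI)
      then show ?thesis using False by (auto simp: indicator_def)
    qed
  qed
  also have "\<dots> = ennreal (exp (k * r)) * ennreal (gauss_tail \<tau>) + ennreal (gauss_tail (r - k))"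
    unfolding ennreal_gauss_tail_shift unfolding ennreal_gauss_tail
    by (subst nn_integral_add) (auto simp: nn_integral_cmult)
  also have "\<dots> = ennreal (exp (k * r) * gauss_tail \<tau> + gauss_tail (r - k))"
    by (simp add: ennreal_mult gauss_tail_nonneg)
  finally show ?thesis
    by (subst (asm) ennreal_le_iff) (auto intro!: add_nonneg_nonneg mult_nonneg_nonneg gauss_tail_nonneg)
qed

text \<open>The same change of measure with mean -r: on x \<ge> 0 the density ratio is at most
  exp(-r^2 / 2).\<close>

lemma gauss_tail_le:
  assumes "r \<ge> 0"
  shows "gauss_tail r \<le> exp (- r\<^sup>2 / 2)"
proof -
  have "ennreal (gauss_tail r) = ennreal (gauss_tail (0 - - r))" by simp
  also have "\<dots> \<le> (\<integral>\<^sup>+ x. ennreal (exp (- r\<^sup>2 / 2)) * (ennreal (std_normal_density x) * indicator {0..} x) \<partial>lborel)"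
    unfolding ennreal_gauss_tail_shift
  proof (rule nn_integral_mono)
    fix x :: real
    show "ennreal (std_normal_density (x - - r)) * indicator {0..} x \<le>
        ennreal (exp (- r\<^sup>2 / 2)) * (ennreal (std_normal_density x) * indicator {0..} x)"
    proof (cases "x \<ge> 0")
      case True
      then have "- r * x - (- r)\<^sup>2 / 2 \<le> - r\<^sup>2 / 2" using assms by simp
      then have "std_normal_density (x - - r) \<le> exp (- r\<^sup>2 / 2) * std_normal_density x"
        unfolding std_normal_density_shift by (simp add: mult.commute mult_left_mono)
      then have "ennreal (std_normal_density (x - - r)) \<le> ennreal (exp (- r\<^sup>2 / 2)) * ennreal (std_normal_density x)"
        by (subst ennreal_mult[symmetric]) (auto intro: ennreal_leI)
      then show ?thesis using True by simp
    qed simp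
  qed
  also have "\<dots> = ennreal (exp (- r\<^sup>2 / 2)) * ennreal (gauss_tail 0)"
    unfolding ennreal_gauss_tail by (rule nn_integral_cmult) simp
  also have "\<dots> \<le> ennreal (exp (- r\<^sup>2 / 2)) * 1"
    using gauss_tail_le_1[of 0] by (intro mult_left_mono) auto
  finally show ?thesis by simp
qed

lemma std_gauss_uminus: "measure std_gauss {..- \<tau>} = gauss_tail \<tau>"
proof -
  have "emeasure std_gauss {..- \<tau>} = (\<integral>\<^sup>+ x. ennreal (std_normal_density x) * indicator {..- \<tau>} x \<partial>lborel)"
    using nn_integral_std_gauss[of "indicator {..- \<tau>}"] by simp
  also have "\<dots> = ennreal \<bar>-1::real\<bar> * (\<integral>\<^sup>+ x. ennreal (std_normal_density (0 + -1 * x)) * indicator {..- \<tau>} (0 + -1 * x) \<partial>lborel)"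
    by (rule nn_integral_real_affine) auto
  also have "\<dots> = ennreal (gauss_tail \<tau>)"
    unfolding ennreal_gauss_tail by (auto simp: indicator_def normal_density_def intro!: nn_integral_cong)
  finally show ?thesis by (simp add: std_gauss.emeasure_eq_measure gauss_tail_nonneg)
qed

lemma std_gauss_abs_gt: "measure std_gauss {x. \<bar>x\<bar> > r} \<le> 2 * gauss_tail r"
proof -
  have "measure std_gauss {x. \<bar>x\<bar> > r} \<le> measure std_gauss ({r..} \<union> {..- r})"
    by (intro std_gauss.finite_measure_mono) auto
  also have "\<dots> \<le> measure std_gauss {r..} + measure std_gauss {..- r}"
    by (intro measure_Un_le) auto
  finally show ?thesis by (simp add: std_gauss_uminus gauss_tail_def[symmetric])
qed

section \<open>Concentration of the norm of a Gaussian vector\<close>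

lemma std_gauss_exp_square:
  assumes "l < 1 / 2"
  shows "(\<integral>\<^sup>+ x. ennreal (exp (l * x\<^sup>2)) \<partial>std_gauss) = ennreal (1 / sqrt (1 - 2 * l))"
proof -
  define b where "b = sqrt (1 - 2 * l)"
  have b: "b > 0" "b\<^sup>2 = 1 - 2 * l" using assms by (simp_all add: b_def)
  have "1 = (\<integral>\<^sup>+ x. ennreal (std_normal_density x) \<partial>lborel)"
    using nn_integral_std_gauss[of "\<lambda>_. 1"] std_gauss.emeasure_space_1 by simp
  also have "\<dots> = \<bar>b\<bar> * (\<integral>\<^sup>+ x. ennreal (std_normal_density (0 + b * x)) \<partial>lborel)"
    using b by (intro nn_integral_real_affine) auto
  also have "(\<integral>\<^sup>+ x. ennreal (std_normal_density (0 + b * x)) \<partial>lborel) = (\<integral>\<^sup>+ x. ennreal (exp (l * x\<^sup>2)) \<partial>std_gauss)"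
  proof -
    have "std_normal_density (0 + b * x) = std_normal_density x * exp (l * x\<^sup>2)" for x
    proof -
      have "- (b * x)\<^sup>2 / 2 = - x\<^sup>2 / 2 + l * x\<^sup>2"
        unfolding power_mult_distrib b(2) by (simp add: field_simps)
      then have "exp (- (b * x)\<^sup>2 / 2) = exp (- x\<^sup>2 / 2) * exp (l * x\<^sup>2)" by (simp only: exp_add)
      then show ?thesis by (simp add: std_normal_density_def)
    qed
    then show ?thesis by (subst nn_integral_std_gauss) (auto simp: ennreal_mult)
  qed
  finally have "ennreal (1 / b) * 1 = ennreal (1 / b) * (ennreal b * (\<integral>\<^sup>+ x. ennreal (exp (l * x\<^sup>2)) \<partial>std_gauss))"
    using b by simp
  also have "\<dots> = ennreal (1 / b * b) * (\<integral>\<^sup>+ x. ennreal (exp (l * x\<^sup>2)) \<partial>std_gauss)"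
  proof -
    have "ennreal (1 / b * b) = ennreal (1 / b) * ennreal b" using b by (intro ennreal_mult) auto
    then show ?thesis by (simp only: mult.assoc)
  qed
  finally show ?thesis using b by (simp add: b_def)
qed

lemma exp_square_moment_le:
  fixes l :: real
  assumes "\<bar>l\<bar> \<le> 1 / 4"
  shows "1 / sqrt (1 - 2 * l) \<le> exp (l + 4 * l\<^sup>2)"
proof -
  have ln: "- (2 * l) - 8 * l\<^sup>2 \<le> ln (1 - 2 * l)"
  proof (cases "l \<ge> 0")
    case True
    then have "- (2 * l) - 2 * (2 * l)\<^sup>2 \<le> ln (1 - 2 * l)"
      using assms by (intro ln_one_minus_pos_lower_bound) auto
    then show ?thesis using zero_le_square[of l] by (simp add: power2_eq_square)
  next
    case False
    then have "(- 2 * l) - (- 2 * l)\<^sup>2 \<le> ln (1 + (- 2 * l))"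
      using assms by (intro ln_one_plus_pos_lower_bound) auto
    then have "- (2 * l) - 4 * (l * l) \<le> ln (1 - 2 * l)" by (simp add: power2_eq_square)
    moreover have "0 \<le> l * l" by simp
    ultimately show ?thesis unfolding power2_eq_square by linarith
  qed
  have pos: "1 - 2 * l > 0" using assms by linarith
  have "1 / sqrt (1 - 2 * l) = exp (- (ln (1 - 2 * l) / 2))"
    using pos by (simp add: exp_minus ln_sqrt[symmetric] inverse_eq_divide)
  also have "\<dots> \<le> exp (l + 4 * l\<^sup>2)" using ln by simp
  finally show ?thesis .
qed

lemma gauss_vec_exp_norm:
  assumes "\<bar>l\<bar> \<le> 1 / 4"
  shows "(\<integral>\<^sup>+ g. ennreal (exp (l * dot d g g)) \<partial>gauss_vec d) \<le> ennreal (exp (d * (l + 4 * l\<^sup>2)))"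
proof (induction d)
  case 0
  then show ?case by (simp add: dot_def gauss_vec.emeasure_space_1)
next
  case (Suc d)
  have "(\<integral>\<^sup>+ g. ennreal (exp (l * dot (Suc d) g g)) \<partial>gauss_vec (Suc d)) =
      (\<integral>\<^sup>+ g. \<integral>\<^sup>+ z. ennreal (exp (l * (dot d g g + z\<^sup>2))) \<partial>std_gauss \<partial>gauss_vec d)"
    by (subst nn_integral_gauss_Suc, measurable) (simp only: dot_self_Suc_upd)
  also have "\<dots> = (\<integral>\<^sup>+ g. ennreal (exp (l * dot d g g)) * ennreal (1 / sqrt (1 - 2 * l)) \<partial>gauss_vec d)"
  proof (rule nn_integral_cong)
    fix g :: "nat \<Rightarrow> real"
    have "(\<integral>\<^sup>+ z. ennreal (exp (l * (dot d g g + z\<^sup>2))) \<partial>std_gauss) =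
        (\<integral>\<^sup>+ z. ennreal (exp (l * dot d g g)) * ennreal (exp (l * z\<^sup>2)) \<partial>std_gauss)"
      by (simp add: distrib_left exp_add ennreal_mult)
    also have "\<dots> = ennreal (exp (l * dot d g g)) * ennreal (1 / sqrt (1 - 2 * l))"
      using assms by (subst nn_integral_cmult) (auto simp: std_gauss_exp_square)
    finally show "(\<integral>\<^sup>+ z. ennreal (exp (l * (dot d g g + z\<^sup>2))) \<partial>std_gauss) =
      ennreal (exp (l * dot d g g)) * ennreal (1 / sqrt (1 - 2 * l))" .
  qed
  also have "\<dots> = (\<integral>\<^sup>+ g. ennreal (exp (l * dot d g g)) \<partial>gauss_vec d) * ennreal (1 / sqrt (1 - 2 * l))"
    by (rule nn_integral_multc) measurable
  also have "\<dots> \<le> ennreal (exp (d * (l + 4 * l\<^sup>2))) * ennreal (exp (l + 4 * l\<^sup>2))"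
    by (intro mult_mono Suc.IH ennreal_leI exp_square_moment_le assms) auto
  also have "\<dots> = ennreal (exp (Suc d * (l + 4 * l\<^sup>2)))"
    by (simp add: ennreal_mult[symmetric] exp_add[symmetric] distrib_right)
  finally show ?case .
qed

text \<open>Chernoff bounds with l = \<eta> / 8 and l = - \<eta> / 8. The exponent is d (4 l^2 - |l|
  \<eta>) = - d \<eta>^2 / 16, and \<eta> \<le> 1 keeps |l| in the range of the moment
  bound.\<close>

lemma gauss_vec_norm_concentration:
  assumes \<eta>: "0 \<le> \<eta>" "\<eta> \<le> 1"
  shows "measure (gauss_vec d) {g \<in> space (gauss_vec d). \<bar>dot d g g - d\<bar> > d * \<eta>} \<le> 2 * exp (- (d * \<eta>\<^sup>2 / 16))"
proof -
  have chern: "measure (gauss_vec d) {g \<in> space (gauss_vec d). l * (dot d g g - d) \<ge> \<bar>l\<bar> * (d * \<eta>)} \<le> exp (- (d * \<eta>\<^sup>2 / 16))"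
    if l: "\<bar>l\<bar> = \<eta> / 8" for l
  proof -
    have l2: "l\<^sup>2 = (\<eta> / 8)\<^sup>2" using l by (metis power2_abs)
    have "measure (gauss_vec d) {g \<in> space (gauss_vec d). l * d + \<bar>l\<bar> * (d * \<eta>) \<le> l * dot d g g} \<le>
        exp (d * (l + 4 * l\<^sup>2) - (l * d + \<bar>l\<bar> * (d * \<eta>)))"
      using l \<eta> by (intro gauss_vec.exponential_Markov gauss_vec_exp_norm) auto
    also have "d * (l + 4 * l\<^sup>2) - (l * d + \<bar>l\<bar> * (d * \<eta>)) = - (d * \<eta>\<^sup>2 / 16)"
      unfolding l2 l by (simp add: power2_eq_square algebra_simps)
    also have "{g \<in> space (gauss_vec d). l * d + \<bar>l\<bar> * (d * \<eta>) \<le> l * dot d g g} =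
        {g \<in> space (gauss_vec d). l * (dot d g g - d) \<ge> \<bar>l\<bar> * (d * \<eta>)}"
      by (auto simp: right_diff_distrib)
    finally show ?thesis .
  qed
  let ?A = "\<lambda>l. {g \<in> space (gauss_vec d). l * (dot d g g - d) \<ge> \<bar>l\<bar> * (d * \<eta>)}"
  show ?thesis
  proof (cases "\<eta> = 0")
    case True
    then show ?thesis using gauss_vec.prob_le_1 by (simp add: order_trans[OF gauss_vec.prob_le_1])
  next
    case False
    then have pos: "\<eta> > 0" using \<eta> by simp
    have "{g \<in> space (gauss_vec d). \<bar>dot d g g - d\<bar> > d * \<eta>} \<subseteq> ?A (\<eta> / 8) \<union> ?A (- (\<eta> / 8))"
    proof
      fix g assume g: "g \<in> {g \<in> space (gauss_vec d). \<bar>dot d g g - d\<bar> > d * \<eta>}"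
      then consider "dot d g g - d \<ge> d * \<eta>" | "- (dot d g g - d) \<ge> d * \<eta>" by (auto simp: abs_if split: if_splits)
      then show "g \<in> ?A (\<eta> / 8) \<union> ?A (- (\<eta> / 8))"
      proof cases
        case 1
        then have "\<eta> / 8 * (d * \<eta>) \<le> \<eta> / 8 * (dot d g g - d)" using pos by (intro mult_left_mono) auto
        then show ?thesis using g pos by auto
      next
        case 2
        then have "\<eta> / 8 * (d * \<eta>) \<le> \<eta> / 8 * (- (dot d g g - d))" using pos by (intro mult_left_mono) auto
        moreover have "\<bar>- (\<eta> / 8)\<bar> = \<eta> / 8" using pos by simp
        moreover have "- (\<eta> / 8) * (dot d g g - d) = \<eta> / 8 * (- (dot d g g - d))" by (simp add: right_diff_distrib)
        ultimately have "- (\<eta> / 8) * (dot d g g - d) \<ge> \<bar>- (\<eta> / 8)\<bar> * (d * \<eta>)" by (simp only:)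
        then show ?thesis using g by blast
      qed
    qed
    then have "measure (gauss_vec d) {g \<in> space (gauss_vec d). \<bar>dot d g g - d\<bar> > d * \<eta>} \<le>
        measure (gauss_vec d) (?A (\<eta> / 8) \<union> ?A (- (\<eta> / 8)))"
      by (intro gauss_vec.finite_measure_mono) measurable
    also have "\<dots> \<le> measure (gauss_vec d) (?A (\<eta> / 8)) + measure (gauss_vec d) (?A (- (\<eta> / 8)))"
      by (intro measure_Un_le) measurable
    also have "\<dots> \<le> exp (- (d * \<eta>\<^sup>2 / 16)) + exp (- (d * \<eta>\<^sup>2 / 16))"
      using pos by (intro add_mono chern) auto
    finally show ?thesis by simp
  qed
qed

section \<open>Reduction of sphere events to one or two Gaussian coordinates\<close>

abbreviation std_gauss2 :: "(real \<times> real) measure" where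
  "std_gauss2 \<equiv> std_gauss \<Otimes>\<^sub>M std_gauss"

interpretation std_gauss2: pair_prob_space std_gauss std_gauss ..

lemma measure_std_gauss2_Times:
  assumes "A \<in> sets borel" "B \<in> sets borel"
  shows "measure std_gauss2 (A \<times> B) = measure std_gauss A * measure std_gauss B"
proof -
  have "emeasure std_gauss2 (A \<times> B) = emeasure std_gauss A * emeasure std_gauss B"
    using assms by (intro std_gauss.emeasure_pair_measure_Times) auto
  then show ?thesis by (simp add: measure_def enn2real_mult)
qed

lemma sets_std_gauss2 [measurable_cong]: "sets std_gauss2 = sets (borel \<Otimes>\<^sub>M borel)"
  by (intro sets_pair_measure_cong) auto

lemma measure_sphere_dots:
  assumes S [measurable]: "S \<in> sets (borel \<Otimes>\<^sub>M borel)"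
  shows "measure (uniform_sphere d) {x \<in> space (uniform_sphere d). (dot d u x, dot d u' x) \<in> S} =
    measure (gauss_vec d) {g \<in> space (gauss_vec d). (dot d u g / sqrt (dot d g g), dot d u' g / sqrt (dot d g g)) \<in> S}"
    (is "measure _ ?A = measure _ ?B")
proof -
  have A: "?A \<in> sets (uniform_sphere d)" and B: "?B \<in> sets (gauss_vec d)" by measurable
  have "emeasure (uniform_sphere d) ?A = (\<integral>\<^sup>+ x. indicator S (dot d u x, dot d u' x) \<partial>uniform_sphere d)"
    using A by (subst nn_integral_indicator[symmetric], assumption) (intro nn_integral_cong, auto split: split_indicator)
  also have "\<dots> = (\<integral>\<^sup>+ g. indicator S (dot d u g / sqrt (dot d g g), dot d u' g / sqrt (dot d g g)) \<partial>gauss_vec d)"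
    by (rule nn_integral_sphere_dots[of "\<lambda>a b. indicator S (a, b)"]) measurable
  also have "\<dots> = emeasure (gauss_vec d) ?B"
    using B by (subst nn_integral_indicator[symmetric], assumption) (intro nn_integral_cong, auto split: split_indicator)
  finally show ?thesis by (simp add: measure_def)
qed

lemma pair_measure_law:
  assumes u: "dot d u u = 1"
  obtains c where "c \<ge> 0" "(dot d u u')\<^sup>2 + c\<^sup>2 = dot d u' u'"
    "\<And>S. S \<in> sets (borel \<Otimes>\<^sub>M borel) \<Longrightarrow>
      measure (gauss_vec d) {g \<in> space (gauss_vec d). (dot d u g, dot d u' g) \<in> S} =
      measure std_gauss2 {z \<in> space std_gauss2. (fst z, dot d u u' * fst z + c * snd z) \<in> S}"
proof -
  obtain \<alpha> \<beta> c where abc: "\<alpha> \<ge> 0" "c \<ge> 0" "\<alpha>\<^sup>2 = dot d u u" "\<alpha> * \<beta> = dot d u u'" "\<beta>\<^sup>2 + c\<^sup>2 = dot d u' u'"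
    and law: "\<And>F. case_prod F \<in> borel_measurable (borel \<Otimes>\<^sub>M borel) \<Longrightarrow>
      (\<integral>\<^sup>+ g. F (dot d u g) (dot d u' g) \<partial>gauss_vec d) =
      (\<integral>\<^sup>+ x. \<integral>\<^sup>+ y. F (\<alpha> * x) (\<beta> * x + c * y) \<partial>std_gauss \<partial>std_gauss)"
    by (rule pair_law[of d u u']) blast
  have a: "\<alpha> = 1" using abc(1,3) u by (simp add: power2_eq_1_iff)
  then have b: "\<beta> = dot d u u'" using abc by simp
  show ?thesis
  proof
    show "c \<ge> 0" "(dot d u u')\<^sup>2 + c\<^sup>2 = dot d u' u'" using abc b by auto
    fix S :: "(real \<times> real) set" assume S [measurable]: "S \<in> sets (borel \<Otimes>\<^sub>M borel)"
    let ?A = "{g \<in> space (gauss_vec d). (dot d u g, dot d u' g) \<in> S}"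
    let ?B = "{z \<in> space std_gauss2. (fst z, dot d u u' * fst z + c * snd z) \<in> S}"
    have A: "?A \<in> sets (gauss_vec d)" and B: "?B \<in> sets std_gauss2" by measurable
    have "emeasure (gauss_vec d) ?A = (\<integral>\<^sup>+ g. indicator S (dot d u g, dot d u' g) \<partial>gauss_vec d)"
      using A by (subst nn_integral_indicator[symmetric], assumption) (intro nn_integral_cong, auto split: split_indicator)
    also have "\<dots> = (\<integral>\<^sup>+ x. \<integral>\<^sup>+ y. indicator S (x, dot d u u' * x + c * y) \<partial>std_gauss \<partial>std_gauss)"
      using law[of "\<lambda>a b. indicator S (a, b)"] by (simp add: a b)
    also have "\<dots> = (\<integral>\<^sup>+ z. indicator S (fst z, dot d u u' * fst z + c * snd z) \<partial>std_gauss2)"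
    proof -
      have m: "(\<lambda>z. indicator S (fst z, dot d u u' * fst z + c * snd z) :: ennreal) \<in> borel_measurable std_gauss2"
        by (rule measurable_compose[OF _ borel_measurable_indicator[OF S]]) measurable
      show ?thesis using std_gauss.nn_integral_fst[OF m] by simp
    qed
    also have "\<dots> = emeasure std_gauss2 ?B"
      using B by (subst nn_integral_indicator[symmetric], assumption) (intro nn_integral_cong, auto split: split_indicator)
    finally show "measure (gauss_vec d) ?A = measure std_gauss2 ?B" by (simp add: measure_def)
  qed
qed

lemma gauss_projection_law:
  assumes u: "dot d u u = 1" and A [measurable]: "A \<in> sets borel"
  shows "measure (gauss_vec d) {g \<in> space (gauss_vec d). dot d u g \<in> A} = measure std_gauss A"
proof -
  obtain c where law: "\<And>S. S \<in> sets (borel \<Otimes>\<^sub>M borel) \<Longrightarrow>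
      measure (gauss_vec d) {g \<in> space (gauss_vec d). (dot d u g, dot d u g) \<in> S} =
      measure std_gauss2 {z \<in> space std_gauss2. (fst z, dot d u u * fst z + c * snd z) \<in> S}"
    by (rule pair_measure_law[OF u, of u]) blast
  have "measure (gauss_vec d) {g \<in> space (gauss_vec d). dot d u g \<in> A} =
      measure std_gauss2 {z \<in> space std_gauss2. (fst z, dot d u u * fst z + c * snd z) \<in> A \<times> UNIV}"
    using law[of "A \<times> UNIV"] by simp
  also have "{z \<in> space std_gauss2. (fst z, dot d u u * fst z + c * snd z) \<in> A \<times> UNIV} = A \<times> UNIV"
    by (auto simp: space_pair_measure)
  also have "measure std_gauss2 (A \<times> UNIV) = measure std_gauss A"
    using std_gauss.prob_space by (simp add: measure_std_gauss2_Times)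
  finally show ?thesis .
qed

section \<open>The probability that a point lies in two nearly orthogonal caps\<close>

lemma sqrt_close:
  fixes y d \<eta> :: real
  assumes "d > 0" "\<bar>y - d\<bar> \<le> d * \<eta>" "y \<ge> 0"
  shows "\<bar>sqrt y - sqrt d\<bar> \<le> sqrt d * \<eta>"
proof -
  have "\<bar>sqrt y - sqrt d\<bar> * sqrt d \<le> \<bar>sqrt y - sqrt d\<bar> * (sqrt y + sqrt d)"
    using assms by (intro mult_left_mono) auto
  also have "\<dots> = \<bar>(sqrt y - sqrt d) * (sqrt y + sqrt d)\<bar>" using assms by (simp add: abs_mult)
  also have "(sqrt y - sqrt d) * (sqrt y + sqrt d) = y - d"
    using assms by (simp add: algebra_simps)
  also have "\<bar>y - d\<bar> \<le> (sqrt d * \<eta>) * sqrt d" using assms by (simp add: mult_ac)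
  finally show ?thesis using assms by (simp add: mult.commute)
qed

text \<open>B and A stand for the Gaussian tails slightly above and slightly below the threshold. p
  lies between them and G between their squares, up to e, while A and B differ by a factor 1 +
  \<delta>. The errors add up to 10 \<delta> p^2 above and 7 \<delta> p^2 below, within the rounded
  16.\<close>

lemma second_moment_algebra:
  fixes p G A B e \<delta> :: real
  assumes d: "0 \<le> \<delta>" "\<delta> \<le> 1 / 16" and p: "0 \<le> p" "p \<le> 1" and B: "0 \<le> B" and A: "0 \<le> A"
    and e: "0 \<le> e" "e \<le> \<delta> * p\<^sup>2"
    and pB: "B - e \<le> p" and pA: "p \<le> A + e" and GB: "B\<^sup>2 - e \<le> G" and GA: "G \<le> A\<^sup>2 + e"
    and AB: "A \<le> (1 + \<delta>) * B + e"
  shows "\<bar>G - p\<^sup>2\<bar> \<le> 16 * \<delta> * p\<^sup>2"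
proof -
  have "\<delta> * p\<^sup>2 \<le> \<delta> * p" using p d by (intro mult_left_mono) (auto simp: power2_eq_square mult_left_le)
  then have ep: "e \<le> \<delta> * p" using e by simp
  have dd: "\<delta> * \<delta> \<le> \<delta> / 16" using d mult_left_mono[of \<delta> "1/16" \<delta>] by simp
  have "A \<le> (1 + \<delta>) * (p + \<delta> * p) + \<delta> * p"
    using AB pB ep d mult_left_mono[of B "p + \<delta> * p" "1 + \<delta>"] by linarith
  also have "\<dots> = p * (1 + 3 * \<delta> + \<delta> * \<delta>)" by (simp add: algebra_simps)
  also have "\<dots> \<le> p * (1 + 4 * \<delta>)" using p dd d by (intro mult_left_mono) auto
  finally have "A\<^sup>2 \<le> (p * (1 + 4 * \<delta>))\<^sup>2" using A by (intro power_mono) auto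
  also have "\<dots> = p\<^sup>2 * (1 + 8 * \<delta> + 16 * (\<delta> * \<delta>))" by (simp add: power2_eq_square algebra_simps)
  also have "\<dots> \<le> p\<^sup>2 * (1 + 9 * \<delta>)" using dd by (intro mult_left_mono) auto
  finally have up: "G \<le> p\<^sup>2 * (1 + 9 * \<delta>) + \<delta> * p\<^sup>2" using GA e by linarith
  have "p * (1 - 3 * \<delta>) * (1 + \<delta>) = p * (1 - 2 * \<delta> - 3 * (\<delta> * \<delta>))" by (simp add: algebra_simps)
  also have "\<dots> \<le> p * (1 - 2 * \<delta>)" using p by (intro mult_left_mono) auto
  also have "\<dots> = p - 2 * (\<delta> * p)" by (simp add: algebra_simps)
  also have "\<dots> \<le> B * (1 + \<delta>)" using AB pA ep by (simp add: mult.commute)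
  finally have "p * (1 - 3 * \<delta>) \<le> B" using d by simp
  moreover have "0 \<le> p * (1 - 3 * \<delta>)" using p d by simp
  ultimately have "(p * (1 - 3 * \<delta>))\<^sup>2 \<le> B\<^sup>2" by (intro power_mono)
  moreover have "(p * (1 - 3 * \<delta>))\<^sup>2 = p\<^sup>2 * (1 - 6 * \<delta>) + 9 * (\<delta> * \<delta> * p\<^sup>2)" by (simp add: power2_eq_square algebra_simps)
  moreover have "0 \<le> \<delta> * \<delta> * p\<^sup>2" using d by simp
  ultimately have lo: "p\<^sup>2 * (1 - 6 * \<delta>) - \<delta> * p\<^sup>2 \<le> G" using GB e by linarith
  have "0 \<le> \<delta> * p\<^sup>2" using d by simp
  then show ?thesis using up lo by (simp add: algebra_simps abs_le_iff)
qed

text \<open>\<delta> is the relative accuracy wanted for pair probabilities. The condition on 8 /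
  n^6 absorbs errors of order n^-8 into \<delta> p^2, as p \<ge> 1 / n. The condition on d makes the
  uncertainty of the threshold so small that it changes the Gaussian tail by a factor of at most 1 +
  \<delta>, up to such errors.\<close>

locale cap_regime =
  fixes n d :: nat and p \<delta> :: real
  assumes n: "n \<ge> 3" and d: "d \<ge> 2" and p: "1 / n \<le> p" "p < 1 / 2"
    and \<delta>: "0 < \<delta>" "\<delta> \<le> 1 / 16" "8 / real n ^ 6 \<le> \<delta>"
    and dim: "12800 * (ln n * sqrt (ln n)) \<le> \<delta> * sqrt d"
begin

text \<open>
  \<open>r\<close> bounds the relevant Gaussian coordinates, \<open>\<eta>\<close> both the relative fluctuation of the squared norm
  of a Gaussian vector and the inner products of distinct points, \<open>T\<close> is the threshold in Gaussian
  units, and \<open>\<kappa>\<close> the resulting uncertainty of \<open>T\<close>; all up to events of probability \<open>O(n^-8)\<close>.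
\<close>

definition "L = ln (real n)"
definition "r = 8 * sqrt L"
definition "\<eta> = 12 * sqrt L / sqrt d"
definition "\<kappa> = 200 * L / sqrt d"
definition "t = threshold p d"
definition "T = t * sqrt d"

lemma L_ge_1: "L \<ge> 1"
proof -
  have "exp 1 \<le> real n" using exp_le n by linarith
  then show ?thesis unfolding L_def using n by (subst ln_ge_iff) auto
qed

lemma sqrt_L: "1 \<le> sqrt L" "sqrt L * sqrt L = L" "sqrt L \<le> L"
proof -
  show 1: "1 \<le> sqrt L" using L_ge_1 by simp
  show 2: "sqrt L * sqrt L = L" using L_ge_1 by simp
  show "sqrt L \<le> L" using 1 2 mult_left_mono[of 1 "sqrt L" "sqrt L"] by simp
qed

lemma sqrt_d_pos: "sqrt d > 0" using d by simp

lemma main_small: "12800 * L * sqrt L / sqrt d \<le> \<delta>"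
  using dim sqrt_d_pos by (simp add: L_def field_simps)

lemma eta_bounds: "0 \<le> \<eta>" "\<eta> \<le> 1 / 2"
proof -
  show "0 \<le> \<eta>" using L_ge_1 by (simp add: \<eta>_def)
  have "\<eta> \<le> 12800 * L * sqrt L / sqrt d"
    unfolding \<eta>_def using sqrt_L L_ge_1 sqrt_d_pos mult_right_mono[of 1 "L" "sqrt L"]
    by (intro divide_right_mono) auto
  then show "\<eta> \<le> 1 / 2" using main_small \<delta> by linarith
qed

text \<open>Two uncertainties must be covered: r \<eta> = 96 L / sqrt d from the fluctuating norm
  and 2 \<eta> r = 192 L / sqrt d from the correlation of two coordinates; hence the 200. The tails
  compared are 4 \<kappa> apart, and 4 \<kappa> r = 6400 L sqrt L / sqrt d \<le> \<delta> / 2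
  explains the 12800 of the locale.\<close>

lemma kappa_bounds: "0 \<le> \<kappa>" "r * \<eta> \<le> \<kappa>" "2 * \<eta> * r \<le> \<kappa>" "4 * \<kappa> \<le> r / 2" "exp (4 * \<kappa> * r) \<le> 1 + \<delta>"
proof -
  show "0 \<le> \<kappa>" using L_ge_1 by (simp add: \<kappa>_def)
  have "r * \<eta> = 96 * (sqrt L * sqrt L) / sqrt d" by (simp add: r_def \<eta>_def)
  also have "\<dots> = 96 * L / sqrt d" by (simp only: sqrt_L)
  finally have re: "r * \<eta> = 96 * L / sqrt d" .
  have "96 * L / sqrt d \<le> 200 * L / sqrt d" "192 * L / sqrt d \<le> 200 * L / sqrt d"
    using L_ge_1 by (intro divide_right_mono; simp)+
  moreover have "2 * \<eta> * r = 192 * L / sqrt d"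
  proof -
    have "2 * \<eta> * r = 2 * (r * \<eta>)" by simp
    then show ?thesis unfolding re by simp
  qed
  ultimately show "r * \<eta> \<le> \<kappa>" "2 * \<eta> * r \<le> \<kappa>" unfolding \<kappa>_def re by linarith+
  have kr: "4 * \<kappa> * r = 6400 * L * sqrt L / sqrt d" by (simp add: \<kappa>_def r_def)
  then have kr1: "4 * \<kappa> * r \<le> \<delta> / 2" using main_small by simp
  have r8: "r \<ge> 8" unfolding r_def using sqrt_L(1) by linarith
  have "4 * \<kappa> * 1 \<le> 4 * \<kappa> * r" using r8 \<open>0 \<le> \<kappa>\<close> by (intro mult_left_mono) auto
  then show "4 * \<kappa> \<le> r / 2" using kr1 \<delta> r8 by linarith
  have "exp (4 * \<kappa> * r) \<le> exp (\<delta> / 2)" using kr1 by simp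
  also have "\<dots> \<le> 1 + \<delta>"
    using exp_bound_half[of "\<delta> / 2"] \<delta> real_exp_bound_lemma[of "\<delta> / 2"] by simp
  finally show "exp (4 * \<kappa> * r) \<le> 1 + \<delta>" .
qed

lemma exp_L: "exp (- (k * L)) = 1 / real n ^ k" for k :: nat
  using n by (simp add: L_def exp_minus exp_of_nat_mult inverse_eq_divide)

text \<open>(r / 2)^2 / 2 = 8 L. The half leaves room for a Gaussian norm as small as sqrt d / 2 and
  for the shift by 4 \<kappa>.\<close>

lemma tail_r: "gauss_tail (r / 2) \<le> 1 / real n ^ 8" "gauss_tail r \<le> 1 / real n ^ 8"
proof -
  have "(r / 2)\<^sup>2 / 2 = 8 * L" using L_ge_1 by (simp add: r_def power2_eq_square)
  then show 1: "gauss_tail (r / 2) \<le> 1 / real n ^ 8"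
    using gauss_tail_le[of "r / 2"] exp_L[of 8] sqrt_L by (simp add: r_def)
  have "r / 2 \<le> r" using sqrt_L by (simp add: r_def)
  from gauss_tail_antimono[OF this] 1 show "gauss_tail r \<le> 1 / real n ^ 8" by linarith
qed

definition "Bad = {g \<in> space (gauss_vec d). \<bar>dot d g g - d\<bar> > d * \<eta>}"

lemma Bad_sets [measurable]: "Bad \<in> sets (gauss_vec d)"
  unfolding Bad_def by measurable

text \<open>The 12 in \<eta> gives 144 / 16 = 9 as the factor of L in the concentration exponent,
  more than the 8 asked for.\<close>

lemma prob_Bad: "measure (gauss_vec d) Bad \<le> 2 / real n ^ 8"
proof -
  have "d * \<eta>\<^sup>2 / 16 = 9 * L" using sqrt_d_pos L_ge_1 by (simp add: \<eta>_def power_divide power_mult_distrib)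
  then have "measure (gauss_vec d) Bad \<le> 2 * exp (- (9 * L))"
    using gauss_vec_norm_concentration[of \<eta> d] eta_bounds by (simp add: Bad_def)
  also have "\<dots> \<le> 2 * exp (- (8 * L))" using L_ge_1 by simp
  finally show ?thesis using exp_L[of 8] by simp
qed

lemma not_Bad:
  assumes "g \<in> space (gauss_vec d) - Bad"
  shows "\<bar>sqrt (dot d g g) - sqrt d\<bar> \<le> sqrt d * \<eta>" "sqrt (dot d g g) > 0" "sqrt (dot d g g) \<ge> sqrt d / 2"
proof -
  show 1: "\<bar>sqrt (dot d g g) - sqrt d\<bar> \<le> sqrt d * \<eta>"
    using assms d dot_self_nonneg[of d g] by (intro sqrt_close) (auto simp: Bad_def)
  have "sqrt d * \<eta> \<le> sqrt d * (1 / 2)" using eta_bounds sqrt_d_pos by (intro mult_left_mono) auto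
  with 1 show 2: "sqrt (dot d g g) \<ge> sqrt d / 2" by linarith
  then show "sqrt (dot d g g) > 0" using sqrt_d_pos by linarith
qed

text \<open>Off \<open>Bad\<close> the normalisation by |g| is controlled deterministically, so that
  only an inclusion of events remains to be checked.\<close>

lemma measure_le_bad:
  assumes "\<And>g. g \<in> A - Bad \<Longrightarrow> g \<in> B" "A \<subseteq> space (gauss_vec d)" "B \<in> sets (gauss_vec d)"
  shows "measure (gauss_vec d) A \<le> measure (gauss_vec d) B + 2 / real n ^ 8"
proof -
  have "measure (gauss_vec d) A \<le> measure (gauss_vec d) (B \<union> Bad)"
    using assms Bad_sets by (intro gauss_vec.finite_measure_mono) auto
  also have "\<dots> \<le> measure (gauss_vec d) B + measure (gauss_vec d) Bad"
    using assms Bad_sets by (intro measure_Un_le) auto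
  finally show ?thesis using prob_Bad by linarith
qed

lemma gauss_event_sets:
  assumes [measurable]: "A \<in> sets borel"
  shows "{g \<in> space (gauss_vec d). dot d u g \<in> A} \<in> sets (gauss_vec d)"
  by measurable

lemma gauss_event2_sets:
  assumes [measurable]: "S \<in> sets (borel \<Otimes>\<^sub>M borel)"
  shows "{g \<in> space (gauss_vec d). (dot d u g, dot d u' g) \<in> S} \<in> sets (gauss_vec d)"
  by measurable

lemma gauss_cap_sets:
  "{g \<in> space (gauss_vec d). t \<le> dot d u g / sqrt (dot d g g)} \<in> sets (gauss_vec d)"
  "{g \<in> space (gauss_vec d). t \<le> dot d u g / sqrt (dot d g g) \<and> t \<le> dot d u' g / sqrt (dot d g g)} \<in> sets (gauss_vec d)"
  by measurable

lemma cap_measure: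
  assumes u: "dot d u u = 1"
  shows "measure (uniform_sphere d) {x \<in> space (uniform_sphere d). t \<le> dot d u x} = p"
    and "measure (gauss_vec d) {g \<in> space (gauss_vec d). t \<le> dot d u g / sqrt (dot d g g)} = p"
proof -
  have p01: "0 < p" "p < 1" using p n by (auto intro: less_le_trans[rotated])
  let ?A = "{x \<in> space (uniform_sphere d). t \<le> dot d u x}"
  have A: "?A \<in> sets (uniform_sphere d)" by measurable
  have "emeasure (uniform_sphere d) ?A = (\<integral>\<^sup>+ x. indicator {t..} (dot d u x) \<partial>uniform_sphere d)"
    using A by (subst nn_integral_indicator[symmetric], assumption) (intro nn_integral_cong, auto split: split_indicator)
  also have "\<dots> = emeasure (sphere_marginal d) {t..}"
    using nn_integral_sphere_marginal[OF d u, of "indicator {t..}"] by simp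
  finally have "measure (uniform_sphere d) ?A = measure (sphere_marginal d) {t..}" by (simp add: measure_def)
  then show 1: "measure (uniform_sphere d) ?A = p" using threshold_spec[OF d p01] by (simp add: t_def)
  show "measure (gauss_vec d) {g \<in> space (gauss_vec d). t \<le> dot d u g / sqrt (dot d g g)} = p"
    using measure_sphere_dots[of "{t..} \<times> UNIV" d u u] 1 by simp
qed

lemma exists_unit: "\<exists>u. dot d u u = 1"
  using dot_unit_vec[of d] d by auto

lemma n_powers: "3 / real n ^ 8 < 1 / n" "3 / real n ^ 8 < (1 / 2 :: real)"
proof -
  have "(3::real) ^ 7 \<le> real n ^ 7" using n by (intro power_mono) auto
  then have "(3 :: real) < real n ^ 7" by simp
  then show 1: "3 / real n ^ 8 < 1 / n" using n by (simp add: field_simps power_Suc numeral_eq_Suc)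
  have "1 / real n \<le> 1 / 3" using n by (simp add: field_simps)
  with 1 show "3 / real n ^ 8 < (1 / 2 :: real)" by linarith
qed

text \<open>Off \<open>Bad\<close>, T > r puts the cap inside a Gaussian half-line beyond r / 2, so
  p \<le> 3 / n^8 < 1 / n. For T < -r the complement of the cap is equally rare and 1 - p < 1/2.
  Both contradict the range of p.\<close>

lemma T_bound: "\<bar>T\<bar> \<le> r"
proof -
  obtain u where u: "dot d u u = 1" using exists_unit by blast
  have r0: "r \<ge> 0" using sqrt_L by (simp add: r_def)
  show ?thesis
  proof (rule ccontr)
    assume "\<not> ?thesis"
    then consider "T > r" | "T < - r" by linarith
    then show False
    proof cases
      case 1
      then have tpos: "t > 0" using r0 sqrt_d_pos by (auto simp: T_def zero_less_mult_iff dest: order.strict_trans1)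
      have "p = measure (gauss_vec d) {g \<in> space (gauss_vec d). t \<le> dot d u g / sqrt (dot d g g)}"
        by (rule cap_measure(2)[OF u, symmetric])
      also have "\<dots> \<le> measure (gauss_vec d) {g \<in> space (gauss_vec d). dot d u g \<in> {r / 2..}} + 2 / real n ^ 8"
      proof (rule measure_le_bad)
        fix g assume g: "g \<in> {g \<in> space (gauss_vec d). t \<le> dot d u g / sqrt (dot d g g)} - Bad"
        then have nb: "sqrt (dot d g g) > 0" "sqrt (dot d g g) \<ge> sqrt d / 2" using not_Bad by auto
        have "r / 2 \<le> t * (sqrt d / 2)" using 1 by (simp add: T_def)
        also have "\<dots> \<le> t * sqrt (dot d g g)" using nb tpos by (intro mult_left_mono) auto
        also have "\<dots> \<le> dot d u g" using g nb by (simp add: pos_le_divide_eq)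
        finally show "g \<in> {g \<in> space (gauss_vec d). dot d u g \<in> {r / 2..}}" using g by simp
      qed (blast, rule gauss_event_sets, simp)
      also have "\<dots> = gauss_tail (r / 2) + 2 / real n ^ 8"
        by (subst gauss_projection_law[OF u]) (auto simp: gauss_tail_def)
      also have "\<dots> \<le> 3 / real n ^ 8" using tail_r by simp
      finally show False using n_powers p by linarith
    next
      case 2
      have tneg: "t < 0"
      proof (rule ccontr)
        assume "\<not> t < 0"
        then have "0 \<le> T" by (simp add: T_def)
        then show False using 2 r0 by linarith
      qed
      let ?A = "{g \<in> space (gauss_vec d). t \<le> dot d u g / sqrt (dot d g g)}"
      have "1 - p = measure (gauss_vec d) (space (gauss_vec d) - ?A)"
        by (subst gauss_vec.prob_compl) (measurable, simp add: cap_measure(2)[OF u])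
      also have "\<dots> \<le> measure (gauss_vec d) {g \<in> space (gauss_vec d). dot d u g \<in> {..- (r / 2)}} + 2 / real n ^ 8"
      proof (rule measure_le_bad)
        fix g assume g: "g \<in> (space (gauss_vec d) - ?A) - Bad"
        then have nb: "sqrt (dot d g g) > 0" "sqrt (dot d g g) \<ge> sqrt d / 2" using not_Bad by auto
        have "dot d u g \<le> t * sqrt (dot d g g)" using g nb by (auto simp: not_le pos_divide_less_eq)
        also have "\<dots> \<le> t * (sqrt d / 2)" using nb tneg by (intro mult_left_mono_neg) auto
        also have "\<dots> \<le> - (r / 2)" using 2 by (simp add: T_def)
        finally show "g \<in> {g \<in> space (gauss_vec d). dot d u g \<in> {..- (r / 2)}}" using g by simp
      qed (blast, rule gauss_event_sets, simp)
      also have "\<dots> = gauss_tail (r / 2) + 2 / real n ^ 8"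
        by (subst gauss_projection_law[OF u]) (auto simp: std_gauss_uminus)
      also have "\<dots> \<le> 3 / real n ^ 8" using tail_r by simp
      finally show False using n_powers p by linarith
    qed
  qed
qed

lemma threshold_close:
  assumes "g \<in> space (gauss_vec d) - Bad"
  shows "\<bar>t * sqrt (dot d g g) - T\<bar> \<le> \<kappa>"
proof -
  have "\<bar>t * sqrt (dot d g g) - T\<bar> = \<bar>t\<bar> * \<bar>sqrt (dot d g g) - sqrt d\<bar>"
    unfolding T_def by (simp add: abs_mult[symmetric] right_diff_distrib)
  also have "\<dots> \<le> \<bar>t\<bar> * (sqrt d * \<eta>)" using not_Bad(1)[OF assms] by (intro mult_left_mono) auto
  also have "\<dots> = \<bar>T\<bar> * \<eta>" using sqrt_d_pos by (simp add: T_def abs_mult)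
  also have "\<dots> \<le> r * \<eta>" using T_bound eta_bounds by (intro mult_right_mono) auto
  finally show ?thesis using kappa_bounds by linarith
qed

lemma p_sandwich: "gauss_tail (T + \<kappa>) - 2 / real n ^ 8 \<le> p" "p \<le> gauss_tail (T - \<kappa>) + 2 / real n ^ 8"
proof -
  obtain u where u: "dot d u u = 1" using exists_unit by blast
  have tl: "gauss_tail a = measure (gauss_vec d) {g \<in> space (gauss_vec d). dot d u g \<in> {a..}}" for a
    by (subst gauss_projection_law[OF u]) (auto simp: gauss_tail_def)
  let ?C = "{g \<in> space (gauss_vec d). t \<le> dot d u g / sqrt (dot d g g)}"
  have "gauss_tail (T + \<kappa>) = measure (gauss_vec d) {g \<in> space (gauss_vec d). dot d u g \<in> {T + \<kappa>..}}" by (rule tl)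
  also have "\<dots> \<le> measure (gauss_vec d) ?C + 2 / real n ^ 8"
  proof (rule measure_le_bad)
    fix g assume g: "g \<in> {g \<in> space (gauss_vec d). dot d u g \<in> {T + \<kappa>..}} - Bad"
    then have "\<bar>t * sqrt (dot d g g) - T\<bar> \<le> \<kappa>" "sqrt (dot d g g) > 0" using threshold_close not_Bad by auto
    moreover from g have "T + \<kappa> \<le> dot d u g" by simp
    ultimately have "t * sqrt (dot d g g) \<le> dot d u g" by linarith
    then show "g \<in> ?C" using g \<open>sqrt (dot d g g) > 0\<close> by (simp add: pos_le_divide_eq)
  qed (blast, rule gauss_cap_sets)
  finally show "gauss_tail (T + \<kappa>) - 2 / real n ^ 8 \<le> p" unfolding cap_measure(2)[OF u] by simp
  have "measure (gauss_vec d) ?C \<le> measure (gauss_vec d) {g \<in> space (gauss_vec d). dot d u g \<in> {T - \<kappa>..}} + 2 / real n ^ 8"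
  proof (rule measure_le_bad)
    fix g assume g: "g \<in> ?C - Bad"
    then have "\<bar>t * sqrt (dot d g g) - T\<bar> \<le> \<kappa>" "sqrt (dot d g g) > 0" using threshold_close not_Bad by auto
    moreover from this g have "t * sqrt (dot d g g) \<le> dot d u g" by (simp add: pos_le_divide_eq)
    ultimately have "T - \<kappa> \<le> dot d u g" by linarith
    then show "g \<in> {g \<in> space (gauss_vec d). dot d u g \<in> {T - \<kappa>..}}" using g by simp
  qed (blast, rule gauss_event_sets, simp)
  then show "p \<le> gauss_tail (T - \<kappa>) + 2 / real n ^ 8" unfolding cap_measure(2)[OF u] tl .
qed

text \<open>The analogue of \<open>measure_le_bad\<close> for a pair of Gaussian variables truncated
  at r; four one-sided tails are lost.\<close>

lemma measure_std_gauss2_le: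
  assumes "\<And>x y. (x, y) \<in> A \<Longrightarrow> \<bar>x\<bar> \<le> r \<Longrightarrow> \<bar>y\<bar> \<le> r \<Longrightarrow> (x, y) \<in> B" and B: "B \<in> sets (borel \<Otimes>\<^sub>M borel)"
  shows "measure std_gauss2 A \<le> measure std_gauss2 B + 4 / real n ^ 8"
proof -
  let ?X = "{x. \<bar>x\<bar> > r} \<times> (UNIV :: real set)" and ?Y = "(UNIV :: real set) \<times> {x. \<bar>x\<bar> > r}"
  have X: "?X \<in> sets std_gauss2" "?Y \<in> sets std_gauss2" by measurable
  have Bs: "B \<in> sets std_gauss2" using B by (simp add: sets_std_gauss2)
  have "measure std_gauss {x. \<bar>x\<bar> > r} \<le> 2 / real n ^ 8" using std_gauss_abs_gt[of r] tail_r by linarith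
  then have XY: "measure std_gauss2 ?X \<le> 2 / real n ^ 8" "measure std_gauss2 ?Y \<le> 2 / real n ^ 8"
    using std_gauss.prob_space by (simp_all add: measure_std_gauss2_Times)
  have "measure std_gauss2 A \<le> measure std_gauss2 (B \<union> (?X \<union> ?Y))"
  proof (intro std_gauss2.P.finite_measure_mono)
    show "A \<subseteq> B \<union> (?X \<union> ?Y)"
    proof
      fix z assume "z \<in> A"
      then show "z \<in> B \<union> (?X \<union> ?Y)" using assms(1)[of "fst z" "snd z"]
        by (cases "\<bar>fst z\<bar> \<le> r"; cases "\<bar>snd z\<bar> \<le> r"; cases z) auto
    qed
  qed (use X Bs in auto)
  also have "\<dots> \<le> measure std_gauss2 B + (measure std_gauss2 ?X + measure std_gauss2 ?Y)"
    using X Bs by (intro order_trans[OF measure_Un_le] add_left_mono measure_Un_le) auto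
  finally show ?thesis using XY by linarith
qed

text \<open>The coordinates along u and u' are x and s x + c y with |s| \<le> \<eta>. On |x|, |y|
  \<le> r the second is within \<kappa> of the independent variable y, and the random norm moves the
  threshold by at most another \<kappa>. The event thus lies between the squares of the half-lines
  starting at T + 2 \<kappa> and T - 2 \<kappa>.\<close>

lemma cap_pair_measure:
  assumes u: "dot d u u = 1" and u': "dot d u' u' = 1" and s: "\<bar>dot d u u'\<bar> \<le> \<eta>"
  shows "\<bar>measure (uniform_sphere d) {x \<in> space (uniform_sphere d). t \<le> dot d u x \<and> t \<le> dot d u' x} - p\<^sup>2\<bar> \<le> 16 * \<delta> * p\<^sup>2"
proof -
  define s where "s = dot d u u'"
  obtain c where c: "c \<ge> 0" "s\<^sup>2 + c\<^sup>2 = 1"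
    and law: "\<And>S. S \<in> sets (borel \<Otimes>\<^sub>M borel) \<Longrightarrow>
      measure (gauss_vec d) {g \<in> space (gauss_vec d). (dot d u g, dot d u' g) \<in> S} =
      measure std_gauss2 {z \<in> space std_gauss2. (fst z, s * fst z + c * snd z) \<in> S}"
    using pair_measure_law[OF u, of u'] unfolding u' s_def by blast
  have s1: "\<bar>s\<bar> \<le> \<eta>" using s by (simp add: s_def)
  have c1: "\<bar>1 - c\<bar> \<le> \<bar>s\<bar>"
  proof -
    have "c\<^sup>2 \<le> 1\<^sup>2" unfolding power_one using c(2) zero_le_power2[of s] by linarith
    then have c1: "c \<le> 1" by (rule power2_le_imp_le) simp
    have "(1 - c) * 1 \<le> (1 - c) * (1 + c)" using c c1 by (intro mult_left_mono) auto
    also have "\<dots> = s\<^sup>2" using c(2) by (simp add: power2_eq_square algebra_simps)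
    also have "\<dots> = \<bar>s\<bar> * \<bar>s\<bar>" by (simp add: power2_eq_square)
    also have "\<dots> \<le> \<bar>s\<bar> * 1" using s1 eta_bounds by (intro mult_left_mono) auto
    finally show ?thesis using c1 by simp
  qed
  have close: "\<bar>(s * x + c * y) - y\<bar> \<le> \<kappa>" if "\<bar>x\<bar> \<le> r" "\<bar>y\<bar> \<le> r" for x y
  proof -
    have "(s * x + c * y) - y = s * x - (1 - c) * y" by (simp add: algebra_simps)
    then have "\<bar>(s * x + c * y) - y\<bar> \<le> \<bar>s * x\<bar> + \<bar>(1 - c) * y\<bar>" by linarith
    also have "\<dots> \<le> \<eta> * r + \<eta> * r"
      unfolding abs_mult using that s1 c1 eta_bounds by (intro add_mono mult_mono) auto
    finally show ?thesis using kappa_bounds(3) by (simp add: mult_ac)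
  qed
  define G where "G = measure (uniform_sphere d) {x \<in> space (uniform_sphere d). t \<le> dot d u x \<and> t \<le> dot d u' x}"
  have G: "G = measure (gauss_vec d) {g \<in> space (gauss_vec d). t \<le> dot d u g / sqrt (dot d g g) \<and> t \<le> dot d u' g / sqrt (dot d g g)}"
    using measure_sphere_dots[of "{t..} \<times> {t..}" d u u'] by (simp add: G_def)
  have prod: "measure std_gauss2 ({a..} \<times> {a..}) = (gauss_tail a)\<^sup>2" for a
    by (simp add: measure_std_gauss2_Times gauss_tail_def power2_eq_square)
  have k0: "\<kappa> \<ge> 0" by (rule kappa_bounds)
  have GA: "G \<le> (gauss_tail (T - 2 * \<kappa>))\<^sup>2 + 6 / real n ^ 8"
  proof -
    let ?a = "T - \<kappa>"
    have "G \<le> measure (gauss_vec d) {g \<in> space (gauss_vec d). (dot d u g, dot d u' g) \<in> {?a..} \<times> {?a..}} + 2 / real n ^ 8"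
      unfolding G
    proof (rule measure_le_bad)
      fix g assume g: "g \<in> {g \<in> space (gauss_vec d). t \<le> dot d u g / sqrt (dot d g g) \<and> t \<le> dot d u' g / sqrt (dot d g g)} - Bad"
      then have "\<bar>t * sqrt (dot d g g) - T\<bar> \<le> \<kappa>" "sqrt (dot d g g) > 0" using threshold_close not_Bad by auto
      moreover from this g have "t * sqrt (dot d g g) \<le> dot d u g" "t * sqrt (dot d g g) \<le> dot d u' g"
        by (simp_all add: pos_le_divide_eq)
      ultimately have "?a \<le> dot d u g" "?a \<le> dot d u' g" by linarith+
      then show "g \<in> {g \<in> space (gauss_vec d). (dot d u g, dot d u' g) \<in> {?a..} \<times> {?a..}}"
        using g by simp
    qed (blast, rule gauss_event2_sets, simp)
    also have "measure (gauss_vec d) {g \<in> space (gauss_vec d). (dot d u g, dot d u' g) \<in> {?a..} \<times> {?a..}} =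
        measure std_gauss2 {z \<in> space std_gauss2. (fst z, s * fst z + c * snd z) \<in> {?a..} \<times> {?a..}}"
      by (rule law) auto
    also have "\<dots> \<le> measure std_gauss2 ({T - 2 * \<kappa>..} \<times> {T - 2 * \<kappa>..}) + 4 / real n ^ 8"
    proof (rule measure_std_gauss2_le)
      fix x y assume "(x, y) \<in> {z \<in> space std_gauss2. (fst z, s * fst z + c * snd z) \<in> {?a..} \<times> {?a..}}"
        and "\<bar>x\<bar> \<le> r" "\<bar>y\<bar> \<le> r"
      then show "(x, y) \<in> {T - 2 * \<kappa>..} \<times> {T - 2 * \<kappa>..}" using close[of x y] k0 by auto
    qed auto
    finally show ?thesis by (simp add: prod)
  qed
  have GB: "(gauss_tail (T + 2 * \<kappa>))\<^sup>2 - 6 / real n ^ 8 \<le> G"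
  proof -
    let ?a = "T + \<kappa>"
    have "measure std_gauss2 ({T + 2 * \<kappa>..} \<times> {T + 2 * \<kappa>..}) \<le>
        measure std_gauss2 {z \<in> space std_gauss2. (fst z, s * fst z + c * snd z) \<in> {?a..} \<times> {?a..}} + 4 / real n ^ 8"
    proof (rule measure_std_gauss2_le)
      fix x y assume "(x, y) \<in> {T + 2 * \<kappa>..} \<times> {T + 2 * \<kappa>..}" "\<bar>x\<bar> \<le> r" "\<bar>y\<bar> \<le> r"
      then show "(x, y) \<in> {z \<in> space std_gauss2. (fst z, s * fst z + c * snd z) \<in> {?a..} \<times> {?a..}}"
        using close[of x y] k0 by (auto simp: space_pair_measure)
    next
      have "{z \<in> space std_gauss2. (fst z, s * fst z + c * snd z) \<in> {?a..} \<times> {?a..}} \<in> sets std_gauss2" by measurable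
      then show "{z \<in> space std_gauss2. (fst z, s * fst z + c * snd z) \<in> {?a..} \<times> {?a..}} \<in> sets (borel \<Otimes>\<^sub>M borel)"
        by (simp only: sets_std_gauss2)
    qed
    also have "measure std_gauss2 {z \<in> space std_gauss2. (fst z, s * fst z + c * snd z) \<in> {?a..} \<times> {?a..}} =
        measure (gauss_vec d) {g \<in> space (gauss_vec d). (dot d u g, dot d u' g) \<in> {?a..} \<times> {?a..}}"
      by (rule law[symmetric]) auto
    also have "\<dots> \<le> G + 2 / real n ^ 8"
      unfolding G
    proof (rule measure_le_bad)
      fix g assume g: "g \<in> {g \<in> space (gauss_vec d). (dot d u g, dot d u' g) \<in> {?a..} \<times> {?a..}} - Bad"
      then have "\<bar>t * sqrt (dot d g g) - T\<bar> \<le> \<kappa>" "sqrt (dot d g g) > 0" using threshold_close not_Bad by auto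
      moreover from g have "T + \<kappa> \<le> dot d u g" "T + \<kappa> \<le> dot d u' g" by simp_all
      ultimately have "t * sqrt (dot d g g) \<le> dot d u g" "t * sqrt (dot d g g) \<le> dot d u' g" by linarith+
      then show "g \<in> {g \<in> space (gauss_vec d). t \<le> dot d u g / sqrt (dot d g g) \<and> t \<le> dot d u' g / sqrt (dot d g g)}"
        using g \<open>sqrt (dot d g g) > 0\<close> by (simp add: pos_le_divide_eq)
    qed (blast, rule gauss_cap_sets)
    finally show ?thesis by (simp add: prod)
  qed
  show ?thesis
    unfolding G_def[symmetric]
  \<comment> \<open>6 / n^8 is 2 / n^8 from \<open>Bad\<close> plus 4 / n^8 from the truncation at
    r.\<close>
  proof (rule second_moment_algebra[of \<delta> p "gauss_tail (T + 2 * \<kappa>)" "gauss_tail (T - 2 * \<kappa>)" "6 / real n ^ 8"])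
    have "gauss_tail (T + 2 * \<kappa>) \<le> gauss_tail (T + \<kappa>)" "gauss_tail (T - \<kappa>) \<le> gauss_tail (T - 2 * \<kappa>)"
      using k0 by (auto intro: gauss_tail_antimono)
    moreover have "2 / real n ^ 8 \<le> 6 / real n ^ 8" by (intro divide_right_mono) auto
    ultimately show "gauss_tail (T + 2 * \<kappa>) - 6 / real n ^ 8 \<le> p" "p \<le> gauss_tail (T - 2 * \<kappa>) + 6 / real n ^ 8"
      using p_sandwich by linarith+
    have "gauss_tail (T - 2 * \<kappa>) = gauss_tail ((T + 2 * \<kappa>) - 4 * \<kappa>)" by (simp add: algebra_simps)
    also have "\<dots> \<le> exp (4 * \<kappa> * r) * gauss_tail (T + 2 * \<kappa>) + gauss_tail (r - 4 * \<kappa>)"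
      by (rule gauss_tail_shift) (use k0 in simp)
    also have "gauss_tail (r - 4 * \<kappa>) \<le> gauss_tail (r / 2)"
      using kappa_bounds(4) by (intro gauss_tail_antimono) simp
    also have "exp (4 * \<kappa> * r) * gauss_tail (T + 2 * \<kappa>) \<le> (1 + \<delta>) * gauss_tail (T + 2 * \<kappa>)"
      using kappa_bounds(5) gauss_tail_nonneg by (intro mult_right_mono)
    finally have "gauss_tail (T - 2 * \<kappa>) \<le> (1 + \<delta>) * gauss_tail (T + 2 * \<kappa>) + gauss_tail (r / 2)" by simp
    moreover have "1 / real n ^ 8 \<le> 6 / real n ^ 8" by (intro divide_right_mono) auto
    ultimately show "gauss_tail (T - 2 * \<kappa>) \<le> (1 + \<delta>) * gauss_tail (T + 2 * \<kappa>) + 6 / real n ^ 8"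
      using tail_r by linarith
    have "6 / real n ^ 8 \<le> 8 / real n ^ 6 * (1 / real n)\<^sup>2"
      using n by (simp add: field_simps power2_eq_square numeral_eq_Suc)
    also have "\<dots> \<le> \<delta> * p\<^sup>2" using \<delta> p by (intro mult_mono power_mono) auto
    finally show "6 / real n ^ 8 \<le> \<delta> * p\<^sup>2" .
    have "0 \<le> 1 / real n" by simp
    then show "0 \<le> p" "p \<le> 1" using p by linarith+
  qed (use GA GB \<delta> gauss_tail_nonneg in auto)
qed

text \<open>On the good event |u . g| exceeds \<eta> sqrt d / 2 = 6 sqrt L, which is larger than r /
  2 = 4 sqrt L.\<close>

lemma near_orthogonal:
  assumes u: "dot d u u = 1"
  shows "measure (uniform_sphere d) {x \<in> space (uniform_sphere d). \<bar>dot d u x\<bar> > \<eta>} \<le> 4 / real n ^ 8"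
proof -
  have "measure (uniform_sphere d) {x \<in> space (uniform_sphere d). \<bar>dot d u x\<bar> > \<eta>} =
      measure (gauss_vec d) {g \<in> space (gauss_vec d). \<bar>dot d u g / sqrt (dot d g g)\<bar> > \<eta>}"
    using measure_sphere_dots[of "{x. \<bar>x\<bar> > \<eta>} \<times> UNIV" d u u] by simp
  also have "\<dots> \<le> measure (gauss_vec d) {g \<in> space (gauss_vec d). dot d u g \<in> {x. \<bar>x\<bar> > r / 2}} + 2 / real n ^ 8"
  proof (rule measure_le_bad)
    fix g assume g: "g \<in> {g \<in> space (gauss_vec d). \<bar>dot d u g / sqrt (dot d g g)\<bar> > \<eta>} - Bad"
    then have nb: "sqrt (dot d g g) > 0" "sqrt (dot d g g) \<ge> sqrt d / 2" using not_Bad by auto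
    have "r / 2 < \<eta> * (sqrt d / 2)" using sqrt_L sqrt_d_pos by (simp add: r_def \<eta>_def)
    also have "\<dots> \<le> \<eta> * sqrt (dot d g g)" using nb eta_bounds by (intro mult_left_mono) auto
    also have "\<dots> < \<bar>dot d u g\<bar>"
      using g nb by (simp add: abs_divide pos_less_divide_eq)
    finally show "g \<in> {g \<in> space (gauss_vec d). dot d u g \<in> {x. \<bar>x\<bar> > r / 2}}" using g by simp
  qed (blast, rule gauss_event_sets, measurable)
  also have "\<dots> = measure std_gauss {x. \<bar>x\<bar> > r / 2} + 2 / real n ^ 8"
    by (subst gauss_projection_law[OF u]) auto
  also have "\<dots> \<le> 4 / real n ^ 8" using std_gauss_abs_gt[of "r / 2"] tail_r by simp
  finally show ?thesis .
qed

end

section \<open>The random geometric graph\<close>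

context cap_regime
begin

text \<open>Unlike the graph, this relation keeps the diagonal; only entries with distinct indices
  enter the degrees and the columns.\<close>

definition adj :: "(nat \<Rightarrow> nat \<Rightarrow> real) \<Rightarrow> nat \<Rightarrow> nat \<Rightarrow> real" where
  "adj X i j = of_bool (t \<le> dot d (X i) (X j))"

lemma adj_sym: "adj X i j = adj X j i"
  by (simp add: adj_def dot_commute)

lemma adj_01: "0 \<le> adj X i j" "adj X i j \<le> 1" "(adj X i j)\<^sup>2 = adj X i j"
  by (simp_all add: adj_def)

lemma p_pos: "0 < p" and p_less_1: "p < 1"
  using p n by (auto intro: less_le_trans[rotated])

abbreviation "P \<equiv> uniform_points n d"

interpretation P: prob_space P by (rule prob_space_uniform_points)

lemma measurable_point: "i \<in> {1..n} \<Longrightarrow> (\<lambda>X. X i) \<in> P \<rightarrow>\<^sub>M borel_vec d"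
  using measurable_component_singleton[of i "{1..n}" "\<lambda>_. uniform_sphere d"]
  by (simp add: uniform_points_def cong: measurable_cong_sets)

lemma measurable_point_dot:
  assumes "i \<in> {1..n}" "j \<in> {1..n}"
  shows "(\<lambda>X. dot d (X i) (X j)) \<in> borel_measurable P"
proof -
  have "(\<lambda>X. X l k) \<in> borel_measurable P" if "l \<in> {1..n}" "k < d" for l k
    using measurable_compose[OF measurable_point[OF that(1)] measurable_component_singleton[of k]] that by simp
  then show ?thesis using assms unfolding dot_def by (intro borel_measurable_sum borel_measurable_times) auto
qed

lemma measurable_adj: "i \<in> {1..n} \<Longrightarrow> j \<in> {1..n} \<Longrightarrow> (\<lambda>X. adj X i j) \<in> borel_measurable P"
  unfolding adj_def using measurable_point_dot by measurable

lemma AE_points_unit: "AE X in P. \<forall>i\<in>{1..n}. dot d (X i) (X i) = 1"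
proof (rule AE_finite_allI)
  fix i assume i: "i \<in> {1..n}"
  show "AE X in P. dot d (X i) (X i) = 1"
    unfolding uniform_points_def
    by (rule AE_PiM_component[OF prob_space_uniform_sphere i AE_sphere_unit]) (use d in simp)
qed simp

lemma resample:
  assumes "j \<in> {1..n}" "F \<in> borel_measurable P"
  shows "(\<integral>\<^sup>+ X. F X \<partial>P) = (\<integral>\<^sup>+ X. \<integral>\<^sup>+ x. F (X(j := x)) \<partial>uniform_sphere d \<partial>P)"
  using assms unfolding uniform_points_def
  by (intro nn_integral_PiM_resample prob_space_uniform_sphere) auto

section \<open>Degrees and pairwise inner products\<close>

lemma nn_integral_exp_cap:
  assumes u: "dot d u u = 1"
  shows "(\<integral>\<^sup>+ x. ennreal (exp (s * of_bool (t \<le> dot d u x))) \<partial>uniform_sphere d) = ennreal (1 + p * (exp s - 1))"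
proof -
  let ?A = "{x \<in> space (uniform_sphere d). t \<le> dot d u x}"
  have A: "?A \<in> sets (uniform_sphere d)" "space (uniform_sphere d) - ?A \<in> sets (uniform_sphere d)" by measurable
  have "(\<integral>\<^sup>+ x. ennreal (exp (s * of_bool (t \<le> dot d u x))) \<partial>uniform_sphere d) =
      (\<integral>\<^sup>+ x. ennreal (exp s) * indicator ?A x + indicator (space (uniform_sphere d) - ?A) x \<partial>uniform_sphere d)"
    by (intro nn_integral_cong) (auto simp: indicator_def)
  also have "\<dots> = ennreal (exp s) * emeasure (uniform_sphere d) ?A + emeasure (uniform_sphere d) (space (uniform_sphere d) - ?A)"
    using A by (subst nn_integral_add) (auto simp: nn_integral_cmult)
  also have "\<dots> = ennreal (exp s) * ennreal p + ennreal (1 - p)"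
    using sphere.prob_compl[OF A(1)] cap_measure(1)[OF u] by (simp only: sphere.emeasure_eq_measure)
  also have "\<dots> = ennreal (exp s * p + (1 - p))"
    using p_pos p_less_1 by (simp add: ennreal_mult)
  also have "exp s * p + (1 - p) = 1 + p * (exp s - 1)" by (simp add: algebra_simps)
  finally show ?thesis .
qed

text \<open>Given the point j, the other endpoints fall into its cap independently with probability
  p, so the degree has the exact binomial generating function. Independence appears as resampling
  the points of S one by one, with X j left fixed.\<close>

lemma degree_mgf:
  assumes j: "j \<in> {1..n}" and S: "finite S" "S \<subseteq> {1..n} - {j}"
  shows "(\<integral>\<^sup>+ X. ennreal (exp (s * (\<Sum>i\<in>S. adj X j i))) \<partial>P) = ennreal ((1 + p * (exp s - 1)) ^ card S)"
  using S
proof (induction S rule: finite_induct)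
  case empty
  then show ?case by (simp add: P.emeasure_space_1)
next
  case (insert k S)
  then have k: "k \<in> {1..n}" "k \<noteq> j" by auto
  have base: "1 + p * (exp s - 1) \<ge> 0"
  proof -
    have "p * (1 - exp s) \<le> p * 1" using p_pos by (intro mult_left_mono) auto
    then show ?thesis using p_less_1 by (simp add: algebra_simps)
  qed
  have meas: "(\<lambda>X. ennreal (exp (s * (\<Sum>i\<in>T. adj X j i)))) \<in> borel_measurable P" if "T \<subseteq> {1..n}" for T
  proof -
    have [measurable]: "(\<lambda>X. \<Sum>i\<in>T. adj X j i) \<in> borel_measurable P"
      using that j by (intro borel_measurable_sum measurable_adj) auto
    show ?thesis by measurable
  qed
  have "(\<integral>\<^sup>+ X. ennreal (exp (s * (\<Sum>i\<in>insert k S. adj X j i))) \<partial>P) =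
     (\<integral>\<^sup>+ X. \<integral>\<^sup>+ x. ennreal (exp (s * (\<Sum>i\<in>insert k S. adj (X(k := x)) j i))) \<partial>uniform_sphere d \<partial>P)"
    by (rule resample[OF k(1) meas]) (use insert in auto)
  also have "\<dots> = (\<integral>\<^sup>+ X. ennreal (exp (s * (\<Sum>i\<in>S. adj X j i))) * ennreal (1 + p * (exp s - 1)) \<partial>P)"
  proof (rule nn_integral_cong_AE)
    show "AE X in P. (\<integral>\<^sup>+ x. ennreal (exp (s * (\<Sum>i\<in>insert k S. adj (X(k := x)) j i))) \<partial>uniform_sphere d) =
       ennreal (exp (s * (\<Sum>i\<in>S. adj X j i))) * ennreal (1 + p * (exp s - 1))"
      using AE_points_unit
    proof eventually_elim
      case (elim X)
      have "(\<Sum>i\<in>insert k S. adj (X(k := x)) j i) = of_bool (t \<le> dot d (X j) x) + (\<Sum>i\<in>S. adj X j i)" for x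
      proof -
        have "(\<Sum>i\<in>S. adj (X(k := x)) j i) = (\<Sum>i\<in>S. adj X j i)"
          using insert.hyps k by (intro sum.cong refl) (auto simp: adj_def)
        moreover have "adj (X(k := x)) j k = of_bool (t \<le> dot d (X j) x)" using k by (simp add: adj_def)
        ultimately show ?thesis by (simp only: sum.insert[OF insert.hyps(1,2)])
      qed
      then have "(\<integral>\<^sup>+ x. ennreal (exp (s * (\<Sum>i\<in>insert k S. adj (X(k := x)) j i))) \<partial>uniform_sphere d) =
          (\<integral>\<^sup>+ x. ennreal (exp (s * (\<Sum>i\<in>S. adj X j i))) * ennreal (exp (s * of_bool (t \<le> dot d (X j) x))) \<partial>uniform_sphere d)"
        by (intro nn_integral_cong) (simp only: distrib_left exp_add ennreal_mult[symmetric] exp_ge_zero mult.commute)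
      also have "\<dots> = ennreal (exp (s * (\<Sum>i\<in>S. adj X j i))) *
          (\<integral>\<^sup>+ x. ennreal (exp (s * of_bool (t \<le> dot d (X j) x))) \<partial>uniform_sphere d)"
        by (rule nn_integral_cmult) measurable
      finally show ?case using nn_integral_exp_cap[of "X j" s] elim j by simp
    qed
  qed
  also have "\<dots> = (\<integral>\<^sup>+ X. ennreal (exp (s * (\<Sum>i\<in>S. adj X j i))) \<partial>P) * ennreal (1 + p * (exp s - 1))"
    by (rule nn_integral_multc[OF meas]) (use insert in auto)
  also have "\<dots> = ennreal ((1 + p * (exp s - 1)) ^ card (insert k S))"
    using insert base by (simp add: ennreal_mult[symmetric] mult.commute)
  finally show ?case .
qed

definition deg :: "(nat \<Rightarrow> nat \<Rightarrow> real) \<Rightarrow> nat \<Rightarrow> real" where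
  "deg X j = (\<Sum>i\<in>{1..n} - {j}. adj X j i)"

lemma measurable_deg: "j \<in> {1..n} \<Longrightarrow> (\<lambda>X. deg X j) \<in> borel_measurable P"
  unfolding deg_def by (intro borel_measurable_sum measurable_adj) auto

text \<open>s may have either sign, so that one statement gives both tails.\<close>

lemma degree_chernoff:
  assumes j: "j \<in> {1..n}"
  shows "measure P {X \<in> space P. a \<le> s * deg X j} \<le> exp (real (n - 1) * (p * (exp s - 1)) - a)"
proof -
  have [measurable]: "(\<lambda>X. deg X j) \<in> borel_measurable P" by (rule measurable_deg[OF j])
  have "(\<integral>\<^sup>+ X. ennreal (exp (s * deg X j)) \<partial>P) = ennreal ((1 + p * (exp s - 1)) ^ (n - 1))"
    unfolding deg_def using degree_mgf[OF j, of "{1..n} - {j}" s] j by simp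
  also have "\<dots> \<le> ennreal (exp (p * (exp s - 1)) ^ (n - 1))"
  proof (intro ennreal_leI power_mono exp_ge_add_one_self)
    have "p * (1 - exp s) \<le> p * 1" using p_pos by (intro mult_left_mono) auto
    then show "0 \<le> 1 + p * (exp s - 1)" using p_less_1 by (simp add: algebra_simps)
  qed
  also have "exp (p * (exp s - 1)) ^ (n - 1) = exp (real (n - 1) * (p * (exp s - 1)))"
    by (rule exp_of_nat_mult[symmetric])
  finally show ?thesis by (intro P.exponential_Markov) measurable
qed

lemma degree_upper:
  assumes "j \<in> {1..n}"
  shows "measure P {X \<in> space P. 9 * (n * p) \<le> deg X j} \<le> exp (- (n * p / 12))"
proof -
  have "measure P {X \<in> space P. 9 * (n * p) \<le> 1 * deg X j} \<le> exp (real (n - 1) * (p * (exp 1 - 1)) - 9 * (n * p))"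
    by (rule degree_chernoff[OF assms])
  also have "\<dots> \<le> exp (- (n * p / 12))"
  proof -
    have "real (n - 1) * (p * (exp 1 - 1)) \<le> real n * (p * 2)"
      using exp_le p_pos by (intro mult_mono) auto
    moreover have "0 < n * p" using p_pos n by simp
    ultimately show ?thesis unfolding exp_le_cancel_iff by linarith
  qed
  finally show ?thesis by simp
qed

text \<open>With s = -1 and exp(-1) \<le> 1/2 the exponent is at most - (n - 1) p / 2 + n p / 4; n
  \<ge> 3 gives n - 1 \<ge> 2 n / 3 and hence - n p / 12.\<close>

lemma degree_lower:
  assumes "j \<in> {1..n}"
  shows "measure P {X \<in> space P. deg X j \<le> n * p / 4} \<le> exp (- (n * p / 12))"
proof -
  have "measure P {X \<in> space P. - (n * p / 4) \<le> -1 * deg X j} \<le> exp (real (n - 1) * (p * (exp (-1) - 1)) - - (n * p / 4))"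
    by (rule degree_chernoff[OF assms])
  also have "\<dots> \<le> exp (- (n * p / 12))"
  proof -
    have "exp (1::real) \<ge> 2" using exp_ge_add_one_self[of 1] by simp
    then have "exp (-1 :: real) \<le> 1 / 2" by (simp add: exp_minus inverse_eq_divide field_simps)
    then have 1: "p * (exp (-1) - 1) \<le> p * (- (1 / 2))" using p_pos by (intro mult_left_mono) auto
    have "real (n - 1) * (p * (exp (-1) - 1)) \<le> real (n - 1) * (p * (- (1 / 2)))"
      by (rule mult_left_mono[OF 1]) simp
    also have "\<dots> = - (real (n - 1) * (p / 2))" by simp
    also have "\<dots> \<le> - (2 / 3 * real n * (p / 2))"
      using n p_pos by (intro le_imp_neg_le mult_right_mono) auto
    finally show ?thesis unfolding exp_le_cancel_iff by linarith
  qed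
  finally show ?thesis by simp
qed

lemma points_near_orthogonal:
  assumes "i \<in> {1..n}" "k \<in> {1..n}" "i \<noteq> k"
  shows "measure P {X \<in> space P. \<eta> < \<bar>dot d (X i) (X k)\<bar>} \<le> 4 / real n ^ 8"
proof -
  let ?A = "{X \<in> space P. \<eta> < \<bar>dot d (X i) (X k)\<bar>}"
  have [measurable]: "(\<lambda>X. dot d (X i) (X k)) \<in> borel_measurable P" by (rule measurable_point_dot) (use assms in auto)
  have A: "?A \<in> sets P" by measurable
  have "ennreal (measure P ?A) = (\<integral>\<^sup>+ X. indicator {y. \<eta> < \<bar>y\<bar>} (dot d (X i) (X k)) \<partial>P)"
    unfolding P.emeasure_eq_measure[symmetric]
    using A by (subst nn_integral_indicator[symmetric], assumption) (intro nn_integral_cong, auto split: split_indicator)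
  also have "\<dots> = (\<integral>\<^sup>+ X. \<integral>\<^sup>+ x. indicator {y. \<eta> < \<bar>y\<bar>} (dot d ((X(k := x)) i) ((X(k := x)) k)) \<partial>uniform_sphere d \<partial>P)"
    by (rule resample[OF assms(2)]) measurable
  also have "\<dots> \<le> (\<integral>\<^sup>+ X. ennreal (4 / real n ^ 8) \<partial>P)"
  proof (rule nn_integral_mono_AE)
    show "AE X in P. (\<integral>\<^sup>+ x. indicator {y. \<eta> < \<bar>y\<bar>} (dot d ((X(k := x)) i) ((X(k := x)) k)) \<partial>uniform_sphere d) \<le> ennreal (4 / real n ^ 8)"
      using AE_points_unit
    proof eventually_elim
      case (elim X)
      let ?B = "{x \<in> space (uniform_sphere d). \<eta> < \<bar>dot d (X i) x\<bar>}"
      have B: "?B \<in> sets (uniform_sphere d)" by measurable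
      have "(\<integral>\<^sup>+ x. indicator {y. \<eta> < \<bar>y\<bar>} (dot d ((X(k := x)) i) ((X(k := x)) k)) \<partial>uniform_sphere d) =
          (\<integral>\<^sup>+ x. indicator ?B x \<partial>uniform_sphere d)"
        using assms by (intro nn_integral_cong) (auto split: split_indicator)
      also have "\<dots> = ennreal (measure (uniform_sphere d) ?B)"
        using B by (simp add: sphere.emeasure_eq_measure)
      also have "\<dots> \<le> ennreal (4 / real n ^ 8)"
        using near_orthogonal[of "X i"] elim assms by (intro ennreal_leI) auto
      finally show ?case .
    qed
  qed
  also have "\<dots> = ennreal (4 / real n ^ 8)" by (simp add: P.emeasure_space_1)
  finally show ?thesis by (subst (asm) ennreal_le_iff) auto
qed

section \<open>Truncated columns of the centred adjacency matrix\<close>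

text \<open>The unit norms are included because the points are vectors of R^d that lie on the sphere
  only almost surely, while the covariance bound is applied at every sample point. The range stops
  before j, so resampling point j does not affect the condition.\<close>

definition orth :: "nat \<Rightarrow> (nat \<Rightarrow> nat \<Rightarrow> real) \<Rightarrow> bool" where
  "orth j X \<longleftrightarrow> (\<forall>i\<in>{1..<j}. dot d (X i) (X i) = 1 \<and> (\<forall>k\<in>{1..<j} - {i}. \<bar>dot d (X i) (X k)\<bar> \<le> \<eta>))"

text \<open>
  Column \<open>j\<close> of the strictly upper triangular part of the centred adjacency matrix, set to zero
  when the points before \<open>j\<close> or the number of earlier neighbours of \<open>j\<close> are exceptional.
\<close>

definition col :: "nat \<Rightarrow> (nat \<Rightarrow> nat \<Rightarrow> real) \<Rightarrow> nat \<Rightarrow> real" where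
  "col j X i = of_bool (i \<in> {1..<j}) * of_bool (orth j X) * of_bool ((\<Sum>k\<in>{1..<j}. adj X k j) \<le> 9 * (n * p)) * (adj X i j - p)"

lemma measurable_col:
  assumes "j \<in> {1..n}" "i \<in> {1..n}"
  shows "(\<lambda>X. col j X i) \<in> borel_measurable P"
proof -
  have [measurable]: "Measurable.pred P (orth j)"
  proof -
    have 1: "Measurable.pred P (\<lambda>X. dot d (X i) (X i) = 1)" if "i \<in> {1..<j}" for i
    proof -
      have [measurable]: "(\<lambda>X. dot d (X i) (X i)) \<in> borel_measurable P"
        using that assms by (intro measurable_point_dot) auto
      show ?thesis by measurable
    qed
    have 2: "Measurable.pred P (\<lambda>X. \<bar>dot d (X i) (X k)\<bar> \<le> \<eta>)" if "i \<in> {1..<j}" "k \<in> {1..<j}" for i k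
    proof -
      have [measurable]: "(\<lambda>X. dot d (X i) (X k)) \<in> borel_measurable P"
        using that assms by (intro measurable_point_dot) auto
      show ?thesis by measurable
    qed
    show ?thesis unfolding orth_def
      by (intro pred_intros_finite pred_intros_logic 1 2) auto
  qed
  have [measurable]: "(\<lambda>X. \<Sum>k\<in>{1..<j}. adj X k j) \<in> borel_measurable P"
    using assms by (intro borel_measurable_sum measurable_adj) auto
  have [measurable]: "(\<lambda>X. adj X i j) \<in> borel_measurable P" by (rule measurable_adj) (use assms in auto)
  show ?thesis unfolding col_def by measurable
qed

lemma orth_update: "j \<le> k \<Longrightarrow> orth j (X(k := x)) = orth j X"
  by (auto simp: orth_def)

lemma col_adapted: "l < j \<Longrightarrow> col l (X(j := x)) = col l X"
  by (intro ext) (auto simp: col_def orth_update adj_def intro!: arg_cong[of _ _ "\<lambda>b. b \<le> _"] sum.cong)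

text \<open>(a - p)^2 \<le> a + p for a in {0, 1}. The cutoff bounds the sum of the a by 9 n p, and
  the terms p add at most n p.\<close>

lemma col_bound: "j \<in> {1..n} \<Longrightarrow> ip {1..n} (col j X) (col j X) \<le> 10 * (n * p)"
proof (cases "orth j X \<and> (\<Sum>k\<in>{1..<j}. adj X k j) \<le> 9 * (n * p)")
  case True
  assume j: "j \<in> {1..n}"
  have "ip {1..n} (col j X) (col j X) = (\<Sum>i\<in>{1..n}. of_bool (i \<in> {1..<j}) * (adj X i j - p)\<^sup>2)"
    using True unfolding ip_def by (intro sum.cong refl) (auto simp: col_def power2_eq_square)
  also have "\<dots> = (\<Sum>i\<in>{1..<j}. (adj X i j - p)\<^sup>2)"
    using j by (intro sum.mono_neutral_cong_right) auto
  also have "\<dots> \<le> (\<Sum>i\<in>{1..<j}. adj X i j + p)"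
  proof (rule sum_mono)
    fix i
    have "(adj X i j - p)\<^sup>2 = (adj X i j)\<^sup>2 - 2 * p * adj X i j + p * p" by (simp add: power2_eq_square algebra_simps)
    also have "\<dots> \<le> adj X i j - 0 + p * 1"
      unfolding adj_01(3) using p_pos p_less_1 adj_01(1)[of X i j] by (intro add_mono diff_mono mult_left_mono) auto
    finally show "(adj X i j - p)\<^sup>2 \<le> adj X i j + p" by simp
  qed
  also have "\<dots> = (\<Sum>i\<in>{1..<j}. adj X i j) + real (j - 1) * p" by (simp add: sum.distrib)
  also have "\<dots> \<le> 9 * (n * p) + n * p" using True j p_pos by (intro add_mono mult_right_mono) auto
  finally show ?thesis by (simp add: mult.commute)
next
  case False
  then have "ip {1..n} (col j X) (col j X) = 0" by (auto simp: ip_def col_def)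
  then show ?thesis using p_pos by simp
qed

text \<open>The covariances are at most p + 16 \<delta> p^2 in modulus on the diagonal and 16
  \<delta> p^2 off it. The quadratic form is therefore at most p |y|^2 plus 16 \<delta> p^2 times
  the squared l1 norm of y, and Cauchy-Schwarz turns the latter into n |y|^2.\<close>

lemma centred_cap_second_moment:
  fixes U :: "nat \<Rightarrow> nat \<Rightarrow> real" and y :: "nat \<Rightarrow> real"
  assumes J: "finite J" "card J \<le> n" and unit: "\<And>i. i \<in> J \<Longrightarrow> dot d (U i) (U i) = 1"
    and orth: "\<And>i k. i \<in> J \<Longrightarrow> k \<in> J \<Longrightarrow> i \<noteq> k \<Longrightarrow> \<bar>dot d (U i) (U k)\<bar> \<le> \<eta>"
  shows "(\<integral>\<^sup>+ x. ennreal ((\<Sum>i\<in>J. y i * (of_bool (t \<le> dot d (U i) x) - p))\<^sup>2) \<partial>uniform_sphere d) \<le>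
    ennreal ((p + 16 * \<delta> * (n * p\<^sup>2)) * (\<Sum>i\<in>J. (y i)\<^sup>2))"
proof -
  let ?M = "uniform_sphere d"
  define b :: "nat \<Rightarrow> (nat \<Rightarrow> real) \<Rightarrow> real" where "b i x = of_bool (t \<le> dot d (U i) x)" for i x
  have bm [measurable]: "b i \<in> borel_measurable ?M" for i unfolding b_def by measurable
  have int: "integrable ?M (\<lambda>x. (b i x - p) * (b k x - p))" for i k
  proof (rule sphere.integrable_const_bound[where B = 1])
    have "\<bar>b i x - p\<bar> * \<bar>b k x - p\<bar> \<le> 1 * 1" for x
      using p_pos p_less_1 by (intro mult_mono) (auto simp: b_def abs_le_iff)
    then show "AE x in ?M. norm ((b i x - p) * (b k x - p)) \<le> 1" by (simp add: abs_mult)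
  qed measurable
  have ib: "integrable ?M (\<lambda>x. b i x * b k x)" "integrable ?M (b i)" for i k
    by (rule sphere.integrable_const_bound[where B = 1]; (simp add: b_def)?; measurable)+
  define G where "G i k = measure ?M {x \<in> space ?M. t \<le> dot d (U i) x \<and> t \<le> dot d (U k) x}" for i k
  have Eb: "(\<integral>x. b i x \<partial>?M) = p" if "i \<in> J" for i
  proof -
    have "(\<integral>x. b i x \<partial>?M) = (\<integral>x. indicator {x \<in> space ?M. t \<le> dot d (U i) x} x \<partial>?M)"
      by (intro Bochner_Integration.integral_cong refl) (auto simp: b_def indicator_def)
    also have "\<dots> = measure ?M {x \<in> space ?M. t \<le> dot d (U i) x}"
      by (subst Bochner_Integration.integral_indicator) (auto intro!: arg_cong2[of _ _ _ _ measure])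
    finally show ?thesis using cap_measure(1)[OF unit[OF that]] by simp
  qed
  have Ebb: "(\<integral>x. b i x * b k x \<partial>?M) = G i k" for i k
  proof -
    have "(\<integral>x. b i x * b k x \<partial>?M) = (\<integral>x. indicator {x \<in> space ?M. t \<le> dot d (U i) x \<and> t \<le> dot d (U k) x} x \<partial>?M)"
      by (intro Bochner_Integration.integral_cong refl) (auto simp: b_def indicator_def)
    also have "\<dots> = G i k"
      unfolding G_def by (subst Bochner_Integration.integral_indicator) (auto intro!: arg_cong2[of _ _ _ _ measure])
    finally show ?thesis .
  qed
  have cov: "(\<integral>x. (b i x - p) * (b k x - p) \<partial>?M) = G i k - p\<^sup>2" if "i \<in> J" "k \<in> J" for i k
  proof -
    have "(\<integral>x. (b i x - p) * (b k x - p) \<partial>?M) = (\<integral>x. b i x * b k x - p * b i x - p * b k x + p\<^sup>2 \<partial>?M)"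
      by (intro Bochner_Integration.integral_cong refl) (simp add: power2_eq_square algebra_simps)
    also have "\<dots> = G i k - p * p - p * p + p\<^sup>2"
      using ib that by (simp add: Eb Ebb sphere.prob_space)
    finally show ?thesis by (simp add: power2_eq_square)
  qed
  have diag: "G i i = p" if "i \<in> J" for i
    using cap_measure(1)[OF unit[OF that]] by (simp add: G_def)
  have entry: "\<bar>G i k - p\<^sup>2\<bar> \<le> of_bool (i = k) * p + 16 * \<delta> * p\<^sup>2" if "i \<in> J" "k \<in> J" for i k
  proof (cases "i = k")
    case True
    have "p\<^sup>2 \<le> p * 1" unfolding power2_eq_square using p_pos p_less_1 by (intro mult_left_mono) auto
    moreover have "0 \<le> 16 * \<delta> * p\<^sup>2" "0 \<le> p\<^sup>2" using \<delta> by simp_all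
    ultimately have "\<bar>p - p\<^sup>2\<bar> \<le> p + 16 * \<delta> * p\<^sup>2" by linarith
    then show ?thesis using True diag[OF that(2)] by simp
  next
    case False
    then show ?thesis using cap_pair_measure[OF unit unit orth] that by (simp add: G_def)
  qed
  have expand: "(\<Sum>i\<in>J. y i * (b i x - p))\<^sup>2 = (\<Sum>i\<in>J. \<Sum>k\<in>J. (y i * y k) * ((b i x - p) * (b k x - p)))" for x
    unfolding power2_eq_square sum_product by (simp add: mult_ac)
  have intS: "integrable ?M (\<lambda>x. (\<Sum>i\<in>J. y i * (b i x - p))\<^sup>2)"
    unfolding expand by (intro Bochner_Integration.integrable_sum integrable_mult_right int)
  have "(\<integral>x. (\<Sum>i\<in>J. y i * (b i x - p))\<^sup>2 \<partial>?M) = (\<Sum>i\<in>J. \<Sum>k\<in>J. (y i * y k) * (G i k - p\<^sup>2))"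
    unfolding expand by (subst Bochner_Integration.integral_sum, intro Bochner_Integration.integrable_sum integrable_mult_right int,
        intro sum.cong refl, subst Bochner_Integration.integral_sum, intro integrable_mult_right int,
        intro sum.cong refl) (simp add: cov)
  also have "\<dots> \<le> (\<Sum>i\<in>J. \<Sum>k\<in>J. (\<bar>y i\<bar> * \<bar>y k\<bar>) * (of_bool (i = k) * p + 16 * \<delta> * p\<^sup>2))"
  proof (intro sum_mono)
    fix i k assume "i \<in> J" "k \<in> J"
    have "(y i * y k) * (G i k - p\<^sup>2) \<le> \<bar>(y i * y k) * (G i k - p\<^sup>2)\<bar>" by simp
    also have "\<dots> \<le> (\<bar>y i\<bar> * \<bar>y k\<bar>) * (of_bool (i = k) * p + 16 * \<delta> * p\<^sup>2)"
      unfolding abs_mult by (intro mult_left_mono entry \<open>i \<in> J\<close> \<open>k \<in> J\<close>) auto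
    finally show "(y i * y k) * (G i k - p\<^sup>2) \<le> (\<bar>y i\<bar> * \<bar>y k\<bar>) * (of_bool (i = k) * p + 16 * \<delta> * p\<^sup>2)" .
  qed
  also have "\<dots> = (\<Sum>i\<in>J. (y i)\<^sup>2) * p + 16 * \<delta> * p\<^sup>2 * (\<Sum>i\<in>J. \<bar>y i\<bar>)\<^sup>2"
  proof -
    define S where "S = (\<Sum>k\<in>J. \<bar>y k\<bar>)"
    have "(\<Sum>k\<in>J. (\<bar>y i\<bar> * \<bar>y k\<bar>) * (of_bool (i = k) * p + 16 * \<delta> * p\<^sup>2)) =
        (y i)\<^sup>2 * p + \<bar>y i\<bar> * (\<Sum>k\<in>J. \<bar>y k\<bar>) * (16 * \<delta> * p\<^sup>2)" if "i \<in> J" for i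
    proof -
      have "(\<Sum>k\<in>J. (\<bar>y i\<bar> * \<bar>y k\<bar>) * (of_bool (i = k) * p + 16 * \<delta> * p\<^sup>2)) =
          (\<Sum>k\<in>J. (if i = k then (y i)\<^sup>2 * p else 0) + \<bar>y i\<bar> * \<bar>y k\<bar> * (16 * \<delta> * p\<^sup>2))"
        by (intro sum.cong refl) (auto simp: distrib_left power2_eq_square)
      then show ?thesis using that J
        by (simp add: sum.distrib sum_distrib_left[symmetric] sum_distrib_right[symmetric])
    qed
    then have "(\<Sum>i\<in>J. \<Sum>k\<in>J. (\<bar>y i\<bar> * \<bar>y k\<bar>) * (of_bool (i = k) * p + 16 * \<delta> * p\<^sup>2)) =
        (\<Sum>i\<in>J. (y i)\<^sup>2 * p + \<bar>y i\<bar> * S * (16 * \<delta> * p\<^sup>2))"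
      unfolding S_def by (intro sum.cong) auto
    also have "\<dots> = (\<Sum>i\<in>J. (y i)\<^sup>2) * p + S * S * (16 * \<delta> * p\<^sup>2)"
      by (simp only: sum.distrib sum_distrib_right[symmetric] S_def[symmetric])
    finally show ?thesis by (simp only: S_def[symmetric] power2_eq_square[of S] mult_ac)
  qed
  also have "\<dots> \<le> (\<Sum>i\<in>J. (y i)\<^sup>2) * p + 16 * \<delta> * p\<^sup>2 * (n * (\<Sum>i\<in>J. (y i)\<^sup>2))"
  proof (intro add_left_mono mult_left_mono)
    have "(\<Sum>i\<in>J. 1 * \<bar>y i\<bar>)\<^sup>2 \<le> (\<Sum>i\<in>J. 1\<^sup>2) * (\<Sum>i\<in>J. \<bar>y i\<bar>\<^sup>2)" by (rule Cauchy_Schwarz_ineq_sum)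
    also have "\<dots> \<le> n * (\<Sum>i\<in>J. (y i)\<^sup>2)" using J by (simp add: mult_right_mono sum_nonneg)
    finally show "(\<Sum>i\<in>J. \<bar>y i\<bar>)\<^sup>2 \<le> n * (\<Sum>i\<in>J. (y i)\<^sup>2)" by simp
  qed (use \<delta> in auto)
  also have "\<dots> = (p + 16 * \<delta> * (n * p\<^sup>2)) * (\<Sum>i\<in>J. (y i)\<^sup>2)" by (simp add: algebra_simps)
  finally have "(\<integral>x. (\<Sum>i\<in>J. y i * (b i x - p))\<^sup>2 \<partial>?M) \<le> (p + 16 * \<delta> * (n * p\<^sup>2)) * (\<Sum>i\<in>J. (y i)\<^sup>2)" .
  moreover have "(\<integral>\<^sup>+ x. ennreal ((\<Sum>i\<in>J. y i * (b i x - p))\<^sup>2) \<partial>?M) = ennreal (\<integral>x. (\<Sum>i\<in>J. y i * (b i x - p))\<^sup>2 \<partial>?M)"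
    by (rule nn_integral_eq_integral[OF intS]) simp
  ultimately show ?thesis unfolding b_def by (simp add: ennreal_leI)
qed

text \<open>The degree cutoff depends on the resampled point x, but it multiplies the whole column
  by 0 or 1 and so can only decrease the square. The condition \<open>orth\<close> does not depend
  on x and is treated as a case distinction.\<close>

lemma col_variance:
  assumes j: "j \<in> {1..n}"
  shows "(\<integral>\<^sup>+ x. ennreal ((ip {1..n} (col j (X(j := x))) y)\<^sup>2) \<partial>uniform_sphere d) \<le>
    ennreal ((p + 16 * \<delta> * (n * p\<^sup>2)) * ip {1..n} y y)"
proof (cases "orth j X")
  case False
  then have "ip {1..n} (col j (X(j := x))) y = 0" for x
    by (simp add: ip_def col_def orth_update)
  then show ?thesis by simp
next
  case True
  have le: "(ip {1..n} (col j (X(j := x))) y)\<^sup>2 \<le> (\<Sum>i\<in>{1..<j}. y i * (of_bool (t \<le> dot d (X i) x) - p))\<^sup>2" for x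
  proof -
    define c :: real where "c = of_bool ((\<Sum>k\<in>{1..<j}. adj (X(j := x)) k j) \<le> 9 * (n * p))"
    have "ip {1..n} (col j (X(j := x))) y = (\<Sum>i\<in>{1..<j}. c * (y i * (of_bool (t \<le> dot d (X i) x) - p)))"
      unfolding ip_def using j True
      by (intro sum.mono_neutral_cong_right) (auto simp: col_def orth_update c_def adj_def)
    also have "\<dots> = c * (\<Sum>i\<in>{1..<j}. y i * (of_bool (t \<le> dot d (X i) x) - p))" by (simp add: sum_distrib_left)
    finally show ?thesis by (simp add: c_def)
  qed
  have "(\<integral>\<^sup>+ x. ennreal ((ip {1..n} (col j (X(j := x))) y)\<^sup>2) \<partial>uniform_sphere d) \<le>
      (\<integral>\<^sup>+ x. ennreal ((\<Sum>i\<in>{1..<j}. y i * (of_bool (t \<le> dot d (X i) x) - p))\<^sup>2) \<partial>uniform_sphere d)"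
    by (intro nn_integral_mono ennreal_leI le)
  also have "\<dots> \<le> ennreal ((p + 16 * \<delta> * (n * p\<^sup>2)) * (\<Sum>i\<in>{1..<j}. (y i)\<^sup>2))"
    using True j by (intro centred_cap_second_moment) (auto simp: orth_def)
  also have "\<dots> \<le> ennreal ((p + 16 * \<delta> * (n * p\<^sup>2)) * ip {1..n} y y)"
  proof (intro ennreal_leI mult_left_mono)
    have "(\<Sum>i\<in>{1..<j}. (y i)\<^sup>2) \<le> (\<Sum>i\<in>{1..n}. (y i)\<^sup>2)" using j by (intro sum_mono2) auto
    then show "(\<Sum>i\<in>{1..<j}. (y i)\<^sup>2) \<le> ip {1..n} y y" by (simp add: ip_def power2_eq_square)
  qed (use p_pos \<delta> in auto)
  finally show ?thesis .
qed

section \<open>The norm of the centred adjacency matrix\<close>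

lemma spectral_bound:
  assumes dense: "n * p \<ge> 4000000 * ln n" "n * p \<ge> 480000" and small: "\<delta> \<le> 1 / 10000000"
  obtains N where "N \<in> sets P" "measure P N \<le> 1 / n"
    "\<And>X x. X \<in> space P - N \<Longrightarrow> (\<Sum>j\<in>{1..n}. (ip {1..n} (col j X) x)\<^sup>2) \<le> (n * p / 50)\<^sup>2 * ip {1..n} x x"
proof -
  define q where "q = 2 * nat \<lceil>ln (real n)\<rceil> + 1"
  have q: "odd q" "q > 0" by (simp_all add: q_def)
  have L1: "ln (real n) \<ge> 1" using L_ge_1 by (simp add: L_def)
  have qlo: "ln n \<le> q" using L1 unfolding q_def by (simp add: of_nat_nat) linarith
  have qhi: "q \<le> 5 * ln n" using L1 unfolding q_def by (simp add: of_nat_nat) linarith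
  define lam where "lam = (n * p / 50)\<^sup>2"
  \<comment> \<open>This gives q R / lam = 1/32. With n \<sigma> \<le> lam / 96 the exponential
    factor is at most e^q, and since 1/32 \<le> e^-3 the probability is at most n e^(-2 q), hence at
    most 1 / n by q \<ge> ln n.\<close>
  define R where "R = lam / (32 * q)"
  define \<sigma> where "\<sigma> = p + 16 * \<delta> * (n * p\<^sup>2)"
  have np: "n * p > 0" using dense by linarith
  have lam: "lam > 0" unfolding lam_def using p_pos n by simp
  have R: "R > 0" using lam q by (simp add: R_def)
  have \<sigma>0: "\<sigma> \<ge> 0" using p_pos \<delta> by (simp add: \<sigma>_def)
  \<comment> \<open>10 * 32 * 5 * 2500 = 4000000: this is the constant in the hypothesis on n p / ln
    n.\<close>
  have R10: "10 * (n * p) \<le> R"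
  proof -
    have "10 * (n * p) * (32 * q) \<le> 10 * (n * p) * (32 * (5 * ln n))"
      using qhi np by (intro mult_left_mono) auto
    also have "\<dots> = n * p * (1600 * ln n)" by simp
    also have "\<dots> \<le> n * p * (n * p / 2500)" using dense np by (intro mult_left_mono) auto
    also have "\<dots> = lam" by (simp add: lam_def power2_eq_square)
    finally show ?thesis using q by (simp add: R_def field_simps)
  qed
  \<comment> \<open>96 * 2500 = 240000. Half of this budget goes to n p through n p \<ge> 480000,
    the other half to the covariances through 16 \<delta> \<le> 1 / 480000.\<close>
  have n\<sigma>: "96 * (n * \<sigma>) \<le> lam"
  proof -
    have "n * \<sigma> = n * p + 16 * \<delta> * (n * p)\<^sup>2" by (simp add: \<sigma>_def power2_eq_square algebra_simps)
    also have "\<dots> \<le> (n * p)\<^sup>2 / 480000 + 16 * (1 / 10000000) * (n * p)\<^sup>2"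
    proof (intro add_mono mult_right_mono mult_left_mono small)
      have "480000 * (n * p) \<le> n * p * (n * p)" using dense np by (intro mult_right_mono) auto
      then show "n * p \<le> (n * p)\<^sup>2 / 480000" by (simp add: power2_eq_square)
    qed auto
    also have "\<dots> \<le> (n * p)\<^sup>2 / 240000" using zero_le_power2[of "n * p"] by simp
    finally show ?thesis by (simp add: lam_def power_divide)
  qed
  obtain N where N: "N \<in> sets P" "measure P N \<le> n * (q * R / lam) ^ q * exp (3 * real n * \<sigma> / R)"
    "\<And>X x. X \<in> space P - N \<Longrightarrow> (\<Sum>j\<in>{1..n}. (ip {1..n} (col j X) x)\<^sup>2) \<le> lam * ip {1..n} x x"
  proof (rule gram_norm_concentration[of "uniform_sphere d" n col R \<sigma> q lam, folded uniform_points_def])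
    show "prob_space (uniform_sphere d)" by (rule prob_space_uniform_sphere)
    show "(\<lambda>X. col j X i) \<in> borel_measurable P" if "j \<in> {1..n}" "i \<in> {1..n}" for i j
      using that by (rule measurable_col)
    show "col l (X(j := x)) = col l X" if "l < j" for l j X x using that by (rule col_adapted)
    show "ip {1..n} (col j X) (col j X) \<le> R" if "j \<in> {1..n}" for j X
      using col_bound[OF that, of X] R10 by linarith
    show "(\<integral>\<^sup>+ x. ennreal ((ip {1..n} (col j (X(j := x))) y)\<^sup>2) \<partial>uniform_sphere d) \<le> ennreal (\<sigma> * ip {1..n} y y)"
      if "j \<in> {1..n}" for j X y
      unfolding \<sigma>_def by (rule col_variance[OF that])
  qed (use R \<sigma>0 q lam in auto)
  show ?thesis
  proof
    show "N \<in> sets P" by (rule N)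
    have qR: "q * R / lam = 1 / 32" using lam q by (simp add: R_def)
    have "3 * real n * \<sigma> / R = 96 * (n * \<sigma>) * q / lam" using lam q by (simp add: R_def field_simps)
    also have "\<dots> \<le> lam * q / lam" using n\<sigma> lam by (intro divide_right_mono mult_right_mono) auto
    also have "\<dots> = q" using lam by simp
    finally have ex: "exp (3 * real n * \<sigma> / R) \<le> exp 1 ^ q" by (simp add: exp_of_nat_mult[symmetric])
    have e3: "exp (3::real) \<le> 32"
    proof -
      have "exp (3::real) = exp 1 ^ 3" by (simp add: exp_of_nat_mult[symmetric])
      also have "\<dots> \<le> 3 ^ 3" by (intro power_mono exp_le) auto
      finally show ?thesis by simp
    qed
    have "measure P N \<le> n * (1 / 32) ^ q * exp 1 ^ q"
      using N(2) ex unfolding qR by (meson mult_left_mono order_trans of_nat_0_le_iff zero_le_power mult_nonneg_nonneg zero_le_divide_1_iff zero_le_numeral)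
    also have "\<dots> \<le> n * exp (- 3) ^ q * exp 1 ^ q"
      using e3 by (intro mult_right_mono mult_left_mono power_mono) (auto simp: exp_minus inverse_eq_divide frac_le)
    also have "\<dots> = n * exp (- 2 * real q)"
      by (simp add: exp_of_nat_mult[symmetric] exp_add[symmetric])
    also have "\<dots> \<le> n * exp (- 2 * ln n)" using qlo by (intro mult_left_mono) auto
    also have "exp (- 2 * ln (real n)) = 1 / (real n)\<^sup>2"
    proof -
      have "exp (- 2 * ln (real n)) = exp (- (2 * L))" by (simp add: L_def)
      then show ?thesis using exp_L[of 2] by simp
    qed
    also have "n * (1 / (real n)\<^sup>2) = 1 / n" by (simp add: power2_eq_square)
    finally show "measure P N \<le> 1 / n" .
    show "(\<Sum>j\<in>{1..n}. (ip {1..n} (col j X) x)\<^sup>2) \<le> (n * p / 50)\<^sup>2 * ip {1..n} x x" if "X \<in> space P - N" for X x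
      using N(3)[OF that] by (simp add: lam_def)
  qed
qed

text \<open>With U the strictly upper triangular matrix of the columns, A - p J = U + U^T - p I.
  This gives 2 n p / 50 + p, and p \<le> n p / 100 accounts for n \<ge> 100.\<close>

lemma triangular_norm_bound:
  assumes n100: "n \<ge> 100"
    and spec: "\<And>x. (\<Sum>j\<in>{1..n}. (ip {1..n} (col j X) x)\<^sup>2) \<le> (n * p / 50)\<^sup>2 * ip {1..n} x x"
    and col: "\<And>i j. j \<in> {1..n} \<Longrightarrow> i \<in> {1..n} \<Longrightarrow> col j X i = of_bool (i < j) * (adj X i j - p)"
  shows "(\<Sum>i\<in>{1..n}. \<Sum>j\<in>{1..n}. (of_bool (geometric_graph n p d X i j) - p) * x i * y j)
    \<le> n * p / 20 * sqrt (\<Sum>i\<in>{1..n}. (x i)\<^sup>2) * sqrt (\<Sum>i\<in>{1..n}. (y i)\<^sup>2)"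
proof -
  let ?I = "{1..n}"
  have CS: "(\<Sum>j\<in>?I. f j * g j) \<le> sqrt (\<Sum>j\<in>?I. (f j)\<^sup>2) * sqrt (\<Sum>j\<in>?I. (g j)\<^sup>2)" for f g :: "nat \<Rightarrow> real"
  proof -
    have "(\<Sum>j\<in>?I. f j * g j) \<le> (\<Sum>j\<in>?I. \<bar>f j\<bar> * \<bar>g j\<bar>)"
      by (intro sum_mono) (simp add: abs_mult[symmetric])
    also have "\<dots> \<le> L2_set f ?I * L2_set g ?I" by (rule L2_set_mult_ineq)
    finally show ?thesis by (simp only: L2_set_def)
  qed
  define nx where "nx = sqrt (\<Sum>i\<in>?I. (x i)\<^sup>2)"
  define ny where "ny = sqrt (\<Sum>i\<in>?I. (y i)\<^sup>2)"
  have nn: "nx \<ge> 0" "ny \<ge> 0" by (simp_all add: nx_def ny_def sum_nonneg)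
  have np: "n * p > 0" using p_pos n by simp
  have half: "sqrt (\<Sum>j\<in>?I. (ip ?I (col j X) z)\<^sup>2) \<le> n * p / 50 * sqrt (\<Sum>i\<in>?I. (z i)\<^sup>2)" for z
  proof -
    have "sqrt (\<Sum>j\<in>?I. (ip ?I (col j X) z)\<^sup>2) \<le> sqrt ((n * p / 50)\<^sup>2 * ip ?I z z)"
      using spec[of z] by (rule real_sqrt_le_mono)
    also have "\<dots> = n * p / 50 * sqrt (\<Sum>i\<in>?I. (z i)\<^sup>2)"
    proof -
      have "sqrt ((n * p / 50)\<^sup>2) = n * p / 50" using p_pos by simp
      moreover have "ip ?I z z = (\<Sum>i\<in>?I. (z i)\<^sup>2)" by (simp add: ip_def power2_eq_square)
      ultimately show ?thesis by (simp only: real_sqrt_mult)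
    qed
    finally show ?thesis .
  qed
  have entry: "(of_bool (geometric_graph n p d X i j) - p) * x i * y j =
      col j X i * x i * y j + col i X j * y j * x i - (if i = j then p * (x i * y j) else 0)"
    if "i \<in> ?I" "j \<in> ?I" for i j
  proof -
    have g: "of_bool (geometric_graph n p d X i j) = adj X i j" if "i \<noteq> j"
      using that \<open>i \<in> ?I\<close> \<open>j \<in> ?I\<close> by (auto simp: geometric_graph_def adj_def t_def)
    consider "i = j" | "i < j" | "j < i" by linarith
    then show ?thesis
    proof cases
      case 1
      then have "\<not> geometric_graph n p d X i j" by (simp add: geometric_graph_def)
      then show ?thesis using 1 that by (simp add: col)
    next
      case 2
      then show ?thesis using that by (simp add: g col)
    next
      case 3
      then show ?thesis using that by (simp add: g col adj_sym[of X i j])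
    qed
  qed
  have "(\<Sum>i\<in>?I. \<Sum>j\<in>?I. (of_bool (geometric_graph n p d X i j) - p) * x i * y j) =
     (\<Sum>i\<in>?I. \<Sum>j\<in>?I. col j X i * x i * y j) + (\<Sum>i\<in>?I. \<Sum>j\<in>?I. col i X j * y j * x i)
      - (\<Sum>i\<in>?I. \<Sum>j\<in>?I. if i = j then p * (x i * y j) else 0)"
    by (simp add: entry sum.distrib sum_subtractf)
  also have "(\<Sum>i\<in>?I. \<Sum>j\<in>?I. col j X i * x i * y j) = (\<Sum>j\<in>?I. ip ?I (col j X) x * y j)"
    by (subst sum.swap) (simp add: ip_def sum_distrib_right)
  also have "(\<Sum>i\<in>?I. \<Sum>j\<in>?I. col i X j * y j * x i) = (\<Sum>i\<in>?I. ip ?I (col i X) y * x i)"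
    by (simp add: ip_def sum_distrib_right)
  also have "(\<Sum>i\<in>?I. \<Sum>j\<in>?I. if i = j then p * (x i * y j) else 0) = - (p * (\<Sum>i\<in>?I. - x i * y i))"
    by (simp add: sum_distrib_left sum_negf)
  also have "(\<Sum>j\<in>?I. ip ?I (col j X) x * y j) + (\<Sum>i\<in>?I. ip ?I (col i X) y * x i) - - (p * (\<Sum>i\<in>?I. - x i * y i))
      \<le> n * p / 50 * nx * ny + n * p / 50 * ny * nx + p * (nx * ny)"
  proof -
    have "(\<Sum>j\<in>?I. ip ?I (col j X) x * y j) \<le> n * p / 50 * nx * ny"
      using order_trans[OF CS mult_right_mono[OF half]] nn by (simp add: nx_def ny_def)
    moreover have "(\<Sum>j\<in>?I. ip ?I (col j X) y * x j) \<le> n * p / 50 * ny * nx"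
      using order_trans[OF CS mult_right_mono[OF half]] nn by (simp add: nx_def ny_def)
    moreover have "p * (\<Sum>i\<in>?I. - x i * y i) \<le> p * (nx * ny)"
      using CS[of "\<lambda>i. - x i" y] p_pos by (intro mult_left_mono) (auto simp: nx_def ny_def)
    ultimately show ?thesis by linarith
  qed
  also have "\<dots> = (n * p / 25 + p) * (nx * ny)" by (simp add: algebra_simps)
  also have "\<dots> \<le> (n * p / 20) * (nx * ny)"
  proof (intro mult_right_mono mult_nonneg_nonneg nn)
    have "100 * p \<le> n * p" using n100 p_pos by (intro mult_right_mono) auto
    then show "n * p / 25 + p \<le> n * p / 20" by linarith
  qed
  finally show ?thesis by (simp add: nx_def ny_def mult.assoc)
qed

lemma globally_synchronizing_prob:
  assumes dense: "n * p \<ge> 4000000 * ln n" "n * p \<ge> 480000" and small: "\<delta> \<le> 1 / 10000000" and n100: "n \<ge> 100"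
  shows "measure P {X \<in> space P. globally_synchronizing n (geometric_graph n p d X)} \<ge> 1 - 3 / n"
proof -
  let ?I = "{1..n}"
  obtain N where N: "N \<in> sets P" "measure P N \<le> 1 / n"
    "\<And>X x. X \<in> space P - N \<Longrightarrow> (\<Sum>j\<in>?I. (ip ?I (col j X) x)\<^sup>2) \<le> (n * p / 50)\<^sup>2 * ip ?I x x"
    using spectral_bound[OF dense small] by blast
  define U where "U j = {X \<in> space P. 9 * (n * p) \<le> deg X j}" for j
  define W where "W j = {X \<in> space P. deg X j \<le> n * p / 4}" for j
  define Ob where "Ob z = {X \<in> space P. \<eta> < \<bar>dot d (X (fst z)) (X (snd z))\<bar>}" for z :: "nat \<times> nat"
  define Z where "Z = {X \<in> space P. \<not> (\<forall>i\<in>?I. dot d (X i) (X i) = 1)}"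
  define D where "D = {z \<in> ?I \<times> ?I. fst z \<noteq> snd z}"
  have Dfin: "finite D" unfolding D_def by simp
  have UW: "U j \<in> sets P" "W j \<in> sets P" if "j \<in> ?I" for j
  proof -
    have [measurable]: "(\<lambda>X. deg X j) \<in> borel_measurable P" by (rule measurable_deg[OF that])
    show "U j \<in> sets P" "W j \<in> sets P" unfolding U_def W_def by measurable
  qed
  have Ob: "Ob z \<in> sets P" if "z \<in> D" for z
  proof -
    have [measurable]: "(\<lambda>X. dot d (X (fst z)) (X (snd z))) \<in> borel_measurable P"
      using that by (intro measurable_point_dot) (auto simp: D_def)
    show ?thesis unfolding Ob_def by measurable
  qed
  have Z: "Z \<in> sets P" "measure P Z = 0"
  proof -
    have "{X \<in> space P. \<forall>i\<in>?I. dot d (X i) (X i) = 1} \<in> sets P"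
    proof (rule sets.sets_Collect_finite_All)
      fix i assume "i \<in> ?I"
      then have [measurable]: "(\<lambda>X. dot d (X i) (X i)) \<in> borel_measurable P" by (intro measurable_point_dot)
      show "{X \<in> space P. dot d (X i) (X i) = 1} \<in> sets P" by measurable
    qed simp
    then show Zs: "Z \<in> sets P" unfolding Z_def by (rule sets.sets_Collect_neg)
    have "AE X in P. X \<notin> Z" using AE_points_unit by eventually_elim (simp add: Z_def)
    then show "measure P Z = 0" using Zs by (subst (asm) AE_iff_measurable[OF Zs]) (auto simp: Z_def measure_def)
  qed
  \<comment> \<open>n p / 12 exceeds 3 ln n, so the union bound over n vertices leaves n^-2.\<close>
  have e: "exp (- (n * p / 12)) \<le> 1 / n ^ 3"
  proof -
    have "exp (- (n * p / 12)) \<le> exp (- (real 3 * L))" using dense L_ge_1 by (simp add: L_def)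
    also have "\<dots> = 1 / n ^ 3" by (simp only: exp_L of_nat_power)
    finally show ?thesis .
  qed
  define Bd where "Bd = N \<union> ((\<Union>j\<in>?I. U j) \<union> ((\<Union>j\<in>?I. W j) \<union> ((\<Union>z\<in>D. Ob z) \<union> Z)))"
  have sets: "(\<Union>j\<in>?I. U j) \<in> sets P" "(\<Union>j\<in>?I. W j) \<in> sets P" "(\<Union>z\<in>D. Ob z) \<in> sets P"
    using UW Ob Dfin by (auto intro!: sets.finite_UN)
  then have Bd: "Bd \<in> sets P" unfolding Bd_def using N Z by (intro sets.Un)
  have mU: "measure P (\<Union>j\<in>?I. U j) \<le> n * (1 / n ^ 3)"
  proof -
    have "measure P (\<Union>j\<in>?I. U j) \<le> (\<Sum>j\<in>?I. measure P (U j))"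
      using UW by (intro P.finite_measure_subadditive_finite) auto
    also have "\<dots> \<le> (\<Sum>j\<in>?I. 1 / n ^ 3)"
      using degree_upper e unfolding U_def by (intro sum_mono) (meson order_trans)
    finally show ?thesis by simp
  qed
  have mW: "measure P (\<Union>j\<in>?I. W j) \<le> n * (1 / n ^ 3)"
  proof -
    have "measure P (\<Union>j\<in>?I. W j) \<le> (\<Sum>j\<in>?I. measure P (W j))"
      using UW by (intro P.finite_measure_subadditive_finite) auto
    also have "\<dots> \<le> (\<Sum>j\<in>?I. 1 / n ^ 3)"
      using degree_lower e unfolding W_def by (intro sum_mono) (meson order_trans)
    finally show ?thesis by simp
  qed
  have mO: "measure P (\<Union>z\<in>D. Ob z) \<le> (real n * real n) * (4 / real n ^ 8)"
  proof -
    have "measure P (\<Union>z\<in>D. Ob z) \<le> (\<Sum>z\<in>D. measure P (Ob z))"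
      using Ob Dfin by (intro P.finite_measure_subadditive_finite) auto
    also have "\<dots> \<le> (\<Sum>z\<in>D. 4 / real n ^ 8)"
      unfolding Ob_def by (intro sum_mono points_near_orthogonal) (auto simp: D_def)
    also have "\<dots> = real (card D) * (4 / real n ^ 8)" by simp
    also have "\<dots> \<le> (real n * real n) * (4 / real n ^ 8)"
    proof (rule mult_right_mono)
      have "card D \<le> card (?I \<times> ?I)" unfolding D_def by (intro card_mono) auto
      then have "card D \<le> n * n" by simp
      then show "real (card D) \<le> real n * real n" by (metis of_nat_le_iff of_nat_mult)
    qed simp
    finally show ?thesis .
  qed
  have mBd: "measure P Bd \<le> 3 / n"
  proof -
    have "measure P Bd \<le> measure P N + (measure P (\<Union>j\<in>?I. U j) + (measure P (\<Union>j\<in>?I. W j) + (measure P (\<Union>z\<in>D. Ob z) + measure P Z)))"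
      unfolding Bd_def using sets N Z
      by (intro order_trans[OF measure_Un_le] add_left_mono sets.Un) (auto intro!: measure_Un_le)
    also have "\<dots> \<le> 1 / n + (n * (1 / n ^ 3) + (n * (1 / n ^ 3) + ((real n * real n) * (4 / real n ^ 8) + 0)))"
      using N(2) mU mW mO Z(2) by (intro add_mono) auto
    also have "\<dots> \<le> 1 / n + (1 / 4 * (1 / n) + (1 / 4 * (1 / n) + (1 / 4 * (1 / n) + 0)))"
    proof (intro add_mono order_refl)
      have "4 * n \<le> n\<^sup>2" using n100 by (simp add: power2_eq_square)
      then have n2: "4 * real n \<le> (real n)\<^sup>2" by (metis of_nat_le_iff of_nat_mult of_nat_numeral of_nat_power)
      show *: "n * (1 / n ^ 3) \<le> 1 / 4 * (1 / n)"
        using n2 n100 by (simp add: field_simps power2_eq_square power3_eq_cube)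
      then show "n * (1 / n ^ 3) \<le> 1 / 4 * (1 / n)" .
      have "real n ^ 1 \<le> real n ^ 5" using n100 by (intro power_increasing) auto
      then have "16 \<le> real n ^ 5" using n100 unfolding power_one_right by linarith
      then show "(real n * real n) * (4 / real n ^ 8) \<le> 1 / 4 * (1 / n)"
        using n100 by (simp add: field_simps numeral_eq_Suc)
    qed
    also have "\<dots> \<le> 3 / n" using n100 by (simp add: field_simps)
    finally show ?thesis .
  qed
  let ?S = "{X \<in> space P. globally_synchronizing n (geometric_graph n p d X)}"
  have good: "X \<in> ?S" if X: "X \<in> space P - Bd" for X
  proof -
    have unit: "dot d (X i) (X i) = 1" if "i \<in> ?I" for i using X that by (auto simp: Bd_def Z_def)
    have orthX: "\<bar>dot d (X i) (X k)\<bar> \<le> \<eta>" if "i \<in> ?I" "k \<in> ?I" "i \<noteq> k" for i k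
    proof -
      have "(i, k) \<in> D" using that by (simp add: D_def)
      then have "X \<notin> Ob (i, k)" using X by (auto simp: Bd_def)
      then show ?thesis using X by (auto simp: Ob_def)
    qed
    have degU: "deg X j \<le> 9 * (n * p)" if "j \<in> ?I" for j
    proof -
      have "X \<notin> U j" using X that by (auto simp: Bd_def)
      then show ?thesis using X by (auto simp: U_def)
    qed
    have degW: "n * p / 4 \<le> deg X j" if "j \<in> ?I" for j
    proof -
      have "X \<notin> W j" using X that by (auto simp: Bd_def)
      then show ?thesis using X by (auto simp: W_def)
    qed
    \<comment> \<open>Outside \<open>Bd\<close> both cutoffs are inactive, so the truncated column
      is the true one.\<close>
    have col: "col j X i = of_bool (i < j) * (adj X i j - p)" if "j \<in> ?I" "i \<in> ?I" for i j
    proof -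
      have "orth j X" using that unit orthX by (auto simp: orth_def)
      moreover have "(\<Sum>k\<in>{1..<j}. adj X k j) \<le> 9 * (n * p)"
      proof -
        have "(\<Sum>k\<in>{1..<j}. adj X k j) = (\<Sum>k\<in>{1..<j}. adj X j k)" by (simp add: adj_sym)
        also have "\<dots> \<le> deg X j"
          unfolding deg_def using that adj_01 by (intro sum_mono2) auto
        finally show ?thesis using degU[OF that(1)] by simp
      qed
      ultimately show ?thesis using that by (auto simp: col_def)
    qed
    have "globally_synchronizing n (geometric_graph n p d X)"
    proof (rule expander_globally_synchronizing)
      show "n \<ge> 1" "p > 0" using n p_pos by auto
      show "geometric_graph n p d X i j \<longleftrightarrow> geometric_graph n p d X j i" for i j
        by (auto simp: geometric_graph_def dot_commute)
      show "\<not> geometric_graph n p d X i i" for i by (simp add: geometric_graph_def)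
      show "(\<Sum>i\<in>{1..n}. \<Sum>j\<in>{1..n}. (of_bool (geometric_graph n p d X i j) - p) * x i * y j)
        \<le> n * p / 20 * sqrt (\<Sum>i\<in>{1..n}. (x i)\<^sup>2) * sqrt (\<Sum>i\<in>{1..n}. (y i)\<^sup>2)" for x y
      proof (rule triangular_norm_bound[OF n100 _ col])
        show "(\<Sum>j\<in>?I. (ip ?I (col j X) x)\<^sup>2) \<le> (n * p / 50)\<^sup>2 * ip ?I x x" for x
          using X by (intro N(3)) (auto simp: Bd_def)
      qed
      show "n * p / 4 \<le> (\<Sum>j\<in>{1..n}. of_bool (geometric_graph n p d X i j))" if "i \<in> {1..n}" for i
      proof -
        have "(\<Sum>j\<in>{1..n}. of_bool (geometric_graph n p d X i j)) = deg X i"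
          unfolding deg_def using that
          by (intro sum.mono_neutral_cong_right) (auto simp: geometric_graph_def adj_def t_def)
        then show ?thesis using degW[OF that] by simp
      qed
    qed
    then show ?thesis using X by simp
  qed
  have "1 - 3 / n \<le> 1 - measure P Bd" using mBd by simp
  also have "\<dots> = measure P (space P - Bd)" using P.prob_compl[OF Bd] by simp
  also have "\<dots> \<le> measure P ?S"
    using good by (intro P.finite_measure_mono globally_synchronizing_event) auto
  finally show ?thesis .
qed

end

section \<open>Choice of the constants\<close>

theorem theorem3:
  shows "\<forall>\<alpha>::real. \<alpha> > 0 \<longrightarrow>
    (\<exists>C\<^sub>p C\<^sub>d c :: real. C\<^sub>p > 0 \<and> C\<^sub>d > 0 \<and> c > 0 \<and>
      (\<forall>(n::nat) (d::nat) (p::real).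
         n \<ge> 1 \<longrightarrow> d \<ge> 2 \<longrightarrow>
         real d \<ge> C\<^sub>d * ((real n)\<^sup>2 * p\<^sup>2 + (ln (real n)) ^ 4) * (ln (real n)) ^ 4 \<longrightarrow>
         \<alpha> / real n < p \<longrightarrow> p < 1 / 2 \<longrightarrow>
         real n * p \<ge> C\<^sub>p * (ln (real n))\<^sup>2 \<longrightarrow>
         \<P>(X in uniform_points n d. globally_synchronizing n (geometric_graph n p d X))
           \<ge> 1 - real n powr (- c)))"
proof (intro allI impI)
  fix \<alpha> :: real
  \<comment> \<open>Already ln n \<ge> 1/2 gives n p \<ge> 2500000, and for ln n \<ge> 1 the bound n
    p \<ge> 4000000 ln n follows.\<close>
  define Cp :: real where "Cp = 10 ^ 7"
  \<comment> \<open>128 * 10^9 is 12800 / \<delta> for \<delta> = 10^-7; it is squared because the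
    locale condition concerns sqrt d.\<close>
  define Cd :: real where "Cd = (128 * 10 ^ 9)\<^sup>2"
  have main: "1 - real n powr (- (1 / 2)) \<le>
      \<P>(X in uniform_points n d. globally_synchronizing n (geometric_graph n p d X))"
    if n: "n \<ge> 1" and d: "d \<ge> 2"
      and dim: "Cd * ((real n)\<^sup>2 * p\<^sup>2 + (ln (real n)) ^ 4) * (ln (real n)) ^ 4 \<le> real d"
      and p: "p < 1 / 2" and dense: "Cp * (ln (real n))\<^sup>2 \<le> real n * p"
    for n d :: nat and p :: real
  proof (cases "n = 1")
    \<comment> \<open>For n = 1 the claimed lower bound is 1 - 1 = 0.\<close>
    case True
    then show ?thesis by simp
  next
    case False
    then have n2: "n \<ge> 2" using n by simp
    define l where "l = ln (real n)"
    have "ln (2::real) \<le> l" unfolding l_def using n2 by (subst ln_le_cancel_iff) auto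
    moreover have "ln (2::real) \<ge> 1 / 2"
      by (subst ln_ge_iff) (use exp_half_le2 in auto)
    ultimately have l12: "l \<ge> 1 / 2" by linarith
    have "(1 / 2)\<^sup>2 \<le> l\<^sup>2" using l12 by (intro power_mono) auto
    then have "10 ^ 7 * (1 / 4) \<le> Cp * l\<^sup>2" by (simp add: Cp_def power2_eq_square)
    then have np: "real n * p \<ge> 2500000" using dense by (simp add: l_def)
    \<comment> \<open>Since p < 1/2, a large n p forces n to be large.\<close>
    have nbig: "n \<ge> 100"
    proof -
      have "real n * p \<le> real n * (1 / 2)" using p by (intro mult_left_mono) auto
      then have "real n \<ge> 100" using np by linarith
      then show ?thesis by simp
    qed
    have l1: "l \<ge> 1"
    proof -
      have "exp 1 \<le> real n" using exp_le nbig by linarith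
      then show ?thesis unfolding l_def using n2 by (subst ln_ge_iff) auto
    qed
    interpret cap_regime n d p "1 / 10 ^ 7"
    proof
      show "n \<ge> 3" "d \<ge> 2" "p < 1 / 2" "0 < 1 / (10::real) ^ 7" "1 / (10::real) ^ 7 \<le> 1 / 16" using nbig d p by auto
      show "1 / real n \<le> p" using np n2 by (simp add: field_simps)
      have "real 100 ^ 6 \<le> real n ^ 6" using nbig by (intro power_mono) auto
      then have "8 / real n ^ 6 \<le> 8 / real 100 ^ 6" using nbig by (intro divide_left_mono) auto
      then show "8 / real n ^ 6 \<le> 1 / 10 ^ 7" by simp
      have "(128 * 10 ^ 9 * (l * sqrt l))\<^sup>2 = Cd * (l ^ 3 * 1)"
        using l1 by (simp add: Cd_def power_mult_distrib power2_eq_square power3_eq_cube)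
      also have "\<dots> \<le> Cd * (l ^ 4 * l ^ 4)"
        using l1 by (intro mult_left_mono mult_mono power_increasing) (auto simp: Cd_def)
      also have "\<dots> \<le> Cd * (((real n)\<^sup>2 * p\<^sup>2 + l ^ 4) * l ^ 4)"
        using l1 by (intro mult_left_mono mult_right_mono) (auto simp: Cd_def)
      also have "\<dots> \<le> real d" using dim by (simp add: l_def mult.assoc)
      finally have "128 * 10 ^ 9 * (l * sqrt l) \<le> sqrt (real d)"
        using real_le_rsqrt by blast
      then show "12800 * (ln (real n) * sqrt (ln (real n))) \<le> 1 / 10 ^ 7 * sqrt (real d)"
        by (simp add: l_def)
    qed
    have "l * 1 \<le> l * l" using l1 by (intro mult_left_mono) auto
    then have "4000000 * l \<le> Cp * l\<^sup>2" using l1 by (simp add: Cp_def power2_eq_square)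
    then have "1 - 3 / n \<le> measure (uniform_points n d) {X \<in> space (uniform_points n d). globally_synchronizing n (geometric_graph n p d X)}"
      using dense np nbig by (intro globally_synchronizing_prob) (auto simp: l_def)
    \<comment> \<open>The failure probability 3 / n is below n^(-1/2) as soon as sqrt n \<ge> 3, so
      c = 1/2 is admissible.\<close>
    moreover have "3 / real n \<le> real n powr (- (1 / 2))"
    proof -
      have "3 \<le> sqrt (real n)" using nbig by (intro real_le_rsqrt) auto
      then have "3 / real n \<le> sqrt (real n) / real n" by (intro divide_right_mono) auto
      also have "\<dots> = 1 / sqrt (real n)" using nbig by (simp add: field_simps)
      also have "\<dots> = real n powr (- (1 / 2))" using nbig by (simp add: powr_minus powr_half_sqrt inverse_eq_divide)
      finally show ?thesis .
    qed
    ultimately show ?thesis by linarith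
  qed
  show "\<exists>C\<^sub>p C\<^sub>d c :: real. C\<^sub>p > 0 \<and> C\<^sub>d > 0 \<and> c > 0 \<and>
      (\<forall>(n::nat) (d::nat) (p::real).
         n \<ge> 1 \<longrightarrow> d \<ge> 2 \<longrightarrow>
         real d \<ge> C\<^sub>d * ((real n)\<^sup>2 * p\<^sup>2 + (ln (real n)) ^ 4) * (ln (real n)) ^ 4 \<longrightarrow>
         \<alpha> / real n < p \<longrightarrow> p < 1 / 2 \<longrightarrow>
         real n * p \<ge> C\<^sub>p * (ln (real n))\<^sup>2 \<longrightarrow>
         \<P>(X in uniform_points n d. globally_synchronizing n (geometric_graph n p d X))
           \<ge> 1 - real n powr (- c))"
    by (rule exI[of _ Cp], rule exI[of _ Cd], rule exI[of _ "1 / 2"]) (use main in \<open>auto simp: Cp_def Cd_def\<close>)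
qed

end
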